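(* Let $(\mathrm{A},.)$ be a finite dimensional real symmetric Leibniz algebra which is not a Lie algebra, let $[u,v]=u.v-v.u$, and let $G$ be any connected Lie group whose Lie algebra is $(\mathrm{A},[\,,\,])$. Then the left invariant linear connection $\nabla$ on $G$ given by $$\nabla_{u^+}v^+=(u.v)^+,\qquad u,v\in\mathrm{A},$$ is different from $\nabla^0$, is strongly special, and its curvature is parallel (with respect to $\nabla$).
   Context: $(\mathrm{A},.)$ is a symmetric Leibniz algebra if for every $u\in\mathrm{A}$ both left multiplication $v\mapsto u.v$ and right multiplication $v\mapsto v.u$ are derivations of $(\mathrm{A},.)$; in that case $(\mathrm{A},[\,,\,])$ with $[u,v]=u.v-v.u$ is a Lie algebra. "Not a Lie algebra" means that the product "$.$" itself is not a Lie bracket. For $u\in\mathfrak{g}=T_eG$, $u^+$ is the left invariant vector field on $G$ with $u^+(e)=u$. $\nabla^0$ is the left invariant linear connection given by $\nabla^0_{u^+}v^+=\frac12[u^+,v^+]$; its holonomy Lie algebra at $e$ is $\mathrm{ad}_{[\mathfrak{g},\mathfrak{g}]}$. A linear connection on $G$ is bi-invariant if invariant under all left and right multiplications. The curvature is $K^\nabla(X,Y)=[\nabla_X,\nabla_Y]-\nabla_{[X,Y]}$. A special connection is a torsion free bi-invariant linear connection with the same curvature as $\nabla^0$; it is strongly special if moreover it has the same holonomy Lie algebra (at $e$) as $\nabla^0$. The holonomy Lie algebra at $e$ of a left invariant connection $\nabla$ is the smallest Lie subalgebra $\mathfrak{h}\subset\mathrm{End}(\mathfrak{g})$ containing all $K^\nabla(u,v)$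 and satisfying $[\mathrm{L}_u,\mathfrak{h}]\subset\mathfrak{h}$ for all $u\in\mathfrak{g}$, where $\mathrm{L}_uv=(\nabla_{u^+}v^+)(e)$. *)

theory Defs
  imports "HOL-Analysis.Analysis" "HOL-Algebra.Group" "HOL-Library.Function_Algebras"
begin

section \<open>Symmetric Leibniz algebras\<close>

definition is_derivation :: "('a::real_vector \<Rightarrow> 'a \<Rightarrow> 'a) \<Rightarrow> ('a \<Rightarrow> 'a) \<Rightarrow> bool" where
  "is_derivation m d \<longleftrightarrow> linear d \<and> (\<forall>v w. d (m v w) = m (d v) w + m v (d w))"

definition symmetric_leibniz_algebra :: "('a::real_vector \<Rightarrow> 'a \<Rightarrow> 'a) \<Rightarrow> bool" where
  "symmetric_leibniz_algebra m \<longleftrightarrow>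
     bilinear m \<and> (\<forall>u. is_derivation m (\<lambda>v. m u v) \<and> is_derivation m (\<lambda>v. m v u))"

definition is_lie_algebra :: "('a::real_vector \<Rightarrow> 'a \<Rightarrow> 'a) \<Rightarrow> bool" where
  "is_lie_algebra m \<longleftrightarrow>
     bilinear m \<and> (\<forall>u. m u u = 0) \<and>
     (\<forall>u v w. m u (m v w) + m v (m w u) + m w (m u v) = 0)"


section \<open>Smooth manifolds\<close>

text \<open>\<open>Ck_on k f S\<close> says that \<open>f\<close> is \<open>k\<close> times continuously differentiable on \<open>S\<close>.
  It is meant for open \<open>S\<close> and a finite dimensional domain: the derivatives are taken
  in the full space, and the higher ones are those of all directional derivatives.\<close>

primrec Ck_on ::
    "nat \<Rightarrow> ('e::real_normed_vector \<Rightarrow> 'f::real_normed_vector) \<Rightarrow> 'e set \<Rightarrow> bool" where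
  "Ck_on 0 f S \<longleftrightarrow> continuous_on S f"
| "Ck_on (Suc k) f S \<longleftrightarrow>
     (\<forall>x\<in>S. f differentiable (at x)) \<and>
     (\<forall>w. Ck_on k (\<lambda>x. frechet_derivative f (at x) w) S)"

definition smooth_on ::
    "('e::real_normed_vector \<Rightarrow> 'f::real_normed_vector) \<Rightarrow> 'e set \<Rightarrow> bool" where
  "smooth_on f S \<longleftrightarrow> (\<forall>k. Ck_on k f S)"

text \<open>A manifold is a whole type \<open>'g\<close> with its type class topology. A chart is a pair
  \<open>(U, \<phi>)\<close>; only the values of \<open>\<phi>\<close> on \<open>U\<close> matter. Atlases need not be maximal.\<close>

type_synonym ('g, 'e) atlas = "('g set \<times> ('g \<Rightarrow> 'e)) set"

definition smooth_atlas ::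
    "('g::topological_space, 'e::euclidean_space) atlas \<Rightarrow> bool" where
  "smooth_atlas A \<longleftrightarrow>
     (\<Union>(U, \<phi>)\<in>A. U) = UNIV \<and>
     (\<forall>(U, \<phi>)\<in>A. open U \<and> open (\<phi> ` U) \<and> homeomorphism U (\<phi> ` U) \<phi> (inv_into U \<phi>)) \<and>
     (\<forall>(U, \<phi>)\<in>A. \<forall>(V, \<psi>)\<in>A. smooth_on (\<psi> \<circ> inv_into U \<phi>) (\<phi> ` (U \<inter> V)))"

definition product_atlas ::
    "('g, 'e) atlas \<Rightarrow> ('h, 'f) atlas \<Rightarrow> ('g \<times> 'h, 'e \<times> 'f) atlas" where
  "product_atlas A B = {(U \<times> V, map_prod \<phi> \<psi>) |U \<phi> V \<psi>. (U, \<phi>) \<in> A \<and> (V, \<psi>) \<in> B}"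

definition smooth_map ::
    "('g::topological_space, 'e::euclidean_space) atlas \<Rightarrow>
     ('h::topological_space, 'f::euclidean_space) atlas \<Rightarrow> ('g \<Rightarrow> 'h) \<Rightarrow> bool" where
  "smooth_map A B F \<longleftrightarrow>
     continuous_on UNIV F \<and>
     (\<forall>(U, \<phi>)\<in>A. \<forall>(V, \<psi>)\<in>B. smooth_on (\<psi> \<circ> F \<circ> inv_into U \<phi>) (\<phi> ` (U \<inter> F -` V)))"

definition smooth_functions :: "('g, 'e::euclidean_space) atlas \<Rightarrow> ('g \<Rightarrow> real) set" where
  "smooth_functions A = {f. \<forall>(U, \<phi>)\<in>A. smooth_on (f \<circ> inv_into U \<phi>) (\<phi> ` U)}"

text \<open>Tangent vectors act on smooth functions: those at \<open>p\<close> are the operators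
  \<open>\<Sum>\<^sub>i w\<^sub>i \<partial>/\<partial>x\<^sub>i\<close> at \<open>p\<close> in the coordinates of a chart around \<open>p\<close>. All of them vanish
  on functions that are not smooth, so that equality of tangent vectors is equality
  of functionals.\<close>

type_synonym 'g tvec = "('g \<Rightarrow> real) \<Rightarrow> real"

definition chart_vector ::
    "('g, 'e::euclidean_space) atlas \<Rightarrow> 'g set \<Rightarrow> ('g \<Rightarrow> 'e) \<Rightarrow> 'g \<Rightarrow> 'e \<Rightarrow> 'g tvec" where
  "chart_vector A U \<phi> p w =
     (\<lambda>f. if f \<in> smooth_functions A
          then frechet_derivative (f \<circ> inv_into U \<phi>) (at (\<phi> p)) w else 0)"

definition tangent_space :: "('g, 'e::euclidean_space) atlas \<Rightarrow> 'g \<Rightarrow> 'g tvec set" where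
  "tangent_space A p = {chart_vector A U \<phi> p w |U \<phi> w. (U, \<phi>) \<in> A \<and> p \<in> U}"

type_synonym 'g vfield = "'g \<Rightarrow> 'g tvec"

definition vector_fields :: "('g, 'e::euclidean_space) atlas \<Rightarrow> 'g vfield set" where
  "vector_fields A =
     {X. (\<forall>p. X p \<in> tangent_space A p) \<and>
         (\<forall>f\<in>smooth_functions A. (\<lambda>p. X p f) \<in> smooth_functions A)}"

text \<open>Sums and differences of tangent vectors, vector fields and endomorphisms are the
  pointwise ones of \<^theory>\<open>HOL-Library.Function_Algebras\<close>.\<close>

definition vf_scale :: "('g \<Rightarrow> real) \<Rightarrow> 'g vfield \<Rightarrow> 'g vfield" where
  "vf_scale f X = (\<lambda>p h. f p * X p h)"

definition vf_bracket :: "'g vfield \<Rightarrow> 'g vfield \<Rightarrow> 'g vfield" where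
  "vf_bracket X Y = (\<lambda>p f. X p (\<lambda>q. Y q f) - Y p (\<lambda>q. X q f))"

text \<open>Only for diffeomorphisms \<open>F\<close>: then \<open>f \<circ> F\<close> is smooth iff \<open>f\<close> is, so the result again
  vanishes on functions that are not smooth.\<close>

definition vf_push :: "('g \<Rightarrow> 'g) \<Rightarrow> 'g vfield \<Rightarrow> 'g vfield" where
  "vf_push F X = (\<lambda>q f. X (inv_into UNIV F q) (f \<circ> F))"


section \<open>Linear connections\<close>

text \<open>A connection is set to \<open>0\<close> outside the vector fields, so that equality
  of connections is equality of functions.\<close>

definition linear_connection ::
    "('g, 'e::euclidean_space) atlas \<Rightarrow> ('g vfield \<Rightarrow> 'g vfield \<Rightarrow> 'g vfield) \<Rightarrow> bool" where
  "linear_connection A D \<longleftrightarrow>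
     (\<forall>X\<in>vector_fields A. \<forall>Y\<in>vector_fields A. D X Y \<in> vector_fields A) \<and>
     (\<forall>X\<in>vector_fields A. \<forall>X'\<in>vector_fields A. \<forall>Y\<in>vector_fields A.
        D (X + X') Y = D X Y + D X' Y) \<and>
     (\<forall>f\<in>smooth_functions A. \<forall>X\<in>vector_fields A. \<forall>Y\<in>vector_fields A.
        D (vf_scale f X) Y = vf_scale f (D X Y)) \<and>
     (\<forall>X\<in>vector_fields A. \<forall>Y\<in>vector_fields A. \<forall>Y'\<in>vector_fields A.
        D X (Y + Y') = D X Y + D X Y') \<and>
     (\<forall>f\<in>smooth_functions A. \<forall>X\<in>vector_fields A. \<forall>Y\<in>vector_fields A.
        D X (vf_scale f Y) = vf_scale (\<lambda>p. X p f) Y + vf_scale f (D X Y)) \<and>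
     (\<forall>X Y. X \<notin> vector_fields A \<or> Y \<notin> vector_fields A \<longrightarrow> D X Y = 0)"

definition torsion_free ::
    "('g, 'e::euclidean_space) atlas \<Rightarrow> ('g vfield \<Rightarrow> 'g vfield \<Rightarrow> 'g vfield) \<Rightarrow> bool" where
  "torsion_free A D \<longleftrightarrow>
     (\<forall>X\<in>vector_fields A. \<forall>Y\<in>vector_fields A. D X Y - D Y X = vf_bracket X Y)"

definition curvature ::
    "('g vfield \<Rightarrow> 'g vfield \<Rightarrow> 'g vfield) \<Rightarrow> 'g vfield \<Rightarrow> 'g vfield \<Rightarrow> 'g vfield \<Rightarrow> 'g vfield" where
  "curvature D X Y Z = D X (D Y Z) - D Y (D X Z) - D (vf_bracket X Y) Z"

definition same_curvature ::
    "('g, 'e::euclidean_space) atlas \<Rightarrow> ('g vfield \<Rightarrow> 'g vfield \<Rightarrow> 'g vfield) \<Rightarrow>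
     ('g vfield \<Rightarrow> 'g vfield \<Rightarrow> 'g vfield) \<Rightarrow> bool" where
  "same_curvature A D D' \<longleftrightarrow>
     (\<forall>X\<in>vector_fields A. \<forall>Y\<in>vector_fields A. \<forall>Z\<in>vector_fields A.
        curvature D X Y Z = curvature D' X Y Z)"

definition parallel_curvature ::
    "('g, 'e::euclidean_space) atlas \<Rightarrow> ('g vfield \<Rightarrow> 'g vfield \<Rightarrow> 'g vfield) \<Rightarrow> bool" where
  "parallel_curvature A D \<longleftrightarrow>
     (\<forall>W\<in>vector_fields A. \<forall>X\<in>vector_fields A. \<forall>Y\<in>vector_fields A. \<forall>Z\<in>vector_fields A.
        D W (curvature D X Y Z) - curvature D (D W X) Y Z
          - curvature D X (D W Y) Z - curvature D X Y (D W Z) = 0)"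

definition invariant_under ::
    "('g, 'e::euclidean_space) atlas \<Rightarrow> ('g \<Rightarrow> 'g) \<Rightarrow>
     ('g vfield \<Rightarrow> 'g vfield \<Rightarrow> 'g vfield) \<Rightarrow> bool" where
  "invariant_under A F D \<longleftrightarrow>
     (\<forall>X\<in>vector_fields A. \<forall>Y\<in>vector_fields A.
        vf_push F (D X Y) = D (vf_push F X) (vf_push F Y))"


section \<open>Lie groups\<close>

definition lie_group ::
    "('g::{t2_space,second_countable_topology}) monoid \<Rightarrow>
     ('g, 'e::euclidean_space) atlas \<Rightarrow> bool" where
  "lie_group G A \<longleftrightarrow>
     group G \<and> carrier G = UNIV \<and> smooth_atlas A \<and>
     smooth_map (product_atlas A A) A (\<lambda>(x, y). x \<otimes>\<^bsub>G\<^esub> y) \<and>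
     smooth_map A A (\<lambda>x. inv\<^bsub>G\<^esub> x)"

text \<open>The field \<open>u\<^sup>+\<close> with \<open>u\<^sup>+(e) = u\<close>, that is \<open>u\<^sup>+(p) = dL\<^sub>p(u)\<close>.\<close>

definition left_field :: "'g monoid \<Rightarrow> 'g tvec \<Rightarrow> 'g vfield" where
  "left_field G u = (\<lambda>p f. u (\<lambda>x. f (p \<otimes>\<^bsub>G\<^esub> x)))"

text \<open>\<open>\<iota>\<close> identifies the algebra \<open>('a, br)\<close> with the Lie algebra of \<open>G\<close>, which is the
  tangent space at \<open>e\<close> with the bracket \<open>[u, v] = [u\<^sup>+, v\<^sup>+](e)\<close>.\<close>

definition lie_algebra_identification ::
    "'g monoid \<Rightarrow> ('g, 'e::euclidean_space) atlas \<Rightarrow> ('a::real_vector \<Rightarrow> 'a \<Rightarrow> 'a) \<Rightarrow>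
     ('a \<Rightarrow> 'g tvec) \<Rightarrow> bool" where
  "lie_algebra_identification G A br \<iota> \<longleftrightarrow>
     bij_betw \<iota> UNIV (tangent_space A \<one>\<^bsub>G\<^esub>) \<and>
     (\<forall>u v. \<iota> (u + v) = \<iota> u + \<iota> v) \<and>
     (\<forall>c u. \<iota> (c *\<^sub>R u) = (\<lambda>f. c * \<iota> u f)) \<and>
     (\<forall>u v. \<iota> (br u v) = vf_bracket (left_field G (\<iota> u)) (left_field G (\<iota> v)) \<one>\<^bsub>G\<^esub>)"

definition left_invariant_connection ::
    "'g monoid \<Rightarrow> ('g, 'e::euclidean_space) atlas \<Rightarrow>
     ('g vfield \<Rightarrow> 'g vfield \<Rightarrow> 'g vfield) \<Rightarrow> bool" where
  "left_invariant_connection G A D \<longleftrightarrow>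
     linear_connection A D \<and> (\<forall>g. invariant_under A (\<lambda>x. g \<otimes>\<^bsub>G\<^esub> x) D)"

definition bi_invariant_connection ::
    "'g monoid \<Rightarrow> ('g, 'e::euclidean_space) atlas \<Rightarrow>
     ('g vfield \<Rightarrow> 'g vfield \<Rightarrow> 'g vfield) \<Rightarrow> bool" where
  "bi_invariant_connection G A D \<longleftrightarrow>
     linear_connection A D \<and>
     (\<forall>g. invariant_under A (\<lambda>x. g \<otimes>\<^bsub>G\<^esub> x) D) \<and>
     (\<forall>g. invariant_under A (\<lambda>x. x \<otimes>\<^bsub>G\<^esub> g) D)"

text \<open>On a Lie group the description determines \<open>\<nabla>\<^sup>0\<close>, because the left invariant fields
  contain a global frame.\<close>

definition nabla0 ::
    "'g monoid \<Rightarrow> ('g, 'e::euclidean_space) atlas \<Rightarrow> 'g vfield \<Rightarrow> 'g vfield \<Rightarrow> 'g vfield" where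
  "nabla0 G A =
     (THE D. left_invariant_connection G A D \<and>
        (\<forall>u\<in>tangent_space A \<one>\<^bsub>G\<^esub>. \<forall>v\<in>tangent_space A \<one>\<^bsub>G\<^esub>.
           D (left_field G u) (left_field G v) =
             vf_scale (\<lambda>_. 1/2) (vf_bracket (left_field G u) (left_field G v))))"


section \<open>Holonomy of left invariant connections\<close>

text \<open>Endomorphisms of a space \<open>V\<close> of tangent vectors are functions that vanish
  outside \<open>V\<close>.\<close>

definition endomorphisms :: "'g tvec set \<Rightarrow> ('g tvec \<Rightarrow> 'g tvec) set" where
  "endomorphisms V =
     {S. (\<forall>v\<in>V. S v \<in> V) \<and>
         (\<forall>v\<in>V. \<forall>w\<in>V. S (v + w) = S v + S w) \<and>
         (\<forall>c. \<forall>v\<in>V. S (\<lambda>f. c * v f) = (\<lambda>f. c * S v f)) \<and>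
         (\<forall>v. v \<notin> V \<longrightarrow> S v = 0)}"

definition commutator ::
    "('g tvec \<Rightarrow> 'g tvec) \<Rightarrow> ('g tvec \<Rightarrow> 'g tvec) \<Rightarrow> 'g tvec \<Rightarrow> 'g tvec" where
  "commutator S T = (\<lambda>v. S (T v) - T (S v))"

definition lie_subalgebra_End ::
    "'g tvec set \<Rightarrow> ('g tvec \<Rightarrow> 'g tvec) set \<Rightarrow> bool" where
  "lie_subalgebra_End V \<h> \<longleftrightarrow>
     \<h> \<subseteq> endomorphisms V \<and> 0 \<in> \<h> \<and>
     (\<forall>S\<in>\<h>. \<forall>T\<in>\<h>. S + T \<in> \<h> \<and> commutator S T \<in> \<h>) \<and>
     (\<forall>c. \<forall>S\<in>\<h>. (\<lambda>v f. c * S v f) \<in> \<h>)"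

definition left_mult_End ::
    "'g monoid \<Rightarrow> ('g, 'e::euclidean_space) atlas \<Rightarrow>
     ('g vfield \<Rightarrow> 'g vfield \<Rightarrow> 'g vfield) \<Rightarrow> 'g tvec \<Rightarrow> 'g tvec \<Rightarrow> 'g tvec" where
  "left_mult_End G A D u =
     (\<lambda>v. if v \<in> tangent_space A \<one>\<^bsub>G\<^esub> then D (left_field G u) (left_field G v) \<one>\<^bsub>G\<^esub> else 0)"

definition curvature_End ::
    "'g monoid \<Rightarrow> ('g, 'e::euclidean_space) atlas \<Rightarrow>
     ('g vfield \<Rightarrow> 'g vfield \<Rightarrow> 'g vfield) \<Rightarrow> 'g tvec \<Rightarrow> 'g tvec \<Rightarrow> 'g tvec \<Rightarrow> 'g tvec" where
  "curvature_End G A D u v =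
     (\<lambda>w. if w \<in> tangent_space A \<one>\<^bsub>G\<^esub>
          then curvature D (left_field G u) (left_field G v) (left_field G w) \<one>\<^bsub>G\<^esub> else 0)"

definition holonomy_algebra ::
    "'g monoid \<Rightarrow> ('g, 'e::euclidean_space) atlas \<Rightarrow>
     ('g vfield \<Rightarrow> 'g vfield \<Rightarrow> 'g vfield) \<Rightarrow> ('g tvec \<Rightarrow> 'g tvec) set" where
  "holonomy_algebra G A D =
     \<Inter> {\<h>. lie_subalgebra_End (tangent_space A \<one>\<^bsub>G\<^esub>) \<h> \<and>
         (\<forall>u\<in>tangent_space A \<one>\<^bsub>G\<^esub>. \<forall>v\<in>tangent_space A \<one>\<^bsub>G\<^esub>. curvature_End G A D u v \<in> \<h>) \<and>
         (\<forall>u\<in>tangent_space A \<one>\<^bsub>G\<^esub>. \<forall>S\<in>\<h>. commutator (left_mult_End G A D u) S \<in> \<h>)}"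

definition special_connection ::
    "'g monoid \<Rightarrow> ('g, 'e::euclidean_space) atlas \<Rightarrow>
     ('g vfield \<Rightarrow> 'g vfield \<Rightarrow> 'g vfield) \<Rightarrow> bool" where
  "special_connection G A D \<longleftrightarrow>
     torsion_free A D \<and> bi_invariant_connection G A D \<and> same_curvature A D (nabla0 G A)"

definition strongly_special_connection ::
    "'g monoid \<Rightarrow> ('g, 'e::euclidean_space) atlas \<Rightarrow>
     ('g vfield \<Rightarrow> 'g vfield \<Rightarrow> 'g vfield) \<Rightarrow> bool" where
  "strongly_special_connection G A D \<longleftrightarrow>
     special_connection G A D \<and> holonomy_algebra G A D = holonomy_algebra G A (nabla0 G A)"

text \<open>\<open>D\<close> is the left invariant connection with \<open>D\<^bsub>u\<^sup>+\<^esub> v\<^sup>+ = (u.v)\<^sup>+\<close> for the product \<open>m\<close> on \<open>'a\<close>.\<close>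

definition connection_of_product ::
    "'g monoid \<Rightarrow> ('g, 'e::euclidean_space) atlas \<Rightarrow> ('a \<Rightarrow> 'g tvec) \<Rightarrow>
     ('a \<Rightarrow> 'a \<Rightarrow> 'a) \<Rightarrow> ('g vfield \<Rightarrow> 'g vfield \<Rightarrow> 'g vfield) \<Rightarrow> bool" where
  "connection_of_product G A \<iota> m D \<longleftrightarrow>
     left_invariant_connection G A D \<and>
     (\<forall>u v. D (left_field G (\<iota> u)) (left_field G (\<iota> v)) = left_field G (\<iota> (m u v)))"

end

theory Submission
  imports Defs
begin

text \<open>
  All claims reduce to the frame of left invariant fields: a linear connection is determined by its
  values on a frame, and the defects measuring torsion, equality of curvatures and parallelism of the
  curvature are tensorial. On the frame they become identities of the algebra. As
  \<open>(u.w).v = - v.(u.w)\<close>, both \<open>\<nabla>\<close> and \<open>\<nabla>\<^sup>0\<close> have the curvature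
  \<open>K(u,v)w = (v.u).w = - 1/4 [[u,v],w]\<close>, and it is parallel because left multiplications are
  derivations. Both holonomy algebras are \<open>{L\<^sub>z. z \<in> A.A}\<close>, with \<open>L\<^sub>z\<close> the left
  multiplications of the Leibniz algebra.

  For right invariance, \<open>[u, ]\<close> is a derivation of the product, so \<open>u\<^sup>+\<close> is an affine field of \<open>\<nabla>\<close>.
  Right invariant fields commute with left invariant ones; hence \<open>\<nabla>\<^sub>X Y\<close> commutes with all
  left invariant fields if \<open>X\<close> and \<open>Y\<close> are right invariant. On a connected group it is then right
  invariant itself, because its coefficients in the frame of right invariant fields are constant.

  Coefficients of smooth fields in a frame are smooth: at each point the frame is independent as a
  family of functionals on the smooth functions, so one can solve for the coefficients near it.
\<close>

section \<open>Calculus of \<open>C\<^sup>k\<close> functions\<close>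

text \<open>Tangent vectors are functionals on globally defined smooth functions, so localising
  fields would call for cut-off functions. The global frame makes this unnecessary: every field is a
  finite combination of left invariant fields with smooth coefficients, and each tensorial identity
  becomes an induction over such combinations (\<open>VF_induct\<close>). Right invariance reuses
  the whole left-handed theory. Right translations of \<open>G\<close> are left translations of
  \<open>opposite_group G\<close>, over the same atlas, with the same unit and the same tangent
  space there. The two sides are linked by one analytic fact: left and right invariant fields
  commute because the mixed second derivatives of f(xy) in x and in y agree. The calculus below is
  developed as far as the symmetry of second derivatives for this purpose. The connection
  \<open>nabla0\<close> is a definite description. It becomes accessible through the same existence
  and uniqueness result as the connection of \<open>m\<close>, applied to the product
  \<open>half_br\<close>.\<close>

lemma Ck_on_cong:
  assumes "open S" "\<And>x. x \<in> S \<Longrightarrow> f x = g x"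
  shows "Ck_on k f S \<longleftrightarrow> Ck_on k g S"
  using assms(2)
proof (induction k arbitrary: f g)
  case 0
  then show ?case by (simp cong: continuous_on_cong)
next
  case (Suc k)
  have der: "(f has_derivative D) (at x) \<longleftrightarrow> (g has_derivative D) (at x)" if "x \<in> S" for x D
    using has_derivative_transform_within_open[of f D x UNIV S g]
      has_derivative_transform_within_open[of g D x UNIV S f] assms(1) that Suc.prems by auto
  have "f differentiable (at x) \<longleftrightarrow> g differentiable (at x)" if "x \<in> S" for x
    using der[OF that] by (simp add: differentiable_def)
  moreover have "frechet_derivative f (at x) = frechet_derivative g (at x)" if "x \<in> S" for x
    using der[OF that] by (simp add: frechet_derivative_def)
  then have "Ck_on k (\<lambda>x. frechet_derivative f (at x) w) S \<longleftrightarrow>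
      Ck_on k (\<lambda>x. frechet_derivative g (at x) w) S" for w
    by (intro Suc.IH) simp
  ultimately show ?case by simp
qed

lemma Ck_on_imp_continuous_on: "Ck_on k f S \<Longrightarrow> continuous_on S f"
  by (cases k) (simp_all add: differentiable_imp_continuous_within continuous_at_imp_continuous_on)

lemma Ck_on_SucD: "Ck_on (Suc k) f S \<Longrightarrow> Ck_on k f S"
proof (induction k arbitrary: f)
  case 0
  then show ?case using Ck_on_imp_continuous_on[OF 0] by simp
next
  case (Suc k)
  from Suc.prems show ?case
    unfolding Ck_on.simps(2)[of "Suc k"] Ck_on.simps(2)[of k f] using Suc.IH by simp
qed

lemma Ck_on_subset: "Ck_on k f S \<Longrightarrow> T \<subseteq> S \<Longrightarrow> Ck_on k f T"
  by (induction k arbitrary: f) (auto intro: continuous_on_subset)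

lemma Ck_on_local:
  assumes "\<And>x. x \<in> S \<Longrightarrow> \<exists>N. open N \<and> x \<in> N \<and> Ck_on k f N"
  shows "Ck_on k f S"
  using assms
proof (induction k arbitrary: f)
  case 0
  show ?case
    unfolding Ck_on.simps
  proof (rule continuous_at_imp_continuous_on, rule ballI)
    fix x assume "x \<in> S"
    then obtain N where "open N" "x \<in> N" "continuous_on N f" using 0 by auto
    then show "isCont f x" by (simp add: continuous_on_eq_continuous_at)
  qed
next
  case (Suc k)
  show ?case
    unfolding Ck_on.simps
  proof (intro conjI ballI allI)
    show "f differentiable (at x)" if "x \<in> S" for x
      using Suc.prems[OF that] by auto
    show "Ck_on k (\<lambda>x. frechet_derivative f (at x) w) S" for w
    proof (rule Suc.IH)
      fix x assume "x \<in> S"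
      from Suc.prems[OF this]
      show "\<exists>N. open N \<and> x \<in> N \<and> Ck_on k (\<lambda>x. frechet_derivative f (at x) w) N" by auto
    qed
  qed
qed

lemma Ck_on_const: "Ck_on k (\<lambda>x. c) S"
  by (induction k arbitrary: c) auto

lemma Ck_on_SucI:
  assumes "open S" "\<And>x. x \<in> S \<Longrightarrow> (f has_derivative f' x) (at x)"
    and "\<And>w. Ck_on k (\<lambda>x. f' x w) S"
  shows "Ck_on (Suc k) f S"
  unfolding Ck_on.simps
proof (intro conjI ballI allI)
  show "f differentiable (at x)" if "x \<in> S" for x
    using assms(2)[OF that] by (auto simp: differentiable_def)
  fix w
  have "frechet_derivative f (at x) w = f' x w" if "x \<in> S" for x
    using frechet_derivative_at[OF assms(2)[OF that]] by simp
  then show "Ck_on k (\<lambda>x. frechet_derivative f (at x) w) S"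
    using assms(3)[of w] Ck_on_cong[OF assms(1), of "\<lambda>x. frechet_derivative f (at x) w" "\<lambda>x. f' x w"]
    by simp
qed

lemma Ck_on_has_derivative:
  "Ck_on (Suc k) f S \<Longrightarrow> x \<in> S \<Longrightarrow>
    (f has_derivative frechet_derivative f (at x)) (at x)"
  by (simp add: frechet_derivative_works)

lemma Ck_on_bounded_linear:
  assumes "open S" "bounded_linear L"
  shows "Ck_on k L S"
proof (cases k)
  case 0
  then show ?thesis using assms(2) by (simp add: linear_continuous_on)
next
  case (Suc k')
  have "Ck_on (Suc k') L S"
    by (rule Ck_on_SucI[where f' = "\<lambda>x. L"])
      (use assms in \<open>auto intro: bounded_linear_imp_has_derivative Ck_on_const\<close>)
  then show ?thesis using Suc by simp
qed

lemma Ck_on_add: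
  assumes "open S" "Ck_on k f S" "Ck_on k g S"
  shows "Ck_on k (\<lambda>x. f x + g x) S"
  using assms(2,3)
proof (induction k arbitrary: f g)
  case 0
  then show ?case by (auto intro: continuous_on_add)
next
  case (Suc k)
  show ?case
  proof (rule Ck_on_SucI[OF assms(1)])
    show "((\<lambda>x. f x + g x) has_derivative
        (\<lambda>w. frechet_derivative f (at x) w + frechet_derivative g (at x) w)) (at x)" if "x \<in> S" for x
      using Ck_on_has_derivative[OF Suc.prems(1) that] Ck_on_has_derivative[OF Suc.prems(2) that]
      by (rule has_derivative_add)
    show "Ck_on k (\<lambda>x. frechet_derivative f (at x) w + frechet_derivative g (at x) w) S" for w
      using Suc by simp
  qed
qed

lemma Ck_on_sum:
  assumes "open S" "\<And>i. i \<in> I \<Longrightarrow> Ck_on k (f i) S"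
  shows "Ck_on k (\<lambda>x. \<Sum>i\<in>I. f i x) S"
  using assms(2)
  by (induction I rule: infinite_finite_induct) (simp_all add: Ck_on_add[OF assms(1)] Ck_on_const)

text \<open>One product rule for two uses: products of real functions, and the basis expansion of
  the derivative in the chain rule.\<close>

lemma Ck_on_scaleR:
  fixes f :: "'e::real_normed_vector \<Rightarrow> real" and g :: "'e \<Rightarrow> 'f::real_normed_vector"
  assumes "open S" "Ck_on k f S" "Ck_on k g S"
  shows "Ck_on k (\<lambda>x. f x *\<^sub>R g x) S"
  using assms(2,3)
proof (induction k arbitrary: f g)
  case 0
  then show ?case by (auto intro: continuous_on_scaleR)
next
  case (Suc k)
  show ?case
  proof (rule Ck_on_SucI[OF assms(1)])
    show "((\<lambda>x. f x *\<^sub>R g x) has_derivative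
        (\<lambda>w. f x *\<^sub>R frechet_derivative g (at x) w + frechet_derivative f (at x) w *\<^sub>R g x)) (at x)"
      if "x \<in> S" for x
      using Ck_on_has_derivative[OF Suc.prems(1) that] Ck_on_has_derivative[OF Suc.prems(2) that]
      by (rule has_derivative_scaleR)
    show "Ck_on k (\<lambda>x. f x *\<^sub>R frechet_derivative g (at x) w +
        frechet_derivative f (at x) w *\<^sub>R g x) S" for w
      using Suc.prems Ck_on_SucD[OF Suc.prems(1)] Ck_on_SucD[OF Suc.prems(2)]
      by (intro Ck_on_add[OF assms(1)] Suc.IH) auto
  qed
qed

lemma Ck_on_bounded_linear_compose:
  assumes "open S" "bounded_linear L" "Ck_on k f S"
  shows "Ck_on k (\<lambda>x. L (f x)) S"
  using assms(3)
proof (induction k arbitrary: f)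
  case 0
  then show ?case using assms(2) by (simp add: bounded_linear.continuous_on)
next
  case (Suc k)
  show ?case
  proof (rule Ck_on_SucI[OF assms(1)])
    show "((\<lambda>x. L (f x)) has_derivative (\<lambda>w. L (frechet_derivative f (at x) w))) (at x)"
      if "x \<in> S" for x
      using Ck_on_has_derivative[OF Suc.prems that] assms(2) bounded_linear.has_derivative by blast
    show "Ck_on k (\<lambda>x. L (frechet_derivative f (at x) w)) S" for w
      using Suc by auto
  qed
qed

text \<open>The derivative of 1/f is - (1/f) f' (1/f), which contains 1/f again. The induction
  hypothesis for the same \<open>f\<close> together with the product rule therefore
  suffices.\<close>

lemma Ck_on_inverse:
  fixes f :: "'e::real_normed_vector \<Rightarrow> real"
  assumes "open S" "Ck_on k f S" "\<And>x. x \<in> S \<Longrightarrow> f x \<noteq> 0"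
  shows "Ck_on k (\<lambda>x. inverse (f x)) S"
  using assms(2)
proof (induction k)
  case 0
  then show ?case using assms(3) by (auto intro: continuous_on_inverse)
next
  case (Suc k)
  show ?case
  proof (rule Ck_on_SucI[OF assms(1)])
    show "((\<lambda>x. inverse (f x)) has_derivative
        (\<lambda>w. - (inverse (f x) * frechet_derivative f (at x) w * inverse (f x)))) (at x)"
      if "x \<in> S" for x
      by (rule Deriv.has_derivative_inverse[OF assms(3)[OF that] Ck_on_has_derivative[OF Suc.prems that]])
    have inv: "Ck_on k (\<lambda>x. inverse (f x)) S"
      using Suc Ck_on_SucD by blast
    have "Ck_on k (\<lambda>x. (- 1) *\<^sub>R (inverse (f x) *\<^sub>R frechet_derivative f (at x) w *\<^sub>R inverse (f x))) S" for w
      using inv Suc.prems by (intro Ck_on_scaleR[OF assms(1)] Ck_on_const) auto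
    then show "Ck_on k (\<lambda>x. - (inverse (f x) * frechet_derivative f (at x) w * inverse (f x))) S" for w
      by (simp add: mult.assoc)
  qed
qed

text \<open>\<open>Ck_on\<close> controls derivatives of \<open>f\<close> only in fixed directions,
  whereas the chain rule uses the varying direction g'(x)w. Expanding that direction in
  \<open>Basis\<close> reduces to fixed ones, which is why the middle space is Euclidean.\<close>

lemma Ck_on_compose:
  fixes g :: "'e::real_normed_vector \<Rightarrow> 'd::euclidean_space" and f :: "'d \<Rightarrow> 'f::real_normed_vector"
  assumes "open S" "Ck_on k g S" "Ck_on k f T" "g ` S \<subseteq> T"
  shows "Ck_on k (f \<circ> g) S"
  using assms(2,3)
proof (induction k arbitrary: f)
  case 0
  then show ?case
    using assms(4) by (auto intro: continuous_on_compose continuous_on_subset simp del: o_apply)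
next
  case (Suc k)
  let ?D = "\<lambda>x w. \<Sum>b\<in>Basis. (frechet_derivative g (at x) w \<bullet> b) *\<^sub>R frechet_derivative f (at (g x)) b"
  show ?case
  proof (rule Ck_on_SucI[OF assms(1)])
    fix x assume x: "x \<in> S"
    have df: "(f has_derivative frechet_derivative f (at (g x))) (at (g x))"
      using Ck_on_has_derivative[OF Suc.prems(2)] assms(4) x by blast
    then have lin: "linear (frechet_derivative f (at (g x)))"
      by (rule has_derivative_linear)
    have "frechet_derivative f (at (g x)) v = (\<Sum>b\<in>Basis. (v \<bullet> b) *\<^sub>R frechet_derivative f (at (g x)) b)" for v
    proof -
      have "frechet_derivative f (at (g x)) (\<Sum>b\<in>Basis. (v \<bullet> b) *\<^sub>R b) =
          (\<Sum>b\<in>Basis. (v \<bullet> b) *\<^sub>R frechet_derivative f (at (g x)) b)"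
        by (simp only: linear_sum[OF lin] linear_cmul[OF lin])
      then show ?thesis by (simp only: euclidean_representation)
    qed
    from this[of "frechet_derivative g (at x) _"]
    have "frechet_derivative f (at (g x)) \<circ> frechet_derivative g (at x) = ?D x"
      unfolding o_def by (rule ext)
    then show "(f \<circ> g has_derivative ?D x) (at x)"
      using diff_chain_at[OF Ck_on_has_derivative[OF Suc.prems(1) x] df] by simp
  next
    fix w
    have gk: "Ck_on k g S" using Suc.prems(1) by (rule Ck_on_SucD)
    have "Ck_on k (\<lambda>x. frechet_derivative f (at (g x)) b) S" for b
      using Suc.IH[OF gk, of "\<lambda>y. frechet_derivative f (at y) b"] Suc.prems(2) by (simp add: o_def)
    moreover have "Ck_on k (\<lambda>x. frechet_derivative g (at x) w \<bullet> b) S" for b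
      using Ck_on_bounded_linear_compose[OF assms(1) bounded_linear_inner_left, of k "\<lambda>x. frechet_derivative g (at x) w"]
        Suc.prems(1) by simp
    ultimately show "Ck_on k (\<lambda>x. ?D x w) S"
      by (intro Ck_on_sum[OF assms(1)] Ck_on_scaleR[OF assms(1)])
  qed
qed

lemma Ck_on_Pair:
  assumes "open S" "Ck_on k f S" "Ck_on k g S"
  shows "Ck_on k (\<lambda>x. (f x, g x)) S"
  using assms(2,3)
proof (induction k arbitrary: f g)
  case 0
  then show ?case by (auto intro: continuous_on_Pair)
next
  case (Suc k)
  show ?case
  proof (rule Ck_on_SucI[OF assms(1)])
    show "((\<lambda>x. (f x, g x)) has_derivative
        (\<lambda>w. (frechet_derivative f (at x) w, frechet_derivative g (at x) w))) (at x)" if "x \<in> S" for x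
      using Ck_on_has_derivative[OF Suc.prems(1) that] Ck_on_has_derivative[OF Suc.prems(2) that]
      by (rule has_derivative_Pair)
    show "Ck_on k (\<lambda>x. (frechet_derivative f (at x) w, frechet_derivative g (at x) w)) S" for w
      using Suc by simp
  qed
qed

section \<open>Symmetry of second derivatives\<close>

lemma mean_value_direction:
  fixes f :: "'e::real_normed_vector \<Rightarrow> real"
  assumes "0 < h" "\<And>s. 0 \<le> s \<Longrightarrow> s \<le> h \<Longrightarrow> f differentiable (at (z + s *\<^sub>R a))"
  shows "\<exists>s. 0 < s \<and> s < h \<and>
    f (z + h *\<^sub>R a) - f z = h * frechet_derivative f (at (z + s *\<^sub>R a)) a"
proof -
  have "((\<lambda>s. f (z + s *\<^sub>R a)) has_real_derivative frechet_derivative f (at (z + s *\<^sub>R a)) a) (at s)"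
    if "0 \<le> s" "s \<le> h" for s
  proof -
    have df: "(f has_derivative frechet_derivative f (at (z + s *\<^sub>R a))) (at (z + s *\<^sub>R a))"
      using assms(2)[OF that] by (simp add: frechet_derivative_works)
    have "((\<lambda>s. z + s *\<^sub>R a) has_derivative (\<lambda>t. t *\<^sub>R a)) (at s)"
      by (auto intro!: derivative_eq_intros)
    from diff_chain_at[OF this df] show ?thesis
      using linear_cmul[OF has_derivative_linear[OF df]]
      by (simp add: has_field_derivative_def o_def mult_commute_abs)
  qed
  from MVT2[OF assms(1) this] show ?thesis by auto
qed

text \<open>Two applications of the mean value theorem: in direction \<open>a\<close> to the
  increment f(x + hb) - f(x), then in direction \<open>b\<close> to the derivative of
  \<open>f\<close> along \<open>a\<close>.\<close>

lemma second_difference: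
  fixes f :: "'e::real_normed_vector \<Rightarrow> real"
  assumes "0 < h" "\<And>s t. 0 \<le> s \<Longrightarrow> s \<le> h \<Longrightarrow> 0 \<le> t \<Longrightarrow> t \<le> h \<Longrightarrow> z + s *\<^sub>R a + t *\<^sub>R b \<in> S"
    and df: "\<And>x. x \<in> S \<Longrightarrow> f differentiable (at x)"
    and ddf: "\<And>x. x \<in> S \<Longrightarrow> (\<lambda>x. frechet_derivative f (at x) a) differentiable (at x)"
  shows "\<exists>s t. 0 < s \<and> s < h \<and> 0 < t \<and> t < h \<and>
    f (z + h *\<^sub>R a + h *\<^sub>R b) - f (z + h *\<^sub>R a) - f (z + h *\<^sub>R b) + f z =
    h * h * frechet_derivative (\<lambda>x. frechet_derivative f (at x) a) (at (z + s *\<^sub>R a + t *\<^sub>R b)) b"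
proof -
  define g where "g x = f (x + h *\<^sub>R b) - f x" for x
  have dg: "(g has_derivative (\<lambda>w. frechet_derivative f (at (x + h *\<^sub>R b)) w - frechet_derivative f (at x) w)) (at x)"
    if "x \<in> S" "x + h *\<^sub>R b \<in> S" for x
  proof -
    have "((\<lambda>x. x + h *\<^sub>R b) has_derivative (\<lambda>w. w)) (at x)"
      by (auto intro!: derivative_eq_intros)
    moreover have "(f has_derivative frechet_derivative f (at (x + h *\<^sub>R b))) (at (x + h *\<^sub>R b))"
      using df[OF that(2)] by (simp add: frechet_derivative_works)
    ultimately have "((\<lambda>x. f (x + h *\<^sub>R b)) has_derivative frechet_derivative f (at (x + h *\<^sub>R b))) (at x)"
      using diff_chain_at by (fastforce simp: o_def)
    moreover have "(f has_derivative frechet_derivative f (at x)) (at x)"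
      using df[OF that(1)] by (simp add: frechet_derivative_works)
    ultimately show ?thesis
      unfolding g_def by (rule has_derivative_diff)
  qed
  have inS: "z + s *\<^sub>R a \<in> S" "z + s *\<^sub>R a + h *\<^sub>R b \<in> S" if "0 \<le> s" "s \<le> h" for s
    using assms(2)[OF that, of 0] assms(2)[OF that, of h] \<open>0 < h\<close> by auto
  obtain s where s: "0 < s" "s < h"
    "g (z + h *\<^sub>R a) - g z = h * frechet_derivative g (at (z + s *\<^sub>R a)) a"
    using mean_value_direction[OF \<open>0 < h\<close>, of g z a] dg[OF inS] differentiable_def by blast
  have "g (z + h *\<^sub>R a) - g z = h * (frechet_derivative f (at (z + s *\<^sub>R a + h *\<^sub>R b)) a
      - frechet_derivative f (at (z + s *\<^sub>R a)) a)"
    using s fun_cong[OF frechet_derivative_at[OF dg[OF inS], of s], symmetric] by simp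
  moreover obtain t where "0 < t" "t < h"
    "frechet_derivative f (at (z + s *\<^sub>R a + h *\<^sub>R b)) a - frechet_derivative f (at (z + s *\<^sub>R a)) a
      = h * frechet_derivative (\<lambda>x. frechet_derivative f (at x) a) (at (z + s *\<^sub>R a + t *\<^sub>R b)) b"
    using mean_value_direction[OF \<open>0 < h\<close>, of "\<lambda>x. frechet_derivative f (at x) a" "z + s *\<^sub>R a" b]
      ddf[OF assms(2)] s by auto
  ultimately show ?thesis
    using s(1,2) by (intro exI[of _ s] exI[of _ t]) (simp add: g_def algebra_simps)
qed

text \<open>The second difference over a small parallelogram does not depend on the order of
  \<open>a\<close> and \<open>b\<close>. It equals h^2 times either mixed derivative at some point
  near \<open>z\<close>; continuity of both excludes a gap at \<open>z\<close>.\<close>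

lemma second_derivative_symmetric:
  fixes f :: "'e::real_normed_vector \<Rightarrow> real"
  assumes S: "open S" "z \<in> S" and f: "Ck_on 2 f S"
  shows "frechet_derivative (\<lambda>x. frechet_derivative f (at x) a) (at z) b =
    frechet_derivative (\<lambda>x. frechet_derivative f (at x) b) (at z) a"
    (is "?F a b z = ?F b a z")
proof (rule ccontr)
  assume neq: "?F a b z \<noteq> ?F b a z"
  have df: "\<And>x. x \<in> S \<Longrightarrow> f differentiable (at x)"
    and ddf: "\<And>x a. x \<in> S \<Longrightarrow> (\<lambda>x. frechet_derivative f (at x) a) differentiable (at x)"
    and cont: "\<And>a b. continuous_on S (?F a b)"
    using f by (auto simp: numeral_2_eq_2)
  \<comment> \<open>Half the gap: two equal numbers, each within \<open>e\<close> of one of the two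
    values, force the gap below \<open>2 * e\<close>.\<close>
  define e where "e = \<bar>?F a b z - ?F b a z\<bar> / 2"
  have "e > 0" using neq by (simp add: e_def)
  have "isCont (?F a b) z" for a b
    using cont S by (simp add: continuous_on_eq_continuous_at)
  note isCont = this
  have near: "\<forall>\<^sub>F x in nhds z. \<bar>?F a b x - ?F a b z\<bar> < e" for a b
    using isCont[of a b] \<open>e > 0\<close> tendstoD[of "?F a b" "?F a b z" "nhds z" e]
    unfolding isCont_def tendsto_at_iff_tendsto_nhds[of "?F a b"] dist_real_def by blast
  have "\<forall>\<^sub>F x in nhds z. x \<in> S \<and> \<bar>?F a b x - ?F a b z\<bar> < e \<and> \<bar>?F b a x - ?F b a z\<bar> < e"
    using near[of a b] near[of b a] eventually_nhds_in_open[OF S] by eventually_elim simp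
  then obtain d where d: "d > 0"
    "\<And>x. dist x z < d \<Longrightarrow> x \<in> S \<and> \<bar>?F a b x - ?F a b z\<bar> < e \<and> \<bar>?F b a x - ?F b a z\<bar> < e"
    by (auto simp: eventually_nhds_metric)
  \<comment> \<open>With this size the parallelogram with sides \<open>h\<close> times
    \<open>a\<close> and \<open>b\<close> stays within d/2 of \<open>z\<close>; the summand 1 keeps
    the denominator positive when \<open>a\<close> and \<open>b\<close> vanish.\<close>
  define h where "h = d / (2 * (norm a + norm b + 1))"
  have pos: "norm a + norm b + 1 > 0"
    by (smt (verit) norm_ge_zero)
  then have "h > 0" using d by (simp add: h_def)
  have near_z: "dist (z + s *\<^sub>R a + t *\<^sub>R b) z < d" if "0 \<le> s" "s \<le> h" "0 \<le> t" "t \<le> h" for s t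
  proof -
    have "norm (s *\<^sub>R a + t *\<^sub>R b) \<le> s * norm a + t * norm b"
      using that norm_triangle_ineq[of "s *\<^sub>R a" "t *\<^sub>R b"] by simp
    also have "\<dots> \<le> h * (norm a + norm b + 1)"
      using that \<open>h > 0\<close> mult_right_mono[of s h "norm a"] mult_right_mono[of t h "norm b"]
      by (simp add: algebra_simps)
    also have "\<dots> = d / 2"
    proof -
      have "d / (2 * c) * c = d / 2" if "c > 0" for c :: real using that by simp
      from this[OF pos] show ?thesis unfolding h_def .
    qed
    finally show ?thesis using d by (simp add: dist_norm add.assoc)
  qed
  obtain s t where 1: "0 < s" "s < h" "0 < t" "t < h"
    "f (z + h *\<^sub>R a + h *\<^sub>R b) - f (z + h *\<^sub>R a) - f (z + h *\<^sub>R b) + f z = h * h * ?F a b (z + s *\<^sub>R a + t *\<^sub>R b)"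
    using second_difference[OF \<open>h > 0\<close>, of z a b S f] near_z d df ddf by blast
  \<comment> \<open>The same parallelogram traversed in the other order, for the second mixed
    derivative.\<close>
  have "z + t *\<^sub>R b + s *\<^sub>R a \<in> S" if "0 \<le> s" "s \<le> h" "0 \<le> t" "t \<le> h" for s t
    using near_z[OF that] d by (simp add: ac_simps)
  then obtain s' t' where 2: "0 < s'" "s' < h" "0 < t'" "t' < h"
    "f (z + h *\<^sub>R b + h *\<^sub>R a) - f (z + h *\<^sub>R b) - f (z + h *\<^sub>R a) + f z = h * h * ?F b a (z + s' *\<^sub>R b + t' *\<^sub>R a)"
    using second_difference[OF \<open>h > 0\<close>, of z b a S f] df ddf by blast
  have "?F a b (z + s *\<^sub>R a + t *\<^sub>R b) = ?F b a (z + t' *\<^sub>R a + s' *\<^sub>R b)"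
  proof -
    have "h * h * ?F a b (z + s *\<^sub>R a + t *\<^sub>R b) = h * h * ?F b a (z + t' *\<^sub>R a + s' *\<^sub>R b)"
      using 1(5) 2(5) unfolding add.assoc[of z] add.commute[of "_ *\<^sub>R b" "_ *\<^sub>R a"] by linarith
    then show ?thesis using \<open>h > 0\<close> by simp
  qed
  moreover have "\<bar>?F a b (z + s *\<^sub>R a + t *\<^sub>R b) - ?F a b z\<bar> < e"
    "\<bar>?F b a (z + t' *\<^sub>R a + s' *\<^sub>R b) - ?F b a z\<bar> < e"
    using near_z 1 2 d by (auto simp: less_imp_le)
  ultimately have "\<bar>?F a b z - ?F b a z\<bar> < 2 * e" by linarith
  then show False by (simp add: e_def)
qed

section \<open>Infinitely differentiable functions on open sets\<close>

lemma smooth_on_cong: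
  "open S \<Longrightarrow> (\<And>x. x \<in> S \<Longrightarrow> f x = g x) \<Longrightarrow> smooth_on f S \<longleftrightarrow> smooth_on g S"
  unfolding smooth_on_def using Ck_on_cong[of S f g] by simp

lemma smooth_on_eq:
  "open S \<Longrightarrow> smooth_on f S \<Longrightarrow> (\<And>x. x \<in> S \<Longrightarrow> f x = g x) \<Longrightarrow> smooth_on g S"
  using smooth_on_cong by blast

lemma smooth_on_subset: "smooth_on f S \<Longrightarrow> T \<subseteq> S \<Longrightarrow> smooth_on f T"
  unfolding smooth_on_def using Ck_on_subset by blast

lemma smooth_on_local:
  "(\<And>x. x \<in> S \<Longrightarrow> \<exists>N. open N \<and> x \<in> N \<and> smooth_on f N) \<Longrightarrow> smooth_on f S"
  unfolding smooth_on_def by (meson Ck_on_local)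

lemma smooth_on_const: "smooth_on (\<lambda>x. c) S"
  by (simp add: smooth_on_def Ck_on_const)

lemma smooth_on_bounded_linear: "open S \<Longrightarrow> bounded_linear L \<Longrightarrow> smooth_on L S"
  by (simp add: smooth_on_def Ck_on_bounded_linear)

lemma smooth_on_add:
  "open S \<Longrightarrow> smooth_on f S \<Longrightarrow> smooth_on g S \<Longrightarrow> smooth_on (\<lambda>x. f x + g x) S"
  by (simp add: smooth_on_def Ck_on_add)

lemma smooth_on_mult:
  fixes f g :: "'e::real_normed_vector \<Rightarrow> real"
  shows "open S \<Longrightarrow> smooth_on f S \<Longrightarrow> smooth_on g S \<Longrightarrow> smooth_on (\<lambda>x. f x * g x) S"
  using Ck_on_scaleR[of S _ f g] by (simp add: smooth_on_def)

lemma smooth_on_inverse: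
  fixes f :: "'e::real_normed_vector \<Rightarrow> real"
  shows "open S \<Longrightarrow> smooth_on f S \<Longrightarrow> (\<And>x. x \<in> S \<Longrightarrow> f x \<noteq> 0) \<Longrightarrow>
    smooth_on (\<lambda>x. inverse (f x)) S"
  by (simp add: smooth_on_def Ck_on_inverse)

lemma smooth_on_compose:
  fixes g :: "'e::real_normed_vector \<Rightarrow> 'd::euclidean_space"
  shows "open S \<Longrightarrow> smooth_on g S \<Longrightarrow> smooth_on f T \<Longrightarrow> g ` S \<subseteq> T \<Longrightarrow> smooth_on (f \<circ> g) S"
  unfolding smooth_on_def by (blast intro: Ck_on_compose)

lemma smooth_on_Pair:
  "open S \<Longrightarrow> smooth_on f S \<Longrightarrow> smooth_on g S \<Longrightarrow> smooth_on (\<lambda>x. (f x, g x)) S"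
  by (simp add: smooth_on_def Ck_on_Pair)

lemma smooth_on_frechet_derivative:
  "smooth_on f S \<Longrightarrow> smooth_on (\<lambda>x. frechet_derivative f (at x) w) S"
  unfolding smooth_on_def by (metis Ck_on.simps(2))

lemma smooth_on_imp_continuous_on: "smooth_on f S \<Longrightarrow> continuous_on S f"
  unfolding smooth_on_def by (metis Ck_on.simps(1))

lemma smooth_on_has_derivative:
  "smooth_on f S \<Longrightarrow> x \<in> S \<Longrightarrow> (f has_derivative frechet_derivative f (at x)) (at x)"
  unfolding smooth_on_def by (metis Ck_on_has_derivative)

lemma frechet_derivative_cong_open:
  assumes "open S" "x \<in> S" "\<And>y. y \<in> S \<Longrightarrow> f y = g y"
  shows "frechet_derivative f (at x) = frechet_derivative g (at x)"
proof -
  have "(f has_derivative D) (at x) \<longleftrightarrow> (g has_derivative D) (at x)" for D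
    using has_derivative_transform_within_open[of f D x UNIV S g]
      has_derivative_transform_within_open[of g D x UNIV S f] assms by auto
  then show ?thesis by (simp add: frechet_derivative_def)
qed

lemma frechet_derivative_fst_slice:
  assumes "f differentiable (at (x, y))"
  shows "frechet_derivative (\<lambda>x. f (x, y)) (at x) v = frechet_derivative f (at (x, y)) (v, 0)"
proof -
  have "((\<lambda>x. (x, y)) has_derivative (\<lambda>v. (v, 0))) (at x)"
    by (auto intro!: derivative_eq_intros)
  from diff_chain_at[OF this] assms
  have "((\<lambda>x. f (x, y)) has_derivative (\<lambda>v. frechet_derivative f (at (x, y)) (v, 0))) (at x)"
    by (fastforce simp: frechet_derivative_works o_def)
  from fun_cong[OF frechet_derivative_at[OF this], of v] show ?thesis by simp
qed

lemma frechet_derivative_snd_slice: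
  assumes "f differentiable (at (x, y))"
  shows "frechet_derivative (\<lambda>y. f (x, y)) (at y) w = frechet_derivative f (at (x, y)) (0, w)"
proof -
  have "((\<lambda>y. (x, y)) has_derivative (\<lambda>w. (0, w))) (at y)"
    by (auto intro!: derivative_eq_intros)
  from diff_chain_at[OF this] assms
  have "((\<lambda>y. f (x, y)) has_derivative (\<lambda>w. frechet_derivative f (at (x, y)) (0, w))) (at y)"
    by (fastforce simp: frechet_derivative_works o_def)
  from fun_cong[OF frechet_derivative_at[OF this], of w] show ?thesis by simp
qed


section \<open>Smooth functions and maps\<close>

lemma atlas_cover:
  assumes "smooth_atlas A"
  obtains U \<phi> where "(U, \<phi>) \<in> A" "p \<in> U"
  using assms UNIV_I[of p] unfolding smooth_atlas_def by blast

lemma atlas_chart: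
  assumes "smooth_atlas A" "(U, \<phi>) \<in> A"
  shows "open U" "open (\<phi> ` U)" "continuous_on U \<phi>" "continuous_on (\<phi> ` U) (inv_into U \<phi>)"
    and "\<And>x. x \<in> U \<Longrightarrow> inv_into U \<phi> (\<phi> x) = x"
  using assms unfolding smooth_atlas_def homeomorphism_def by fast+

lemma atlas_transition:
  assumes "smooth_atlas A" "(U, \<phi>) \<in> A" "(V, \<psi>) \<in> A"
  shows "smooth_on (\<psi> \<circ> inv_into U \<phi>) (\<phi> ` (U \<inter> V))"
  using assms unfolding smooth_atlas_def by fast

lemma chart_image_open:
  assumes "smooth_atlas A" "(U, \<phi>) \<in> A" "open W"
  shows "open (\<phi> ` (U \<inter> W))"
proof -
  note c = atlas_chart[OF assms(1,2)]
  have "\<phi> ` (U \<inter> W) = \<phi> ` U \<inter> inv_into U \<phi> -` W"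
    using c(5) by force
  then show ?thesis
    using continuous_open_preimage[OF c(4,2) assms(3)] by simp
qed

lemma smooth_map_iff:
  "smooth_map A B F \<longleftrightarrow> continuous_on UNIV F \<and> (\<forall>U \<phi> V \<psi>. (U, \<phi>) \<in> A \<longrightarrow> (V, \<psi>) \<in> B \<longrightarrow>
     smooth_on (\<psi> \<circ> F \<circ> inv_into U \<phi>) (\<phi> ` (U \<inter> F -` V)))"
  by (auto simp: smooth_map_def)

lemma smooth_mapD:
  assumes "smooth_map A B F" "(U, \<phi>) \<in> A" "(V, \<psi>) \<in> B"
  shows "smooth_on (\<psi> \<circ> F \<circ> inv_into U \<phi>) (\<phi> ` (U \<inter> F -` V))"
  using assms unfolding smooth_map_def by fast

text \<open>Locally a chart of \<open>B\<close> is inserted between \<open>F\<close> and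
  \<open>k\<close>. Taking for \<open>k\<close> a function on the target, or a chart composed with a
  second map, gives composition of functions with maps and of maps with maps.\<close>

lemma smooth_on_comp_map:
  fixes A :: "('g::topological_space, 'e::euclidean_space) atlas"
    and B :: "('h::topological_space, 'f::euclidean_space) atlas"
  assumes A: "smooth_atlas A" and B: "smooth_atlas B" and F: "smooth_map A B F" and "open V"
    and k: "\<And>W \<xi>. (W, \<xi>) \<in> B \<Longrightarrow> smooth_on (k \<circ> inv_into W \<xi>) (\<xi> ` (W \<inter> V))"
    and U: "(U, \<phi>) \<in> A"
  shows "smooth_on (k \<circ> F \<circ> inv_into U \<phi>) (\<phi> ` (U \<inter> F -` V))"
proof (rule smooth_on_local)
  fix x assume "x \<in> \<phi> ` (U \<inter> F -` V)"
  then obtain p where p: "x = \<phi> p" "p \<in> U" "F p \<in> V" by auto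
  obtain W \<xi> where W: "(W, \<xi>) \<in> B" "F p \<in> W" using atlas_cover[OF B] .
  define N where "N = \<phi> ` (U \<inter> F -` (W \<inter> V))"
  have "open (F -` (W \<inter> V))"
    using F atlas_chart(1)[OF B W(1)] \<open>open V\<close> by (auto simp: smooth_map_def intro: open_vimage)
  then have "open N" unfolding N_def by (rule chart_image_open[OF A U])
  moreover have "x \<in> N" using p W by (auto simp: N_def)
  moreover have "smooth_on (k \<circ> F \<circ> inv_into U \<phi>) N"
  proof -
    have "smooth_on (\<xi> \<circ> F \<circ> inv_into U \<phi>) N"
      by (rule smooth_on_subset[OF smooth_mapD[OF F U W(1)]]) (auto simp: N_def)
    moreover have "(\<xi> \<circ> F \<circ> inv_into U \<phi>) ` N \<subseteq> \<xi> ` (W \<inter> V)"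
      using atlas_chart(5)[OF A U] by (auto simp: N_def)
    ultimately have "smooth_on ((k \<circ> inv_into W \<xi>) \<circ> (\<xi> \<circ> F \<circ> inv_into U \<phi>)) N"
      using smooth_on_compose[OF \<open>open N\<close>] k[OF W(1)] by blast
    moreover have "((k \<circ> inv_into W \<xi>) \<circ> (\<xi> \<circ> F \<circ> inv_into U \<phi>)) y = (k \<circ> F \<circ> inv_into U \<phi>) y"
      if "y \<in> N" for y
      using that atlas_chart(5)[OF A U] atlas_chart(5)[OF B W(1)] by (auto simp: N_def)
    ultimately show ?thesis by (rule smooth_on_eq[OF \<open>open N\<close>])
  qed
  ultimately show "\<exists>N. open N \<and> x \<in> N \<and> smooth_on (k \<circ> F \<circ> inv_into U \<phi>) N" by blast
qed

lemma smooth_map_compose: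
  assumes "smooth_atlas A" "smooth_atlas B" "smooth_atlas C" "smooth_map A B F" "smooth_map B C H"
  shows "smooth_map A C (H \<circ> F)"
  unfolding smooth_map_def
proof (intro conjI ballI, goal_cases)
  case 1
  show ?case
    using assms(4,5) unfolding smooth_map_def by (blast intro: continuous_on_compose continuous_on_subset)
next
  case (2 x)
  obtain U \<phi> where x: "x = (U, \<phi>)" by force
  have "smooth_on (\<psi> \<circ> (H \<circ> F) \<circ> inv_into U \<phi>) (\<phi> ` (U \<inter> (H \<circ> F) -` V))"
    if V: "(V, \<psi>) \<in> C" for V \<psi>
  proof -
    have "open (H -` V)"
      using assms(5) atlas_chart(1)[OF assms(3) V] by (auto simp: smooth_map_def intro: open_vimage)
    from smooth_on_comp_map[OF assms(1,2,4) this, of "\<psi> \<circ> H", OF smooth_mapD[OF assms(5) _ V], of U \<phi>]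
    show ?thesis using 2 x unfolding comp_assoc vimage_comp by simp
  qed
  then show ?case using x by auto
qed

lemma smooth_functions_iff:
  "f \<in> smooth_functions A \<longleftrightarrow> (\<forall>U \<phi>. (U, \<phi>) \<in> A \<longrightarrow> smooth_on (f \<circ> inv_into U \<phi>) (\<phi> ` U))"
  by (auto simp: smooth_functions_def)

lemma smooth_functions_compose:
  assumes "smooth_atlas A" "smooth_atlas B" "smooth_map A B F" "f \<in> smooth_functions B"
  shows "f \<circ> F \<in> smooth_functions A"
  using smooth_on_comp_map[OF assms(1-3) open_UNIV, of f] assms(4) by (auto simp: smooth_functions_iff)

text \<open>A property of the germ of \<open>f\<close> at \<open>p\<close>. Coefficients in a frame
  can only be solved for near a point, where a pivot stays nonzero, so smoothness is needed in this
  local form.\<close>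

definition smooth_at :: "('g::topological_space, 'e::euclidean_space) atlas \<Rightarrow> 'g \<Rightarrow> ('g \<Rightarrow> real) \<Rightarrow> bool" where
  "smooth_at A p f \<longleftrightarrow> (\<exists>W. open W \<and> p \<in> W \<and>
     (\<forall>U \<phi>. (U, \<phi>) \<in> A \<longrightarrow> smooth_on (f \<circ> inv_into U \<phi>) (\<phi> ` (U \<inter> W))))"

lemma smooth_functions_iff_smooth_at:
  assumes "smooth_atlas A"
  shows "f \<in> smooth_functions A \<longleftrightarrow> (\<forall>p. smooth_at A p f)"
proof
  assume "f \<in> smooth_functions A"
  then show "\<forall>p. smooth_at A p f"
    unfolding smooth_functions_iff smooth_at_def by (intro allI exI[of _ UNIV]) simp
next
  assume f: "\<forall>p. smooth_at A p f"
  show "f \<in> smooth_functions A"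
    unfolding smooth_functions_iff
  proof (intro allI impI, rule smooth_on_local)
    fix U \<phi> x assume U: "(U, \<phi>) \<in> A" and "x \<in> \<phi> ` U"
    then obtain p where p: "x = \<phi> p" "p \<in> U" by auto
    then obtain W where W: "open W" "p \<in> W" "smooth_on (f \<circ> inv_into U \<phi>) (\<phi> ` (U \<inter> W))"
      using f U unfolding smooth_at_def by blast
    then show "\<exists>N. open N \<and> x \<in> N \<and> smooth_on (f \<circ> inv_into U \<phi>) N"
      using chart_image_open[OF assms U W(1)] p by blast
  qed
qed

lemma smooth_at_subset:
  assumes "smooth_at A p f"
  shows "\<exists>W. open W \<and> p \<in> W \<and> (\<forall>U \<phi> W'. W' \<subseteq> W \<longrightarrow> (U, \<phi>) \<in> A \<longrightarrow>
    smooth_on (f \<circ> inv_into U \<phi>) (\<phi> ` (U \<inter> W')))"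
proof -
  from assms obtain W where W: "open W" "p \<in> W"
    "\<And>U \<phi>. (U, \<phi>) \<in> A \<Longrightarrow> smooth_on (f \<circ> inv_into U \<phi>) (\<phi> ` (U \<inter> W))"
    unfolding smooth_at_def by blast
  show ?thesis
  proof (intro exI[of _ W] conjI allI impI W(1,2))
    fix U \<phi> W' assume "W' \<subseteq> W" "(U, \<phi>) \<in> A"
    then show "smooth_on (f \<circ> inv_into U \<phi>) (\<phi> ` (U \<inter> W'))"
      by (intro smooth_on_subset[OF W(3)]) auto
  qed
qed

lemma smooth_at_const: "smooth_at A p (\<lambda>_. c)"
  unfolding smooth_at_def by (intro exI[of _ UNIV]) (simp add: o_def smooth_on_const)

lemma smooth_at_binop:
  fixes A :: "('g::topological_space, 'e::euclidean_space) atlas"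
  assumes A: "smooth_atlas A" and "smooth_at A p f" "smooth_at A p g"
    and op: "\<And>(S :: 'e set) u v. open S \<Longrightarrow> smooth_on u S \<Longrightarrow> smooth_on v S \<Longrightarrow> smooth_on (\<lambda>x. h (u x) (v x)) S"
  shows "smooth_at A p (\<lambda>x. h (f x) (g x))"
proof -
  obtain W where W: "open W" "p \<in> W"
    "\<forall>U \<phi> W'. W' \<subseteq> W \<longrightarrow> (U, \<phi>) \<in> A \<longrightarrow> smooth_on (f \<circ> inv_into U \<phi>) (\<phi> ` (U \<inter> W'))"
    using smooth_at_subset[OF assms(2)] by (elim exE conjE) (rule that)
  obtain V where V: "open V" "p \<in> V"
    "\<forall>U \<phi> W'. W' \<subseteq> V \<longrightarrow> (U, \<phi>) \<in> A \<longrightarrow> smooth_on (g \<circ> inv_into U \<phi>) (\<phi> ` (U \<inter> W'))"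
    using smooth_at_subset[OF assms(3)] by (elim exE conjE) (rule that)
  show ?thesis
    unfolding smooth_at_def
  proof (intro exI[of _ "W \<inter> V"] conjI allI impI)
    show "open (W \<inter> V)" using W V by blast
    show "p \<in> W \<inter> V" using W V by blast
    fix U \<phi> assume U: "(U, \<phi>) \<in> A"
    show "smooth_on ((\<lambda>x. h (f x) (g x)) \<circ> inv_into U \<phi>) (\<phi> ` (U \<inter> (W \<inter> V)))"
      using op[OF chart_image_open[OF A U], of "W \<inter> V" "f \<circ> inv_into U \<phi>" "g \<circ> inv_into U \<phi>"]
        W V U by (simp add: o_def open_Int)
  qed
qed

lemma smooth_at_add:
  "smooth_atlas A \<Longrightarrow> smooth_at A p f \<Longrightarrow> smooth_at A p g \<Longrightarrow> smooth_at A p (\<lambda>x. f x + g x)"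
  by (rule smooth_at_binop) (auto intro: smooth_on_add)

lemma smooth_at_mult:
  "smooth_atlas A \<Longrightarrow> smooth_at A p f \<Longrightarrow> smooth_at A p g \<Longrightarrow> smooth_at A p (\<lambda>x. f x * g x)"
  by (rule smooth_at_binop) (auto intro: smooth_on_mult)

lemma smooth_at_diff:
  "smooth_atlas A \<Longrightarrow> smooth_at A p f \<Longrightarrow> smooth_at A p g \<Longrightarrow> smooth_at A p (\<lambda>x. f x - g x)"
  using smooth_at_add[of A p f "\<lambda>x. - 1 * g x"] smooth_at_mult[of A p "\<lambda>_. - 1" g] smooth_at_const[of A p "- 1"]
  by simp

lemma smooth_at_sum:
  assumes "smooth_atlas A" "\<And>i. i \<in> I \<Longrightarrow> smooth_at A p (f i)"
  shows "smooth_at A p (\<lambda>x. \<Sum>i\<in>I. f i x)"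
  using assms(2)
  by (induction I rule: infinite_finite_induct) (simp_all add: smooth_at_const smooth_at_add[OF assms(1)])

lemma smooth_at_cong:
  assumes "smooth_atlas A" "smooth_at A p f" "\<forall>\<^sub>F x in nhds p. f x = g x"
  shows "smooth_at A p g"
proof -
  obtain W where W: "open W" "p \<in> W"
    "\<forall>U \<phi> W'. W' \<subseteq> W \<longrightarrow> (U, \<phi>) \<in> A \<longrightarrow> smooth_on (f \<circ> inv_into U \<phi>) (\<phi> ` (U \<inter> W'))"
    using smooth_at_subset[OF assms(2)] by (elim exE conjE) (rule that)
  obtain V where V: "open V" "p \<in> V" "\<And>x. x \<in> V \<Longrightarrow> f x = g x"
    using assms(3) by (auto simp: eventually_nhds)
  show ?thesis
    unfolding smooth_at_def
  proof (intro exI[of _ "W \<inter> V"] conjI allI impI)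
    show "open (W \<inter> V)" using W V by blast
    show "p \<in> W \<inter> V" using W V by blast
    fix U \<phi> assume U: "(U, \<phi>) \<in> A"
    have o: "open (\<phi> ` (U \<inter> (W \<inter> V)))"
      using chart_image_open[OF assms(1) U] W(1) V(1) by (simp add: open_Int)
    show "smooth_on (g \<circ> inv_into U \<phi>) (\<phi> ` (U \<inter> (W \<inter> V)))"
    proof (rule smooth_on_eq[OF o])
      show "smooth_on (f \<circ> inv_into U \<phi>) (\<phi> ` (U \<inter> (W \<inter> V)))"
        using W(3) U by simp
      show "(f \<circ> inv_into U \<phi>) x = (g \<circ> inv_into U \<phi>) x" if "x \<in> \<phi> ` (U \<inter> (W \<inter> V))" for x
        using that V(3) atlas_chart(5)[OF assms(1) U] by auto
    qed
  qed
qed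

lemma smooth_at_imp_isCont:
  fixes A :: "('g::t2_space, 'e::euclidean_space) atlas"
  assumes A: "smooth_atlas A" and "smooth_at A p f"
  shows "isCont f p"
proof -
  obtain W where W: "open W" "p \<in> W"
    "\<forall>U \<phi> W'. W' \<subseteq> W \<longrightarrow> (U, \<phi>) \<in> A \<longrightarrow> smooth_on (f \<circ> inv_into U \<phi>) (\<phi> ` (U \<inter> W'))"
    using smooth_at_subset[OF assms(2)] by (elim exE conjE) (rule that)
  obtain U \<phi> where U: "(U, \<phi>) \<in> A" "p \<in> U" using atlas_cover[OF A] .
  note c = atlas_chart[OF A U(1)]
  have "continuous_on (U \<inter> W) \<phi>" using c(3) by (rule continuous_on_subset) auto
  moreover have "continuous_on (\<phi> ` (U \<inter> W)) (f \<circ> inv_into U \<phi>)"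
    using W(3)[rule_format, OF order_refl U(1)] by (rule smooth_on_imp_continuous_on)
  ultimately have "continuous_on (U \<inter> W) ((f \<circ> inv_into U \<phi>) \<circ> \<phi>)"
    by (rule continuous_on_compose)
  then have "continuous_on (U \<inter> W) f" by (rule continuous_on_eq) (simp add: c(5))
  moreover have "open (U \<inter> W)" "p \<in> U \<inter> W" using c(1) W U by auto
  ultimately show ?thesis by (simp add: continuous_on_eq_continuous_at)
qed

lemma smooth_at_nonzero:
  fixes A :: "('g::t2_space, 'e::euclidean_space) atlas"
  assumes "smooth_atlas A" "smooth_at A p f" "f p \<noteq> 0"
  shows "\<forall>\<^sub>F x in nhds p. f x \<noteq> 0"
proof -
  have "(f \<longlongrightarrow> f p) (nhds p)"
    using smooth_at_imp_isCont[OF assms(1,2)] tendsto_at_iff_tendsto_nhds[of f p] by (simp add: isCont_def)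
  then show ?thesis using tendsto_imp_eventually_ne assms(3) by blast
qed

lemma smooth_at_inverse:
  fixes A :: "('g::t2_space, 'e::euclidean_space) atlas"
  assumes A: "smooth_atlas A" and "smooth_at A p f" "f p \<noteq> 0"
  shows "smooth_at A p (\<lambda>x. inverse (f x))"
proof -
  obtain W where W: "open W" "p \<in> W"
    "\<forall>U \<phi> W'. W' \<subseteq> W \<longrightarrow> (U, \<phi>) \<in> A \<longrightarrow> smooth_on (f \<circ> inv_into U \<phi>) (\<phi> ` (U \<inter> W'))"
    using smooth_at_subset[OF assms(2)] by (elim exE conjE) (rule that)
  obtain V where V: "open V" "p \<in> V" "\<And>x. x \<in> V \<Longrightarrow> f x \<noteq> 0"
    using smooth_at_nonzero[OF assms] by (auto simp: eventually_nhds)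
  show ?thesis
    unfolding smooth_at_def
  proof (intro exI[of _ "W \<inter> V"] conjI allI impI)
    show "open (W \<inter> V)" using W V by blast
    show "p \<in> W \<inter> V" using W V by blast
    fix U \<phi> assume U: "(U, \<phi>) \<in> A"
    have o: "open (\<phi> ` (U \<inter> (W \<inter> V)))"
      using chart_image_open[OF A U] W(1) V(1) by (simp add: open_Int)
    have "smooth_on (f \<circ> inv_into U \<phi>) (\<phi> ` (U \<inter> (W \<inter> V)))"
      using W(3) U by simp
    moreover have "(f \<circ> inv_into U \<phi>) x \<noteq> 0" if "x \<in> \<phi> ` (U \<inter> (W \<inter> V))" for x
      using that V(3) atlas_chart(5)[OF A U] by auto
    ultimately have "smooth_on (\<lambda>x. inverse ((f \<circ> inv_into U \<phi>) x)) (\<phi> ` (U \<inter> (W \<inter> V)))"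
      by (rule smooth_on_inverse[OF o])
    then show "smooth_on ((\<lambda>x. inverse (f x)) \<circ> inv_into U \<phi>) (\<phi> ` (U \<inter> (W \<inter> V)))"
      by (simp add: o_def)
  qed
qed

lemma smooth_functions_const: "(\<lambda>_. c) \<in> smooth_functions A"
  by (simp add: smooth_functions_iff o_def smooth_on_const)

lemma smooth_functions_add:
  "smooth_atlas A \<Longrightarrow> f \<in> smooth_functions A \<Longrightarrow> g \<in> smooth_functions A \<Longrightarrow>
    (\<lambda>x. f x + g x) \<in> smooth_functions A"
  by (simp add: smooth_functions_iff_smooth_at smooth_at_add)

lemma smooth_functions_mult:
  "smooth_atlas A \<Longrightarrow> f \<in> smooth_functions A \<Longrightarrow> g \<in> smooth_functions A \<Longrightarrow>
    (\<lambda>x. f x * g x) \<in> smooth_functions A"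
  by (simp add: smooth_functions_iff_smooth_at smooth_at_mult)

lemma smooth_functions_sum:
  "smooth_atlas A \<Longrightarrow> (\<And>i. i \<in> I \<Longrightarrow> f i \<in> smooth_functions A) \<Longrightarrow>
    (\<lambda>x. \<Sum>i\<in>I. f i x) \<in> smooth_functions A"
  by (simp add: smooth_functions_iff_smooth_at smooth_at_sum)


section \<open>Products\<close>

lemma inv_into_map_prod:
  assumes "z \<in> \<phi> ` U \<times> \<psi> ` V" "inj_on \<phi> U" "inj_on \<psi> V"
  shows "inv_into (U \<times> V) (map_prod \<phi> \<psi>) z = (inv_into U \<phi> (fst z), inv_into V \<psi> (snd z))"
proof -
  obtain x y where xy: "z = (\<phi> x, \<psi> y)" "x \<in> U" "y \<in> V" using assms(1) by auto
  have "inj_on (map_prod \<phi> \<psi>) (U \<times> V)"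
    using assms(2,3) by (auto simp: inj_on_def)
  then show ?thesis
    using xy assms inv_into_f_f[of "map_prod \<phi> \<psi>" "U \<times> V" "(x, y)"] by simp
qed

lemma atlas_chart_inj:
  assumes "smooth_atlas A" "(U, \<phi>) \<in> A"
  shows "inj_on \<phi> U"
  using atlas_chart(5)[OF assms] by (metis inj_onI)

lemma smooth_atlas_product:
  fixes A :: "('g::topological_space, 'e::euclidean_space) atlas"
    and B :: "('h::topological_space, 'f::euclidean_space) atlas"
  assumes A: "smooth_atlas A" and B: "smooth_atlas B"
  shows "smooth_atlas (product_atlas A B)"
proof -
  have cover: "\<exists>X\<in>product_atlas A B. z \<in> fst X" for z
  proof -
    obtain U \<phi> V \<psi> where "(U, \<phi>) \<in> A" "fst z \<in> U" "(V, \<psi>) \<in> B" "snd z \<in> V"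
      using atlas_cover[OF A] atlas_cover[OF B] by metis
    then show ?thesis
      by (intro bexI[of _ "(U \<times> V, map_prod \<phi> \<psi>)"]) (auto simp: product_atlas_def mem_Times_iff)
  qed
  have chart: "open (U \<times> V)" "open (map_prod \<phi> \<psi> ` (U \<times> V))"
    "homeomorphism (U \<times> V) (map_prod \<phi> \<psi> ` (U \<times> V)) (map_prod \<phi> \<psi>) (inv_into (U \<times> V) (map_prod \<phi> \<psi>))"
    if U: "(U, \<phi>) \<in> A" and V: "(V, \<psi>) \<in> B" for U \<phi> V \<psi>
  proof -
    note a = atlas_chart[OF A U] and b = atlas_chart[OF B V]
    have im: "map_prod \<phi> \<psi> ` (U \<times> V) = \<phi> ` U \<times> \<psi> ` V" by force
    show "open (U \<times> V)" using a b by (intro open_Times)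
    show "open (map_prod \<phi> \<psi> ` (U \<times> V))" unfolding im using a b by (intro open_Times)
    have inv: "inv_into (U \<times> V) (map_prod \<phi> \<psi>) z = (inv_into U \<phi> (fst z), inv_into V \<psi> (snd z))"
      if "z \<in> \<phi> ` U \<times> \<psi> ` V" for z
      using that atlas_chart_inj[OF A U] atlas_chart_inj[OF B V] by (rule inv_into_map_prod)
    show "homeomorphism (U \<times> V) (map_prod \<phi> \<psi> ` (U \<times> V)) (map_prod \<phi> \<psi>)
      (inv_into (U \<times> V) (map_prod \<phi> \<psi>))"
      unfolding homeomorphism_def im
    proof (intro conjI ballI)
      show "inv_into (U \<times> V) (map_prod \<phi> \<psi>) (map_prod \<phi> \<psi> z) = z" if "z \<in> U \<times> V" for z
        using that a(5) b(5) by (subst inv) auto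
      show "map_prod \<phi> \<psi> (inv_into (U \<times> V) (map_prod \<phi> \<psi>) z) = z" if "z \<in> \<phi> ` U \<times> \<psi> ` V" for z
        using that a(5) b(5) by (subst inv) auto
      show "\<phi> ` U \<times> \<psi> ` V = \<phi> ` U \<times> \<psi> ` V" by (rule refl)
      have "continuous_on (U \<times> V) (\<lambda>z. (\<phi> (fst z), \<psi> (snd z)))"
        by (intro continuous_on_Pair continuous_on_compose2[OF a(3)] continuous_on_compose2[OF b(3)]
            continuous_on_fst continuous_on_snd continuous_on_id) auto
      then show "continuous_on (U \<times> V) (map_prod \<phi> \<psi>)"
        by (simp add: map_prod_def case_prod_beta')
      have "(\<lambda>z. (inv_into U \<phi> (fst z), inv_into V \<psi> (snd z))) ` (\<phi> ` U \<times> \<psi> ` V) = U \<times> V"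
        using a(5) b(5) by force
      then show "inv_into (U \<times> V) (map_prod \<phi> \<psi>) ` (\<phi> ` U \<times> \<psi> ` V) = U \<times> V"
        using inv by (simp cong: image_cong)
      have "continuous_on (\<phi> ` U \<times> \<psi> ` V) (\<lambda>z. (inv_into U \<phi> (fst z), inv_into V \<psi> (snd z)))"
        by (intro continuous_on_Pair continuous_on_compose2[OF a(4)] continuous_on_compose2[OF b(4)]
            continuous_on_fst continuous_on_snd continuous_on_id) auto
      then show "continuous_on (\<phi> ` U \<times> \<psi> ` V) (inv_into (U \<times> V) (map_prod \<phi> \<psi>))"
        by (rule continuous_on_eq) (simp add: inv)
    qed
  qed
  have trans: "smooth_on (map_prod \<phi>' \<psi>' \<circ> inv_into (U \<times> V) (map_prod \<phi> \<psi>))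
      (map_prod \<phi> \<psi> ` ((U \<times> V) \<inter> (U' \<times> V')))"
    if U: "(U, \<phi>) \<in> A" and V: "(V, \<psi>) \<in> B" and U': "(U', \<phi>') \<in> A" and V': "(V', \<psi>') \<in> B"
    for U \<phi> V \<psi> U' \<phi>' V' \<psi>'
  proof -
    let ?S = "\<phi> ` (U \<inter> U')" and ?T = "\<psi> ` (V \<inter> V')"
    have im: "map_prod \<phi> \<psi> ` ((U \<times> V) \<inter> (U' \<times> V')) = ?S \<times> ?T" by force
    have S: "open ?S" using chart_image_open[OF A U] atlas_chart(1)[OF A U'] .
    have T: "open ?T" using chart_image_open[OF B V] atlas_chart(1)[OF B V'] .
    have ST: "open (?S \<times> ?T)" using S T by (rule open_Times)
    have "smooth_on ((\<phi>' \<circ> inv_into U \<phi>) \<circ> fst) (?S \<times> ?T)"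
      by (rule smooth_on_compose[OF ST smooth_on_bounded_linear[OF ST bounded_linear_fst] atlas_transition[OF A U U']])
        auto
    moreover have "smooth_on ((\<psi>' \<circ> inv_into V \<psi>) \<circ> snd) (?S \<times> ?T)"
      by (rule smooth_on_compose[OF ST smooth_on_bounded_linear[OF ST bounded_linear_snd] atlas_transition[OF B V V']])
        auto
    ultimately have "smooth_on (\<lambda>z. (((\<phi>' \<circ> inv_into U \<phi>) \<circ> fst) z, ((\<psi>' \<circ> inv_into V \<psi>) \<circ> snd) z)) (?S \<times> ?T)"
      by (rule smooth_on_Pair[OF ST])
    moreover have "(((\<phi>' \<circ> inv_into U \<phi>) \<circ> fst) z, ((\<psi>' \<circ> inv_into V \<psi>) \<circ> snd) z) =
        (map_prod \<phi>' \<psi>' \<circ> inv_into (U \<times> V) (map_prod \<phi> \<psi>)) z" if "z \<in> ?S \<times> ?T" for z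
    proof -
      have "z \<in> \<phi> ` U \<times> \<psi> ` V" using that by auto
      from inv_into_map_prod[OF this atlas_chart_inj[OF A U] atlas_chart_inj[OF B V]]
      show ?thesis by simp
    qed
    ultimately show ?thesis
      unfolding im by (rule smooth_on_eq[OF ST])
  qed
  show ?thesis
    unfolding smooth_atlas_def
  proof (intro conjI)
    show "(\<Union>(U, \<phi>)\<in>product_atlas A B. U) = UNIV"
      using cover unfolding case_prod_beta by blast
    show "\<forall>(U, \<phi>)\<in>product_atlas A B. open U \<and> open (\<phi> ` U) \<and> homeomorphism U (\<phi> ` U) \<phi> (inv_into U \<phi>)"
    proof -
      have "open X \<and> open (\<rho> ` X) \<and> homeomorphism X (\<rho> ` X) \<rho> (inv_into X \<rho>)"
        if X: "(X, \<rho>) \<in> product_atlas A B" for X \<rho>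
      proof -
        obtain U \<phi> V \<psi> where "(U, \<phi>) \<in> A" "(V, \<psi>) \<in> B" "X = U \<times> V" "\<rho> = map_prod \<phi> \<psi>"
          using X unfolding product_atlas_def by blast
        then show ?thesis using chart by simp
      qed
      then show ?thesis by auto
    qed
    show "\<forall>(U, \<phi>)\<in>product_atlas A B. \<forall>(V, \<psi>)\<in>product_atlas A B. smooth_on (\<psi> \<circ> inv_into U \<phi>) (\<phi> ` (U \<inter> V))"
    proof -
      have "smooth_on (\<psi> \<circ> inv_into U \<phi>) (\<phi> ` (U \<inter> V))"
        if "(U, \<phi>) \<in> product_atlas A B" "(V, \<psi>) \<in> product_atlas A B" for U \<phi> V \<psi>
        using that trans by (auto simp: product_atlas_def)
      then show ?thesis by auto
    qed
  qed
qed

lemma smooth_map_pair_left: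
  fixes A :: "('g::topological_space, 'e::euclidean_space) atlas"
    and B :: "('h::topological_space, 'f::euclidean_space) atlas"
  assumes A: "smooth_atlas A" and B: "smooth_atlas B"
  shows "smooth_map B (product_atlas A B) (\<lambda>y. (c, y))"
proof -
  have "smooth_on (map_prod \<phi> \<psi> \<circ> (\<lambda>y. (c, y)) \<circ> inv_into W \<xi>) (\<xi> ` (W \<inter> (\<lambda>y. (c, y)) -` (U \<times> V)))"
    if U: "(U, \<phi>) \<in> A" and V: "(V, \<psi>) \<in> B" and W: "(W, \<xi>) \<in> B" for U \<phi> V \<psi> W \<xi>
  proof -
    have o: "open (\<xi> ` (W \<inter> V))" using chart_image_open[OF B W] atlas_chart(1)[OF B V] .
    have "smooth_on (\<lambda>x. (\<phi> c, (\<psi> \<circ> inv_into W \<xi>) x)) (\<xi> ` (W \<inter> V))"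
      using o smooth_on_const atlas_transition[OF B W V] by (rule smooth_on_Pair)
    then have "smooth_on (map_prod \<phi> \<psi> \<circ> (\<lambda>y. (c, y)) \<circ> inv_into W \<xi>) (\<xi> ` (W \<inter> V))"
      by (simp add: o_def)
    then show ?thesis
      by (rule smooth_on_subset) auto
  qed
  moreover have "continuous_on UNIV (\<lambda>y. (c, y))"
    by (intro continuous_on_Pair continuous_on_const continuous_on_id)
  ultimately show ?thesis
    unfolding smooth_map_iff by (auto simp: product_atlas_def)
qed

text \<open>In charts this is a transition map followed by the linear swap. It makes the
  multiplication of the opposite group smooth and turns slices in one variable into slices in the
  other.\<close>

lemma smooth_map_swap:
  fixes A :: "('g::topological_space, 'e::euclidean_space) atlas"
    and B :: "('h::topological_space, 'f::euclidean_space) atlas"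
  assumes A: "smooth_atlas A" and B: "smooth_atlas B"
  shows "smooth_map (product_atlas A B) (product_atlas B A) prod.swap"
proof -
  have *: "smooth_on (map_prod \<psi>' \<phi>' \<circ> prod.swap \<circ> inv_into (U \<times> V) (map_prod \<phi> \<psi>))
      (map_prod \<phi> \<psi> ` ((U \<times> V) \<inter> prod.swap -` (V' \<times> U')))"
    if U: "(U, \<phi>) \<in> A" and V: "(V, \<psi>) \<in> B" and U': "(U', \<phi>') \<in> A" and V': "(V', \<psi>') \<in> B"
    for U \<phi> V \<psi> U' \<phi>' V' \<psi>'
  proof -
    let ?S = "map_prod \<phi> \<psi> ` ((U \<times> V) \<inter> (U' \<times> V'))"
    have P: "smooth_atlas (product_atlas A B)" using A B by (rule smooth_atlas_product)
    have c: "(U \<times> V, map_prod \<phi> \<psi>) \<in> product_atlas A B" "(U' \<times> V', map_prod \<phi>' \<psi>') \<in> product_atlas A B"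
      using U V U' V' by (auto simp: product_atlas_def)
    have o: "open ?S" using chart_image_open[OF P c(1)] atlas_chart(1)[OF P c(2)] .
    have "bounded_linear (prod.swap :: 'e \<times> 'f \<Rightarrow> _)"
      by (simp add: prod.swap_def[abs_def] bounded_linear_Pair bounded_linear_fst bounded_linear_snd)
    then have "smooth_on (prod.swap \<circ> (map_prod \<phi>' \<psi>' \<circ> inv_into (U \<times> V) (map_prod \<phi> \<psi>))) ?S"
      by (intro smooth_on_compose[OF o atlas_transition[OF P c] smooth_on_bounded_linear[OF open_UNIV]]) auto
    moreover have "(U \<times> V) \<inter> prod.swap -` (V' \<times> U') = (U \<times> V) \<inter> (U' \<times> V')" by auto
    moreover have "prod.swap \<circ> (map_prod \<phi>' \<psi>' \<circ> inv_into (U \<times> V) (map_prod \<phi> \<psi>)) =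
      map_prod \<psi>' \<phi>' \<circ> prod.swap \<circ> inv_into (U \<times> V) (map_prod \<phi> \<psi>)"
      by (simp add: fun_eq_iff map_prod_def case_prod_beta)
    ultimately show ?thesis by simp
  qed
  have "continuous_on UNIV (prod.swap :: 'g \<times> 'h \<Rightarrow> _)"
    by (simp add: prod.swap_def[abs_def] continuous_on_Pair continuous_on_fst continuous_on_snd)
  then show ?thesis
    unfolding smooth_map_iff
  proof (intro conjI allI impI)
    fix X X' Y Y' assume "(X, X') \<in> product_atlas A B" "(Y, Y') \<in> product_atlas B A"
    then show "smooth_on (Y' \<circ> prod.swap \<circ> inv_into X X') (X' ` (X \<inter> prod.swap -` Y))"
      using * by (auto simp: product_atlas_def)
  qed
qed

section \<open>Tangent vectors\<close>

lemma tangent_space_iff: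
  "t \<in> tangent_space A p \<longleftrightarrow> (\<exists>U \<phi> w. (U, \<phi>) \<in> A \<and> p \<in> U \<and> t = chart_vector A U \<phi> p w)"
  by (auto simp: tangent_space_def)

lemma chart_has_derivative:
  assumes "f \<in> smooth_functions A" "(U, \<phi>) \<in> A" "p \<in> U"
  shows "(f \<circ> inv_into U \<phi> has_derivative frechet_derivative (f \<circ> inv_into U \<phi>) (at (\<phi> p))) (at (\<phi> p))"
  using assms by (auto simp: smooth_functions_iff intro!: smooth_on_has_derivative[where S = "\<phi> ` U"])

lemma tangent_not_smooth: "t \<in> tangent_space A p \<Longrightarrow> f \<notin> smooth_functions A \<Longrightarrow> t f = 0"
  by (auto simp: tangent_space_iff chart_vector_def)

lemma tangent_const:
  assumes "t \<in> tangent_space A p"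
  shows "t (\<lambda>_. c) = 0"
  using assms by (auto simp: tangent_space_iff chart_vector_def o_def)

lemma tangent_add:
  assumes A: "smooth_atlas A" and t: "t \<in> tangent_space A p"
    and f: "f \<in> smooth_functions A" and g: "g \<in> smooth_functions A"
  shows "t (\<lambda>x. f x + g x) = t f + t g"
proof -
  obtain U \<phi> w where U: "(U, \<phi>) \<in> A" "p \<in> U" and t': "t = chart_vector A U \<phi> p w"
    using t unfolding tangent_space_iff by blast
  have "((\<lambda>x. (f \<circ> inv_into U \<phi>) x + (g \<circ> inv_into U \<phi>) x) has_derivative
    (\<lambda>w. frechet_derivative (f \<circ> inv_into U \<phi>) (at (\<phi> p)) w + frechet_derivative (g \<circ> inv_into U \<phi>) (at (\<phi> p)) w)) (at (\<phi> p))"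
    by (rule has_derivative_add[OF chart_has_derivative[OF f U] chart_has_derivative[OF g U]])
  from fun_cong[OF frechet_derivative_at[OF this], of w]
  show ?thesis
    using smooth_functions_add[OF A f g] f g by (simp add: t' chart_vector_def o_def)
qed

lemma tangent_mult:
  assumes A: "smooth_atlas A" and t: "t \<in> tangent_space A p"
    and f: "f \<in> smooth_functions A" and g: "g \<in> smooth_functions A"
  shows "t (\<lambda>x. f x * g x) = f p * t g + t f * g p"
proof -
  obtain U \<phi> w where U: "(U, \<phi>) \<in> A" "p \<in> U" and t': "t = chart_vector A U \<phi> p w"
    using t unfolding tangent_space_iff by blast
  have "((\<lambda>x. (f \<circ> inv_into U \<phi>) x * (g \<circ> inv_into U \<phi>) x) has_derivative
    (\<lambda>w. (f \<circ> inv_into U \<phi>) (\<phi> p) * frechet_derivative (g \<circ> inv_into U \<phi>) (at (\<phi> p)) w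
      + frechet_derivative (f \<circ> inv_into U \<phi>) (at (\<phi> p)) w * (g \<circ> inv_into U \<phi>) (\<phi> p))) (at (\<phi> p))"
    by (rule has_derivative_mult[OF chart_has_derivative[OF f U] chart_has_derivative[OF g U]])
  from fun_cong[OF frechet_derivative_at[OF this], of w]
  show ?thesis
    using smooth_functions_mult[OF A f g] f g atlas_chart(5)[OF A U]
    by (simp add: t' chart_vector_def o_def)
qed

lemma tangent_sum:
  assumes A: "smooth_atlas A" and t: "t \<in> tangent_space A p"
    and f: "\<And>i. i \<in> I \<Longrightarrow> f i \<in> smooth_functions A"
  shows "t (\<lambda>x. \<Sum>i\<in>I. f i x) = (\<Sum>i\<in>I. t (f i))"
  using f
proof (induction I rule: infinite_finite_induct)
  case (insert i I)
  then show ?case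
    using tangent_add[OF A t, of "f i" "\<lambda>x. \<Sum>i\<in>I. f i x"] smooth_functions_sum[OF A, of I f] by simp
qed (simp_all add: tangent_const[OF t])

text \<open>By the chain rule the result is the chart vector of the image of \<open>w\<close> under
  the derivative of \<open>F\<close> in charts. The guard is needed because f o F may be smooth
  although \<open>f\<close> is not, and tangent vectors must vanish on such
  \<open>f\<close>.\<close>

lemma tangent_push:
  fixes A :: "('g::topological_space, 'e::euclidean_space) atlas"
    and B :: "('h::topological_space, 'f::euclidean_space) atlas"
  assumes A: "smooth_atlas A" and B: "smooth_atlas B" and F: "smooth_map A B F"
    and t: "t \<in> tangent_space A p"
  shows "(\<lambda>f. if f \<in> smooth_functions B then t (f \<circ> F) else 0) \<in> tangent_space B (F p)"
proof -
  obtain U \<phi> w where U: "(U, \<phi>) \<in> A" "p \<in> U" and t': "t = chart_vector A U \<phi> p w"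
    using t unfolding tangent_space_iff by blast
  obtain V \<psi> where V: "(V, \<psi>) \<in> B" "F p \<in> V" using atlas_cover[OF B] .
  let ?F = "\<psi> \<circ> F \<circ> inv_into U \<phi>"
  let ?N = "\<phi> ` (U \<inter> F -` V)"
  have "open (F -` V)"
    using F atlas_chart(1)[OF B V(1)] by (auto simp: smooth_map_def intro: open_vimage)
  then have N: "open ?N" by (rule chart_image_open[OF A U(1)])
  have p: "\<phi> p \<in> ?N" using U V by auto
  have dF: "(?F has_derivative frechet_derivative ?F (at (\<phi> p))) (at (\<phi> p))"
    using smooth_mapD[OF F U(1) V(1)] p by (rule smooth_on_has_derivative)
  have "frechet_derivative (f \<circ> F \<circ> inv_into U \<phi>) (at (\<phi> p)) w =
      frechet_derivative (f \<circ> inv_into V \<psi>) (at (\<psi> (F p))) (frechet_derivative ?F (at (\<phi> p)) w)"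
    if f: "f \<in> smooth_functions B" for f
  proof -
    have Fp: "?F (\<phi> p) = \<psi> (F p)" using atlas_chart(5)[OF A U] by simp
    have "(f \<circ> inv_into V \<psi> has_derivative frechet_derivative (f \<circ> inv_into V \<psi>) (at (\<psi> (F p)))) (at (?F (\<phi> p)))"
      unfolding Fp by (rule chart_has_derivative[OF f V])
    from frechet_derivative_at[OF diff_chain_at[OF dF this]]
    have "frechet_derivative (f \<circ> inv_into V \<psi> \<circ> ?F) (at (\<phi> p)) w =
      frechet_derivative (f \<circ> inv_into V \<psi>) (at (\<psi> (F p))) (frechet_derivative ?F (at (\<phi> p)) w)"
      by (metis comp_apply)
    \<comment> \<open>The inserted chart cancels only on the open set \<open>?N\<close>, which is
      enough for derivatives at the point.\<close>
    moreover have "frechet_derivative (f \<circ> inv_into V \<psi> \<circ> ?F) (at (\<phi> p)) =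
        frechet_derivative (f \<circ> F \<circ> inv_into U \<phi>) (at (\<phi> p))"
      by (rule frechet_derivative_cong_open[OF N p])
        (use atlas_chart(5)[OF A U(1)] atlas_chart(5)[OF B V(1)] in auto)
    ultimately show ?thesis by simp
  qed
  then have "(\<lambda>f. if f \<in> smooth_functions B then t (f \<circ> F) else 0) =
      chart_vector B V \<psi> (F p) (frechet_derivative ?F (at (\<phi> p)) w)"
    using smooth_functions_compose[OF A B F] by (auto simp: fun_eq_iff t' chart_vector_def)
  then show ?thesis using V unfolding tangent_space_iff by blast
qed

text \<open>In a chart the derivative vanishes on a ball, so \<open>f\<close> is locally constant;
  connectedness does the rest.\<close>

lemma tangent_zero_imp_constant:
  fixes A :: "('g::topological_space, 'e::euclidean_space) atlas"
  assumes A: "smooth_atlas A" and conn: "connected (UNIV :: 'g set)" and f: "f \<in> smooth_functions A"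
    and zero: "\<And>p t. t \<in> tangent_space A p \<Longrightarrow> t f = 0"
  shows "f p = f q"
proof -
  have "f constant_on UNIV"
  proof (rule locally_constant_imp_constant[OF conn])
    fix a :: 'g
    obtain U \<phi> where U: "(U, \<phi>) \<in> A" "a \<in> U" using atlas_cover[OF A] .
    note c = atlas_chart[OF A U(1)]
    obtain e where e: "e > 0" "ball (\<phi> a) e \<subseteq> \<phi> ` U"
      using c(2) U(2) open_contains_ball by blast
    have "(f \<circ> inv_into U \<phi> has_derivative (\<lambda>h. 0)) (at x within ball (\<phi> a) e)" if x: "x \<in> ball (\<phi> a) e" for x
    proof -
      obtain y where y: "x = \<phi> y" "y \<in> U" using subsetD[OF e(2) x] by (rule imageE)
      have "frechet_derivative (f \<circ> inv_into U \<phi>) (at (\<phi> y)) w = 0" for w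
        using zero[of "chart_vector A U \<phi> y w" y] U y f by (auto simp: tangent_space_iff chart_vector_def)
      then have "frechet_derivative (f \<circ> inv_into U \<phi>) (at (\<phi> y)) = (\<lambda>w. 0)" by auto
      then show ?thesis
        using chart_has_derivative[OF f U(1) y(2)] y by (simp add: has_derivative_at_withinI)
    qed
    from has_derivative_zero_constant[OF convex_ball this]
    obtain b where b: "(f \<circ> inv_into U \<phi>) x = b" if "x \<in> ball (\<phi> a) e" for x by auto
    have fb: "f y = b" if "y \<in> U" "\<phi> y \<in> ball (\<phi> a) e" for y
      using b[OF that(2)] c(5)[OF that(1)] by simp
    show "\<exists>T. openin (top_of_set UNIV) T \<and> a \<in> T \<and> (\<forall>x\<in>T. f x = f a)"
    proof (intro exI[of _ "U \<inter> \<phi> -` ball (\<phi> a) e"] conjI ballI)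
      show "openin (top_of_set UNIV) (U \<inter> \<phi> -` ball (\<phi> a) e)"
        using continuous_open_preimage[OF c(3,1)] by simp
      show "a \<in> U \<inter> \<phi> -` ball (\<phi> a) e" using U e by simp
      then show "f x = f a" if "x \<in> U \<inter> \<phi> -` ball (\<phi> a) e" for x
        using that fb by simp
    qed
  qed
  then show ?thesis by (auto simp: constant_on_def)
qed

section \<open>Slices of smooth functions on a product and their mixed derivatives\<close>

context
  fixes A :: "('g::topological_space, 'e::euclidean_space) atlas"
    and B :: "('h::topological_space, 'f::euclidean_space) atlas"
    and f :: "'g \<times> 'h \<Rightarrow> real"
  assumes A: "smooth_atlas A" and B: "smooth_atlas B"
    and f: "f \<in> smooth_functions (product_atlas A B)"
begin

definition product_form where
  "product_form U \<phi> V \<psi> = f \<circ> inv_into (U \<times> V) (map_prod \<phi> \<psi>)"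

lemma smooth_slice_snd: "(\<lambda>y. f (x, y)) \<in> smooth_functions B"
  using smooth_functions_compose[OF B smooth_atlas_product[OF A B] smooth_map_pair_left[OF A B] f]
  by (simp add: o_def)

lemma smooth_slice_fst: "(\<lambda>x. f (x, y)) \<in> smooth_functions A"
proof -
  have "smooth_map A (product_atlas A B) (prod.swap \<circ> (\<lambda>x. (y, x)))"
    by (rule smooth_map_compose[OF A smooth_atlas_product[OF B A] smooth_atlas_product[OF A B]
          smooth_map_pair_left[OF B A] smooth_map_swap[OF B A]])
  from smooth_functions_compose[OF A smooth_atlas_product[OF A B] this f]
  show ?thesis by (simp add: o_def)
qed

context
  fixes U \<phi> V \<psi>
  assumes U: "(U, \<phi>) \<in> A" and V: "(V, \<psi>) \<in> B"
begin

lemma smooth_product_form: "smooth_on (product_form U \<phi> V \<psi>) (\<phi> ` U \<times> \<psi> ` V)"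
proof -
  have "(U \<times> V, map_prod \<phi> \<psi>) \<in> product_atlas A B" using U V by (auto simp: product_atlas_def)
  moreover have "map_prod \<phi> \<psi> ` (U \<times> V) = \<phi> ` U \<times> \<psi> ` V" by force
  ultimately show ?thesis
    using f unfolding smooth_functions_iff product_form_def by metis
qed

lemma product_form_eq:
  "x \<in> U \<Longrightarrow> y \<in> V \<Longrightarrow> product_form U \<phi> V \<psi> (\<phi> x, \<psi> y) = f (x, y)"
  using inv_into_map_prod[OF _ atlas_chart_inj[OF A U] atlas_chart_inj[OF B V], of "(\<phi> x, \<psi> y)"]
    atlas_chart(5)[OF A U] atlas_chart(5)[OF B V] by (simp add: product_form_def)

lemma open_product_form: "open (\<phi> ` U \<times> \<psi> ` V)"
  using atlas_chart(2)[OF A U] atlas_chart(2)[OF B V] by (rule open_Times)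

lemma differentiable_product_form:
  "x \<in> U \<Longrightarrow> y \<in> V \<Longrightarrow> product_form U \<phi> V \<psi> differentiable (at (\<phi> x, \<psi> y))"
  using smooth_on_has_derivative[OF smooth_product_form, of "(\<phi> x, \<psi> y)"] by (auto simp: differentiable_def)

lemma chart_vector_slice_snd:
  assumes "x \<in> U" "y \<in> V"
  shows "chart_vector B V \<psi> y w (\<lambda>y. f (x, y)) =
    frechet_derivative (product_form U \<phi> V \<psi>) (at (\<phi> x, \<psi> y)) (0, w)"
proof -
  have "frechet_derivative ((\<lambda>y. f (x, y)) \<circ> inv_into V \<psi>) (at (\<psi> y)) =
      frechet_derivative (\<lambda>z. product_form U \<phi> V \<psi> (\<phi> x, z)) (at (\<psi> y))"
    by (rule frechet_derivative_cong_open[OF atlas_chart(2)[OF B V]])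
      (use assms product_form_eq atlas_chart(5)[OF B V] in auto)
  then show ?thesis
    using frechet_derivative_snd_slice[OF differentiable_product_form[OF assms]] smooth_slice_snd
    by (simp add: chart_vector_def)
qed

lemma chart_vector_slice_fst:
  assumes "x \<in> U" "y \<in> V"
  shows "chart_vector A U \<phi> x v (\<lambda>x. f (x, y)) =
    frechet_derivative (product_form U \<phi> V \<psi>) (at (\<phi> x, \<psi> y)) (v, 0)"
proof -
  have "frechet_derivative ((\<lambda>x. f (x, y)) \<circ> inv_into U \<phi>) (at (\<phi> x)) =
      frechet_derivative (\<lambda>z. product_form U \<phi> V \<psi> (z, \<psi> y)) (at (\<phi> x))"
    by (rule frechet_derivative_cong_open[OF atlas_chart(2)[OF A U]])
      (use assms product_form_eq atlas_chart(5)[OF A U] in auto)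
  then show ?thesis
    using frechet_derivative_fst_slice[OF differentiable_product_form[OF assms]] smooth_slice_fst
    by (simp add: chart_vector_def)
qed

end

text \<open>In charts the function is the derivative of \<open>product_form\<close> in the fixed
  direction (0, w), restricted to a slice. This yields the smoothness of left invariant
  fields.\<close>

lemma smooth_tangent_slice_snd:
  assumes t: "t \<in> tangent_space B q"
  shows "(\<lambda>x. t (\<lambda>y. f (x, y))) \<in> smooth_functions A"
  unfolding smooth_functions_iff
proof (intro allI impI)
  fix U \<phi> assume U: "(U, \<phi>) \<in> A"
  obtain V \<psi> w where V: "(V, \<psi>) \<in> B" "q \<in> V" and t': "t = chart_vector B V \<psi> q w"
    using t unfolding tangent_space_iff by blast
  note c = atlas_chart[OF A U]
  have "smooth_on (\<lambda>z. frechet_derivative (product_form U \<phi> V \<psi>) (at z) (0, w)) (\<phi> ` U \<times> \<psi> ` V)"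
    by (rule smooth_on_frechet_derivative[OF smooth_product_form[OF U V(1)]])
  moreover have "smooth_on (\<lambda>x. (x, \<psi> q)) (\<phi> ` U)"
    using c(2) smooth_on_bounded_linear[OF c(2) bounded_linear_ident] smooth_on_const by (rule smooth_on_Pair)
  ultimately have "smooth_on ((\<lambda>z. frechet_derivative (product_form U \<phi> V \<psi>) (at z) (0, w)) \<circ> (\<lambda>x. (x, \<psi> q))) (\<phi> ` U)"
    using V by (intro smooth_on_compose[OF c(2)]) auto
  then show "smooth_on ((\<lambda>x. t (\<lambda>y. f (x, y))) \<circ> inv_into U \<phi>) (\<phi> ` U)"
    by (rule smooth_on_eq[OF c(2)]) (auto simp: t' c(5) chart_vector_slice_snd[OF U V(1) _ V(2)])
qed

text \<open>Both sides are mixed second derivatives of \<open>product_form\<close> in the directions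
  (v, 0) and (0, w). The hypothesis \<open>smooth\<close> ensures that the outer \<open>t\<close> on
  the right differentiates instead of returning its default value 0.\<close>

lemma tangent_slices_commute:
  assumes s: "s \<in> tangent_space A p" and t: "t \<in> tangent_space B q"
    and smooth: "(\<lambda>y. s (\<lambda>x. f (x, y))) \<in> smooth_functions B"
  shows "s (\<lambda>x. t (\<lambda>y. f (x, y))) = t (\<lambda>y. s (\<lambda>x. f (x, y)))"
proof -
  obtain U \<phi> v where U: "(U, \<phi>) \<in> A" "p \<in> U" and s': "s = chart_vector A U \<phi> p v"
    using s unfolding tangent_space_iff by blast
  obtain V \<psi> w where V: "(V, \<psi>) \<in> B" "q \<in> V" and t': "t = chart_vector B V \<psi> q w"
    using t unfolding tangent_space_iff by blast
  let ?F = "product_form U \<phi> V \<psi>"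
  have pq: "(\<phi> p, \<psi> q) \<in> \<phi> ` U \<times> \<psi> ` V" using U V by simp
  have diff: "(\<lambda>z. frechet_derivative ?F (at z) u) differentiable (at (\<phi> p, \<psi> q))" for u
    using smooth_on_has_derivative[OF smooth_on_frechet_derivative[OF smooth_product_form[OF U(1) V(1)], of u] pq]
    by (rule differentiableI)
  have "frechet_derivative ((\<lambda>x. t (\<lambda>y. f (x, y))) \<circ> inv_into U \<phi>) (at (\<phi> p)) =
      frechet_derivative (\<lambda>x. frechet_derivative ?F (at (x, \<psi> q)) (0, w)) (at (\<phi> p))"
    by (rule frechet_derivative_cong_open[OF atlas_chart(2)[OF A U(1)]])
      (use U V in \<open>auto simp: t' atlas_chart(5)[OF A U(1)] chart_vector_slice_snd[OF U(1) V(1) _ V(2)]\<close>)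
  then have 1: "s (\<lambda>x. t (\<lambda>y. f (x, y))) =
      frechet_derivative (\<lambda>z. frechet_derivative ?F (at z) (0, w)) (at (\<phi> p, \<psi> q)) (v, 0)"
    using smooth_tangent_slice_snd[OF t] frechet_derivative_fst_slice[OF diff]
    by (simp add: s' chart_vector_def[of A])
  have "frechet_derivative ((\<lambda>y. s (\<lambda>x. f (x, y))) \<circ> inv_into V \<psi>) (at (\<psi> q)) =
      frechet_derivative (\<lambda>y. frechet_derivative ?F (at (\<phi> p, y)) (v, 0)) (at (\<psi> q))"
    by (rule frechet_derivative_cong_open[OF atlas_chart(2)[OF B V(1)]])
      (use U V in \<open>auto simp: s' atlas_chart(5)[OF B V(1)] chart_vector_slice_fst[OF U(1) V(1) U(2)]\<close>)
  then have 2: "t (\<lambda>y. s (\<lambda>x. f (x, y))) =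
      frechet_derivative (\<lambda>z. frechet_derivative ?F (at z) (v, 0)) (at (\<phi> p, \<psi> q)) (0, w)"
    using smooth frechet_derivative_snd_slice[OF diff]
    by (simp add: t' chart_vector_def[of B])
  have "Ck_on 2 ?F (\<phi> ` U \<times> \<psi> ` V)"
    using smooth_product_form[OF U(1) V(1)] by (simp add: smooth_on_def)
  from second_derivative_symmetric[OF open_product_form[OF U(1) V(1)] pq this]
  show ?thesis using 1 2 by simp
qed

end

section \<open>Coefficients with respect to a frame\<close>

text \<open>Gaussian elimination over the local ring of germs of smooth functions.\<close>

lemma frame_coefficients_smooth_at:
  fixes A :: "('g::t2_space, 'e::euclidean_space) atlas"
    and E :: "'i \<Rightarrow> 'c \<Rightarrow> 'g \<Rightarrow> real"
  assumes A: "smooth_atlas A" and "finite I"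
    and "\<And>f. smooth_at A p (X f)"
    and "\<And>i f. i \<in> I \<Longrightarrow> smooth_at A p (E i f)"
    and "\<And>f. \<forall>\<^sub>F q in nhds p. X f q = (\<Sum>i\<in>I. c i q * E i f q)"
    and "\<And>a. (\<And>f. (\<Sum>i\<in>I. a i * E i f p) = 0) \<Longrightarrow> \<forall>i\<in>I. a i = 0"
    and "i \<in> I"
  shows "smooth_at A p (c i)"
  using assms(2-)
proof (induction I arbitrary: X E i rule: finite_induct)
  case empty
  then show ?case by simp
next
  case (insert j I)
  \<comment> \<open>A pivot: if column \<open>j\<close> vanished at \<open>p\<close> for every test
    function, the indicator of \<open>j\<close> would be a nontrivial relation.\<close>
  have "\<exists>g. E j g p \<noteq> 0"
  proof (rule ccontr)
    assume "\<not> ?thesis"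
    then have "(\<Sum>i\<in>insert j I. (if i = j then 1 else 0) * E i f p) = 0" for f
      by (intro sum.neutral) auto
    from insert.prems(4)[OF this] show False by simp
  qed
  then obtain g where g: "E j g p \<noteq> 0" by blast
  \<comment> \<open>Subtracting multiples of the pivot row \<open>g\<close> clears column
    \<open>j\<close> and leaves the unknowns \<open>c i\<close> of the other columns unchanged, so
    \<open>c\<close> stays fixed in the induction. Dividing by \<open>E j g\<close> is allowed near
    \<open>p\<close>.\<close>
  define X' where "X' f q = X f q - E j f q * (X g q * inverse (E j g q))" for f q
  define E' where "E' i f q = E i f q - E j f q * (E i g q * inverse (E j g q))" for i f q
  have smooth_inv: "smooth_at A p (\<lambda>q. inverse (E j g q))"
    using g insert.prems(2) by (intro smooth_at_inverse[OF A]) auto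
  have nz: "\<forall>\<^sub>F q in nhds p. E j g q \<noteq> 0"
    using g insert.prems(2) by (intro smooth_at_nonzero[OF A]) auto
  have smooth_I: "smooth_at A p (c i)" if "i \<in> I" for i
  proof (rule insert.IH[OF _ _ _ _ that])
    show "smooth_at A p (X' f)" for f
      unfolding X'_def using insert.prems(1,2) smooth_inv
      by (intro smooth_at_diff[OF A] smooth_at_mult[OF A]) auto
    show "smooth_at A p (E' i f)" if "i \<in> I" for i f
      unfolding E'_def using insert.prems(2) smooth_inv that
      by (intro smooth_at_diff[OF A] smooth_at_mult[OF A]) auto
    show "\<forall>\<^sub>F q in nhds p. X' f q = (\<Sum>i\<in>I. c i q * E' i f q)" for f
      using insert.prems(3)[of f] insert.prems(3)[of g] nz
    proof eventually_elim
      case (elim q)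
      have "(\<Sum>i\<in>I. c i q * E' i f q) =
          (\<Sum>i\<in>I. c i q * E i f q) - E j f q * ((\<Sum>i\<in>I. c i q * E i g q) * inverse (E j g q))"
        by (simp add: E'_def algebra_simps sum_subtractf sum_distrib_left sum_distrib_right)
      also have "\<dots> = (X f q - c j q * E j f q) - E j f q * ((X g q - c j q * E j g q) * inverse (E j g q))"
        using elim(1,2) insert.hyps by simp
      also have "\<dots> = X' f q" using elim(3) by (simp add: X'_def field_simps)
      finally show ?case by simp
    qed
    show "\<forall>i\<in>I. a i = 0" if a: "\<And>f. (\<Sum>i\<in>I. a i * E' i f p) = 0" for a
    proof -
      \<comment> \<open>Row \<open>g\<close> of a relation among the original columns forces this
        coefficient for column \<open>j\<close>; with it a relation among the \<open>E'\<close>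
        lifts to one among the \<open>E\<close>.\<close>
      define b where "b = - (\<Sum>i\<in>I. a i * E i g p) * inverse (E j g p)"
      have "(\<Sum>i\<in>insert j I. (a(j := b)) i * E i f p) = 0" for f
      proof -
        have "(\<Sum>i\<in>insert j I. (a(j := b)) i * E i f p) = b * E j f p + (\<Sum>i\<in>I. (a(j := b)) i * E i f p)"
          using insert.hyps by simp
        also have "(\<Sum>i\<in>I. (a(j := b)) i * E i f p) = (\<Sum>i\<in>I. a i * E i f p)"
          using insert.hyps by (intro sum.cong) auto
        also have "b * E j f p + (\<Sum>i\<in>I. a i * E i f p) = (\<Sum>i\<in>I. a i * E' i f p)"
          by (simp add: b_def E'_def algebra_simps sum_subtractf sum_distrib_left sum_distrib_right)
        finally show ?thesis using a by simp
      qed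
      from insert.prems(4)[OF this] show ?thesis using insert.hyps by (auto split: if_splits)
    qed
  qed
  show ?case
  proof (cases "i = j")
    case False
    then show ?thesis using smooth_I insert.prems(5) by simp
  next
    case True
    \<comment> \<open>Back substitution: the pivot row expresses \<open>c j\<close> by the
      coefficients already known to be smooth.\<close>
    have "smooth_at A p (\<lambda>q. (X g q - (\<Sum>i\<in>I. c i q * E i g q)) * inverse (E j g q))"
      using insert.prems(1,2) smooth_inv smooth_I
      by (intro smooth_at_mult[OF A] smooth_at_diff[OF A] smooth_at_sum[OF A]) auto
    moreover have "\<forall>\<^sub>F q in nhds p. (X g q - (\<Sum>i\<in>I. c i q * E i g q)) * inverse (E j g q) = c j q"
      using insert.prems(3)[of g] nz by eventually_elim (use insert.hyps in simp)
    ultimately show ?thesis using True by (auto intro: smooth_at_cong[OF A])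
  qed
qed

section \<open>Vector fields\<close>

lemma sum_fun_apply: "(\<Sum>i\<in>I. f i) x = (\<Sum>i\<in>I. f i x)"
  by (induction I rule: infinite_finite_induct) auto

lemma vf_scale_apply: "vf_scale f X p h = f p * X p h"
  by (simp add: vf_scale_def)

lemma vf_bracket_apply: "vf_bracket X Y p f = X p (\<lambda>q. Y q f) - Y p (\<lambda>q. X q f)"
  by (simp add: vf_bracket_def)

lemma vector_field_tangent: "X \<in> vector_fields A \<Longrightarrow> X p \<in> tangent_space A p"
  by (simp add: vector_fields_def)

lemma vector_field_not_smooth: "X \<in> vector_fields A \<Longrightarrow> f \<notin> smooth_functions A \<Longrightarrow> X p f = 0"
  using tangent_not_smooth[OF vector_field_tangent] .

lemma vector_field_smooth: "X \<in> vector_fields A \<Longrightarrow> (\<lambda>p. X p f) \<in> smooth_functions A"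
proof (cases "f \<in> smooth_functions A")
  case False
  assume "X \<in> vector_fields A"
  from vector_field_not_smooth[OF this False] show ?thesis
    using smooth_functions_const[of 0 A] by simp
qed (simp add: vector_fields_def)

lemma vf_bracket_antisym: "vf_bracket X Y = - vf_bracket Y X"
  by (simp add: fun_eq_iff vf_bracket_apply)

context
  fixes A :: "('g::topological_space, 'e::euclidean_space) atlas"
  assumes A: "smooth_atlas A"
begin

lemma vf_bracket_add_left:
  assumes "X \<in> vector_fields A" "X' \<in> vector_fields A" "Y \<in> vector_fields A"
  shows "vf_bracket (X + X') Y = vf_bracket X Y + vf_bracket X' Y"
  using tangent_add[OF A vector_field_tangent[OF assms(3)] vector_field_smooth[OF assms(1)] vector_field_smooth[OF assms(2)]]
  by (simp add: fun_eq_iff vf_bracket_apply)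

lemma vf_bracket_scale_left:
  assumes "f \<in> smooth_functions A" "X \<in> vector_fields A" "Y \<in> vector_fields A"
  shows "vf_bracket (vf_scale f X) Y = vf_scale f (vf_bracket X Y) - vf_scale (\<lambda>p. Y p f) X"
  using tangent_mult[OF A vector_field_tangent[OF assms(3)] assms(1) vector_field_smooth[OF assms(2)]]
  by (simp add: fun_eq_iff vf_bracket_apply vf_scale_apply algebra_simps)

lemma vf_bracket_add_right:
  assumes "X \<in> vector_fields A" "Y \<in> vector_fields A" "Y' \<in> vector_fields A"
  shows "vf_bracket X (Y + Y') = vf_bracket X Y + vf_bracket X Y'"
  using vf_bracket_add_left[OF assms(2,3,1)] by (simp add: vf_bracket_antisym[of X])

lemma vf_bracket_scale_right:
  assumes "f \<in> smooth_functions A" "X \<in> vector_fields A" "Y \<in> vector_fields A"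
  shows "vf_bracket X (vf_scale f Y) = vf_scale f (vf_bracket X Y) + vf_scale (\<lambda>p. X p f) Y"
  using vf_bracket_scale_left[OF assms(1,3,2)]
  by (simp add: vf_bracket_antisym[of X] fun_eq_iff vf_scale_apply algebra_simps)

end


section \<open>Lie groups\<close>

text \<open>Its left translations and left invariant fields are the right ones of the original
  group. Only the multiplication changes, so atlas, unit and inverses can be shared.\<close>

definition opposite_group :: "'g monoid \<Rightarrow> 'g monoid" where
  "opposite_group G = G\<lparr>mult := \<lambda>x y. y \<otimes>\<^bsub>G\<^esub> x\<rparr>"

lemma opposite_group_simps [simp]:
  "x \<otimes>\<^bsub>opposite_group G\<^esub> y = y \<otimes>\<^bsub>G\<^esub> x" "\<one>\<^bsub>opposite_group G\<^esub> = \<one>\<^bsub>G\<^esub>"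
  "carrier (opposite_group G) = carrier G"
  by (simp_all add: opposite_group_def)

lemma inv_opposite_group: "inv\<^bsub>opposite_group G\<^esub> x = inv\<^bsub>G\<^esub> x"
  by (simp add: m_inv_def conj_commute)

lemma group_opposite_group:
  assumes "group G"
  shows "group (opposite_group G)"
proof -
  interpret group G by fact
  show ?thesis
    by (rule groupI) (auto simp: m_assoc intro: r_inv_ex)
qed

lemma lie_group_opposite_group:
  fixes A :: "('g::{t2_space,second_countable_topology}, 'e::euclidean_space) atlas"
  assumes "lie_group G A"
  shows "lie_group (opposite_group G) A"
proof -
  have A: "smooth_atlas A" and "smooth_map (product_atlas A A) A (\<lambda>(x, y). x \<otimes>\<^bsub>G\<^esub> y)"
    using assms by (auto simp: lie_group_def)
  then have "smooth_map (product_atlas A A) A ((\<lambda>(x, y). x \<otimes>\<^bsub>G\<^esub> y) \<circ> prod.swap)"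
    using smooth_atlas_product[OF A A] smooth_map_swap[OF A A] by (intro smooth_map_compose)
  moreover have "(\<lambda>(x, y). x \<otimes>\<^bsub>G\<^esub> y) \<circ> prod.swap = (\<lambda>(x, y). x \<otimes>\<^bsub>opposite_group G\<^esub> y)"
    by auto
  ultimately show ?thesis
    using assms by (simp add: lie_group_def group_opposite_group inv_opposite_group)
qed

locale smooth_group =
  fixes G :: "('g::{t2_space,second_countable_topology}) monoid"
    and A :: "('g, 'e::euclidean_space) atlas"
  assumes lie_group: "lie_group G A"
begin

abbreviation mul (infixl "\<cdot>" 70) where "x \<cdot> y \<equiv> x \<otimes>\<^bsub>G\<^esub> y"
abbreviation unit where "unit \<equiv> \<one>\<^bsub>G\<^esub>"
abbreviation inver where "inver x \<equiv> inv\<^bsub>G\<^esub> x"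

lemma atlas: "smooth_atlas A"
  using lie_group by (simp add: lie_group_def)

lemma group_laws [simp]:
  "x \<cdot> y \<cdot> z = x \<cdot> (y \<cdot> z)" "unit \<cdot> x = x" "x \<cdot> unit = x"
  "inver x \<cdot> x = unit" "x \<cdot> inver x = unit" "inver x \<cdot> (x \<cdot> y) = y" "x \<cdot> (inver x \<cdot> y) = y"
proof -
  interpret group G using lie_group by (simp add: lie_group_def)
  have UN: "carrier G = UNIV" using lie_group by (simp add: lie_group_def)
  show 1: "x \<cdot> y \<cdot> z = x \<cdot> (y \<cdot> z)" for x y z using UN by (simp add: m_assoc)
  show 2: "unit \<cdot> x = x" "x \<cdot> unit = x" "inver x \<cdot> x = unit" "x \<cdot> inver x = unit" for x using UN by auto
  show "inver x \<cdot> (x \<cdot> y) = y" "x \<cdot> (inver x \<cdot> y) = y"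
    using 1[of "inver x" x y] 1[of x "inver x" y] 2 by simp_all
qed

lemma inv_into_translation: "inv_into UNIV (\<lambda>x. g \<cdot> x) y = inver g \<cdot> y"
proof (rule inv_into_f_eq)
  show "inj (\<lambda>x. g \<cdot> x)" by (rule injI) (metis group_laws(6))
qed simp_all

lemma mult_smooth:
  assumes "f \<in> smooth_functions A"
  shows "(\<lambda>z. f (fst z \<cdot> snd z)) \<in> smooth_functions (product_atlas A A)"
  using smooth_functions_compose[OF smooth_atlas_product[OF atlas atlas] atlas _ assms, of "\<lambda>(x, y). x \<cdot> y"]
    lie_group by (simp add: lie_group_def o_def case_prod_beta)

lemma smooth_map_translation: "smooth_map A A (\<lambda>x. g \<cdot> x)"
proof -
  have "smooth_map A A ((\<lambda>(x, y). x \<cdot> y) \<circ> (\<lambda>x. (g, x)))"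
    using lie_group
    by (intro smooth_map_compose[OF atlas smooth_atlas_product[OF atlas atlas] atlas]
        smooth_map_pair_left[OF atlas atlas]) (simp add: lie_group_def)
  then show ?thesis by (simp add: o_def)
qed

lemma smooth_translation: "f \<in> smooth_functions A \<Longrightarrow> (\<lambda>x. f (g \<cdot> x)) \<in> smooth_functions A"
  using smooth_functions_compose[OF atlas atlas smooth_map_translation] by (simp add: o_def)

lemma smooth_translation_iff: "(\<lambda>x. f (g \<cdot> x)) \<in> smooth_functions A \<longleftrightarrow> f \<in> smooth_functions A"
  using smooth_translation[of f g] smooth_translation[of "\<lambda>x. f (g \<cdot> x)" "inver g"] by auto

lemma tangent_translation:
  assumes "t \<in> tangent_space A q"
  shows "(\<lambda>f. t (\<lambda>x. f (g \<cdot> x))) \<in> tangent_space A (g \<cdot> q)"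
proof -
  \<comment> \<open>The guard of \<open>tangent_push\<close> drops out: translations are invertible,
    so a function is smooth exactly when its translate is.\<close>
  have "(\<lambda>f. if f \<in> smooth_functions A then t (f \<circ> (\<lambda>x. g \<cdot> x)) else 0) = (\<lambda>f. t (\<lambda>x. f (g \<cdot> x)))"
    using tangent_not_smooth[OF assms] by (auto simp: fun_eq_iff o_def smooth_translation_iff)
  then show ?thesis using tangent_push[OF atlas atlas smooth_map_translation assms, of g] by (simp only:)
qed

lemma left_field_apply: "left_field G u p f = u (\<lambda>x. f (p \<cdot> x))"
  by (simp add: left_field_def)

lemma left_field_unit [simp]: "left_field G u unit = u"
  by (simp add: left_field_def)

lemma left_field_translate: "left_field G u p (\<lambda>x. f (g \<cdot> x)) = left_field G u (g \<cdot> p) f"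
  by (simp add: left_field_def)

text \<open>Applied to \<open>f\<close>, the field is the derivative of f(px) in x at the unit,
  hence depends smoothly on the parameter p.\<close>

lemma left_field_vector_field:
  assumes "u \<in> tangent_space A unit"
  shows "left_field G u \<in> vector_fields A"
  unfolding vector_fields_def
proof (intro CollectI conjI allI ballI)
  show "left_field G u p \<in> tangent_space A p" for p
    using tangent_translation[OF assms, of p] by (simp add: left_field_def)
  show "(\<lambda>p. left_field G u p f) \<in> smooth_functions A" if "f \<in> smooth_functions A" for f
    using smooth_tangent_slice_snd[OF atlas atlas mult_smooth[OF that] assms] by (simp add: left_field_apply)
qed

lemma left_field_inj:
  assumes "left_field G u p = left_field G v p"
  shows "u = v"
proof
  fix f show "u f = v f"
    using fun_cong[OF assms, of "\<lambda>x. f (inver p \<cdot> x)"] by (simp add: left_field_def)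
qed

lemma tangent_eq_left_field:
  assumes "t \<in> tangent_space A p"
  obtains u where "u \<in> tangent_space A unit" "t = left_field G u p"
proof
  show "(\<lambda>f. t (\<lambda>x. f (inver p \<cdot> x))) \<in> tangent_space A unit"
    using tangent_translation[OF assms, of "inver p"] by simp
  show "t = left_field G (\<lambda>f. t (\<lambda>x. f (inver p \<cdot> x))) p"
    by (simp add: left_field_def)
qed

lemma vf_push_translation: "vf_push (\<lambda>x. g \<cdot> x) X p f = X (inver g \<cdot> p) (\<lambda>x. f (g \<cdot> x))"
  by (simp add: vf_push_def inv_into_translation o_def)

lemma vf_push_translation_vector_field:
  assumes "X \<in> vector_fields A"
  shows "vf_push (\<lambda>x. g \<cdot> x) X \<in> vector_fields A"
  unfolding vector_fields_def
proof (intro CollectI conjI allI ballI)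
  show "vf_push (\<lambda>x. g \<cdot> x) X p \<in> tangent_space A p" for p
  proof -
    have "vf_push (\<lambda>x. g \<cdot> x) X p = (\<lambda>f. X (inver g \<cdot> p) (\<lambda>x. f (g \<cdot> x)))"
      by (rule ext) (rule vf_push_translation)
    then show ?thesis
      using tangent_translation[OF vector_field_tangent[OF assms, of "inver g \<cdot> p"], of g] by simp
  qed
  show "(\<lambda>p. vf_push (\<lambda>x. g \<cdot> x) X p f) \<in> smooth_functions A" for f
    using smooth_translation[OF vector_field_smooth[OF assms], where g = "inver g"]
    by (simp add: vf_push_translation)
qed

lemma vf_push_left_field: "vf_push (\<lambda>x. g \<cdot> x) (left_field G u) = left_field G u"
  by (simp add: fun_eq_iff vf_push_translation left_field_translate)

end

lemma smooth_group_opposite: "smooth_group G A \<Longrightarrow> smooth_group (opposite_group G) A"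
  by (simp add: smooth_group_def lie_group_opposite_group)

text \<open>One field differentiates f(xy) in y at the unit, the other in x at \<open>p\<close>. The
  two orders of application are the two mixed derivatives, which agree by
  \<open>tangent_slices_commute\<close>.\<close>

lemma (in smooth_group) left_right_commute:
  assumes u: "u \<in> tangent_space A unit" and v: "v \<in> tangent_space A unit"
  shows "vf_bracket (left_field G u) (left_field (opposite_group G) v) = 0"
proof -
  interpret opp: smooth_group "opposite_group G" A
    by (rule smooth_group_opposite) unfold_locales
  have opp_field: "left_field (opposite_group G) v \<in> vector_fields A"
    using opp.left_field_vector_field v by simp
  have "left_field G u p (\<lambda>q. left_field (opposite_group G) v q f) =
      left_field (opposite_group G) v p (\<lambda>q. left_field G u q f)" for p f
  proof (cases "f \<in> smooth_functions A")
    case False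
    then show ?thesis
      using vector_field_not_smooth[OF left_field_vector_field[OF u]] vector_field_not_smooth[OF opp_field]
        tangent_const[OF vector_field_tangent[OF left_field_vector_field[OF u]], of _ 0]
        tangent_const[OF vector_field_tangent[OF opp_field], of _ 0] by simp
  next
    case True
    define s where "s = left_field (opposite_group G) v p"
    have s: "s \<in> tangent_space A p"
      unfolding s_def using opp_field by (rule vector_field_tangent)
    have sv: "left_field (opposite_group G) v (p \<cdot> y) f = s (\<lambda>x. f (x \<cdot> y))" for y
      by (simp add: s_def left_field_def)
    have "(\<lambda>q. left_field (opposite_group G) v q f) \<in> smooth_functions A"
      using opp_field by (rule vector_field_smooth)
    from smooth_translation[OF this, of p]
    have "(\<lambda>y. s (\<lambda>x. f (x \<cdot> y))) \<in> smooth_functions A" by (simp add: sv)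
    then show ?thesis
      using tangent_slices_commute[OF atlas atlas mult_smooth[OF True] s u]
      by (simp add: left_field_apply[of u] sv) (simp add: s_def)
  qed
  then show ?thesis by (simp add: fun_eq_iff vf_bracket_apply)
qed


section \<open>The frame of left invariant fields\<close>

text \<open>The bracket is deliberately absent: with the same \<iota> and \<open>B\<close> the
  opposite group is then an instance too, although its bracket has the opposite sign.\<close>

locale framed_group = smooth_group G A
  for G :: "('g::{t2_space,second_countable_topology}) monoid" and A :: "('g, 'e::euclidean_space) atlas" +
  fixes \<iota> :: "'a::real_vector \<Rightarrow> 'g tvec" and B :: "'a set"
  assumes iota_bij: "bij_betw \<iota> UNIV (tangent_space A \<one>\<^bsub>G\<^esub>)"
    and iota_add: "\<iota> (u + v) = \<iota> u + \<iota> v"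
    and iota_scale: "\<iota> (c *\<^sub>R u) = (\<lambda>f. c * \<iota> u f)"
    and finite_B: "finite B" and indep_B: "independent B" and span_B: "span B = UNIV"
begin

abbreviation C where "C \<equiv> smooth_functions A"
abbreviation VF where "VF \<equiv> vector_fields A"
abbreviation lf where "lf u \<equiv> left_field G (\<iota> u)"

lemma iota_tangent: "\<iota> u \<in> tangent_space A unit"
  using iota_bij by (auto simp: bij_betw_def)

lemma tangent_unitE:
  assumes "t \<in> tangent_space A unit"
  obtains u where "t = \<iota> u"
  using assms iota_bij by (auto simp: bij_betw_def)

lemma iota_inj: "\<iota> u = \<iota> v \<longleftrightarrow> u = v"
  using iota_bij by (auto simp: bij_betw_def inj_eq)

lemma lf_VF [simp]: "lf u \<in> VF"
  by (rule left_field_vector_field[OF iota_tangent])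

lemma lf_add: "lf (u + v) p f = lf u p f + lf v p f"
  by (simp add: left_field_def iota_add)

lemma lf_scale: "lf (c *\<^sub>R u) p f = c * lf u p f"
  by (simp add: left_field_def iota_scale)

lemma lf_zero: "lf 0 p f = 0"
  using lf_scale[of 0 0] by simp

lemma lf_sum: "lf (\<Sum>i\<in>I. u i) p f = (\<Sum>i\<in>I. lf (u i) p f)"
  by (induction I rule: infinite_finite_induct) (simp_all add: lf_zero lf_add)

lemma lf_inj: "lf u p = lf v p \<Longrightarrow> u = v"
  using left_field_inj iota_inj by blast

text \<open>The left Maurer-Cartan form at \<open>p\<close>, with values in the algebra.\<close>

definition pullback where "pullback p t = (THE u. t = lf u p)"

lemma pullback_lf [simp]: "pullback p (lf u p) = u"
  unfolding pullback_def using lf_inj by (intro the_equality) auto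

lemma lf_pullback: "t \<in> tangent_space A p \<Longrightarrow> lf (pullback p t) p = t"
  by (metis tangent_eq_left_field tangent_unitE pullback_lf)

lemma pullback_add:
  assumes "s \<in> tangent_space A p" "t \<in> tangent_space A p"
  shows "pullback p (s + t) = pullback p s + pullback p t"
proof -
  have "s + t = lf (pullback p s + pullback p t) p"
    using assms by (simp add: fun_eq_iff lf_add lf_pullback)
  then show ?thesis by simp
qed

lemma pullback_scale:
  assumes "t \<in> tangent_space A p"
  shows "pullback p (\<lambda>f. c * t f) = c *\<^sub>R pullback p t"
proof -
  have "(\<lambda>f. c * t f) = lf (c *\<^sub>R pullback p t) p"
    using assms by (simp add: fun_eq_iff lf_scale lf_pullback)
  then show ?thesis by simp
qed

lemma lf_tangent: "lf u p \<in> tangent_space A p"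
  by (rule vector_field_tangent[OF lf_VF])

lemma tangent_space_add: "s \<in> tangent_space A p \<Longrightarrow> t \<in> tangent_space A p \<Longrightarrow> s + t \<in> tangent_space A p"
  using lf_tangent[of "pullback p s + pullback p t" p] lf_pullback
  by (simp add: lf_add[abs_def] plus_fun_def)

lemma tangent_space_scale: "t \<in> tangent_space A p \<Longrightarrow> (\<lambda>f. c * t f) \<in> tangent_space A p"
  using lf_tangent[of "c *\<^sub>R pullback p t" p] lf_pullback by (simp add: lf_scale[abs_def])

lemma VF_add [simp]: "X \<in> VF \<Longrightarrow> Y \<in> VF \<Longrightarrow> X + Y \<in> VF"
  by (simp add: vector_fields_def tangent_space_add smooth_functions_add[OF atlas])

lemma VF_scale [simp]: "f \<in> C \<Longrightarrow> X \<in> VF \<Longrightarrow> vf_scale f X \<in> VF"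
  by (simp add: vector_fields_def vf_scale_def tangent_space_scale smooth_functions_mult[OF atlas])

lemma VF_zero [simp]: "0 \<in> VF"
  using VF_scale[OF smooth_functions_const[of 0] lf_VF[of 0]] by (simp add: vf_scale_def zero_fun_def)

lemma vf_scale_minus_one: "vf_scale (\<lambda>_. - 1) X = - X"
  by (simp add: fun_eq_iff vf_scale_apply)

lemma VF_minus [simp]: "X \<in> VF \<Longrightarrow> - X \<in> VF"
  using VF_scale[OF smooth_functions_const[of "- 1"]] by (simp add: vf_scale_minus_one)

lemma VF_diff [simp]: "X \<in> VF \<Longrightarrow> Y \<in> VF \<Longrightarrow> X - Y \<in> VF"
  using VF_add[of X "- Y"] by simp

lemma VF_apply_C [simp]: "X \<in> VF \<Longrightarrow> (\<lambda>p. X p f) \<in> C"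
  by (rule vector_field_smooth)

definition coef where "coef X b p = representation B (pullback p (X p)) b"

lemma coef_expansion: "X \<in> VF \<Longrightarrow> X p f = (\<Sum>b\<in>B. coef X b p * lf b p f)"
proof -
  assume X: "X \<in> VF"
  have "pullback p (X p) = (\<Sum>b\<in>B. coef X b p *\<^sub>R b)"
    unfolding coef_def using sum_representation_eq[OF indep_B _ finite_B order_refl] span_B by simp
  then have "lf (pullback p (X p)) p f = (\<Sum>b\<in>B. coef X b p * lf b p f)"
    by (simp add: lf_sum lf_scale)
  then show ?thesis using lf_pullback[OF vector_field_tangent[OF X]] by simp
qed

text \<open>Each test function gives one linear equation for the coefficients. The frame is
  independent at every point because left translation and \<iota> are injective, so elimination
  applies.\<close>

lemma coef_smooth [simp]:
  assumes X: "X \<in> VF" and b: "b \<in> B"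
  shows "coef X b \<in> C"
  unfolding smooth_functions_iff_smooth_at[OF atlas]
proof
  fix p
  show "smooth_at A p (coef X b)"
  proof (rule frame_coefficients_smooth_at[OF atlas finite_B _ _ _ _ b, where
        E = "\<lambda>b f q. lf b q f" and X = "\<lambda>f q. X q f"])
    show "smooth_at A p (\<lambda>q. X q f)" for f
      using VF_apply_C[OF X] smooth_functions_iff_smooth_at[OF atlas] by blast
    show "smooth_at A p (\<lambda>q. lf i q f)" for f i
      using VF_apply_C[OF lf_VF] smooth_functions_iff_smooth_at[OF atlas] by blast
    show "\<forall>\<^sub>F q in nhds p. X q f = (\<Sum>i\<in>B. coef X i q * lf i q f)" for f
      using coef_expansion[OF X] by simp
    show "\<forall>i\<in>B. a i = 0" if "\<And>f. (\<Sum>i\<in>B. a i * lf i p f) = 0" for a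
    proof -
      have "lf (\<Sum>i\<in>B. a i *\<^sub>R i) p = lf 0 p"
        using that by (simp add: fun_eq_iff lf_sum lf_scale lf_zero)
      then have "(\<Sum>i\<in>B. a i *\<^sub>R i) = 0" by (rule lf_inj)
      then show ?thesis using independentD[OF indep_B finite_B order_refl] by blast
    qed
  qed
qed

lemma VF_eq_sum: "X \<in> VF \<Longrightarrow> X = (\<Sum>b\<in>B. vf_scale (coef X b) (lf b))"
  by (simp add: fun_eq_iff sum_fun_apply vf_scale_apply coef_expansion[symmetric])

text \<open>Fields are finite sums of left invariant fields with smooth coefficients. An identity
  between expressions that behave alike under sums and function multiples need therefore be checked
  on left invariant fields only.\<close>

lemma VF_induct [consumes 1, case_names lf add scale]:
  assumes X: "X \<in> VF" and lf: "\<And>u. P (lf u)"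
    and add: "\<And>X Y. X \<in> VF \<Longrightarrow> Y \<in> VF \<Longrightarrow> P X \<Longrightarrow> P Y \<Longrightarrow> P (X + Y)"
    and scale: "\<And>f X. f \<in> C \<Longrightarrow> X \<in> VF \<Longrightarrow> P X \<Longrightarrow> P (vf_scale f X)"
  shows "P X"
proof -
  \<comment> \<open>Membership in \<open>VF\<close> is carried along because the rule
    \<open>add\<close> asks for it at every partial sum.\<close>
  have "(\<Sum>b\<in>F. vf_scale (coef X b) (lf b)) \<in> VF \<and> P (\<Sum>b\<in>F. vf_scale (coef X b) (lf b))"
    if "finite F" "F \<subseteq> B" for F
    using that
  proof (induction F)
    case empty
    have "lf 0 = 0" by (simp add: fun_eq_iff lf_zero)
    with lf[of 0] have "P 0" by simp
    with VF_zero show ?case unfolding sum.empty by (rule conjI)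
  next
    case (insert b F)
    then have IH: "(\<Sum>b\<in>F. vf_scale (coef X b) (lf b)) \<in> VF" "P (\<Sum>b\<in>F. vf_scale (coef X b) (lf b))"
      and b: "coef X b \<in> C" using X by simp_all
    show ?case
      unfolding sum.insert[OF insert.hyps]
      using add[OF VF_scale[OF b lf_VF] IH(1) scale[OF b lf_VF lf] IH(2)] VF_add[OF VF_scale[OF b lf_VF] IH(1)]
      by (intro conjI)
  qed
  from this[OF finite_B order_refl] show ?thesis using VF_eq_sum[OF X] by simp
qed

end

lemma framed_group_opposite:
  assumes "framed_group G A \<iota> B"
  shows "framed_group (opposite_group G) A \<iota> B"
  using assms unfolding framed_group_def framed_group_axioms_def
  by (auto intro: smooth_group_opposite)

text \<open>A field commuting with all left invariant fields has constant coefficients in the frame of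
  right invariant fields.\<close>

lemma (in framed_group) commute_imp_right_invariant:
  assumes conn: "connected (UNIV :: 'g set)" and X: "X \<in> VF"
    and comm: "\<And>u. vf_bracket (lf u) X = 0"
  obtains w where "X = left_field (opposite_group G) (\<iota> w)"
proof -
  interpret opp: framed_group "opposite_group G" A \<iota> B
    by (rule framed_group_opposite) unfold_locales
  have zero: "lf u p (opp.coef X b) = 0" if b: "b \<in> B" for u p b
  proof -
    \<comment> \<open>By the Leibniz rule this sum is the bracket of \<open>lf u\<close> and
      \<open>X\<close> applied to \<open>f\<close>: the remaining terms cancel since
      \<open>lf u\<close> commutes with the right invariant frame.\<close>
    have "(\<Sum>b\<in>B. lf u p (opp.coef X b) * opp.lf b p f) = 0" for f
    proof (cases "f \<in> C")
      case False
      then show ?thesis using vector_field_not_smooth[OF opp.lf_VF] by simp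
    next
      case True
      have comm': "lf u p (\<lambda>q. opp.lf b q f) = opp.lf b p (\<lambda>q. lf u q f)" for b
        using fun_cong[OF fun_cong[OF left_right_commute[OF iota_tangent iota_tangent]], of u b p f]
        by (simp add: vf_bracket_apply)
      have "lf u p (\<lambda>q. X q f) = lf u p (\<lambda>q. \<Sum>b\<in>B. opp.coef X b q * opp.lf b q f)"
        by (simp add: opp.coef_expansion[OF X])
      also have "\<dots> = (\<Sum>b\<in>B. lf u p (\<lambda>q. opp.coef X b q * opp.lf b q f))"
        using X by (intro tangent_sum[OF atlas lf_tangent] smooth_functions_mult[OF atlas]) auto
      also have "\<dots> = (\<Sum>b\<in>B. opp.coef X b p * lf u p (\<lambda>q. opp.lf b q f) + lf u p (opp.coef X b) * opp.lf b p f)"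
        using X by (intro sum.cong tangent_mult[OF atlas lf_tangent]) auto
      also have "\<dots> = X p (\<lambda>q. lf u q f) + (\<Sum>b\<in>B. lf u p (opp.coef X b) * opp.lf b p f)"
        by (simp add: sum.distrib comm' opp.coef_expansion[OF X])
      finally show ?thesis
        using fun_cong[OF fun_cong[OF comm], of u p f] by (simp add: vf_bracket_apply)
    qed
    then have "opp.lf (\<Sum>b\<in>B. lf u p (opp.coef X b) *\<^sub>R b) p = opp.lf 0 p"
      by (simp add: fun_eq_iff opp.lf_sum opp.lf_scale opp.lf_zero)
    then have "(\<Sum>b\<in>B. lf u p (opp.coef X b) *\<^sub>R b) = 0" by (rule opp.lf_inj)
    from independentD[where u = "\<lambda>b. lf u p (opp.coef X b)", OF indep_B finite_B order_refl this b]
    show ?thesis .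
  qed
  \<comment> \<open>The vectors \<open>lf u q\<close> exhaust the tangent space at \<open>q\<close>,
    so every tangent vector annihilates the coefficient.\<close>
  have const: "opp.coef X b p = opp.coef X b unit" if "b \<in> B" for b p
  proof (rule tangent_zero_imp_constant[OF atlas conn])
    show "t (opp.coef X b) = 0" if t: "t \<in> tangent_space A q" for q t
      using zero[OF \<open>b \<in> B\<close>, of "pullback q t" q] lf_pullback[OF t] by simp
  qed (use X that in simp)
  have "X = opp.lf (\<Sum>b\<in>B. opp.coef X b unit *\<^sub>R b)"
  proof (intro ext)
    show "X p f = opp.lf (\<Sum>b\<in>B. opp.coef X b unit *\<^sub>R b) p f" for p f
      unfolding opp.lf_sum opp.lf_scale opp.coef_expansion[OF X, of p f]
      by (rule sum.cong[OF refl]) (simp only: const[of _ p])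
  qed
  then show thesis by (rule that)
qed

lemmas fun_ops = plus_fun_apply zero_fun_apply minus_apply uminus_apply

text \<open>As simplification rules these would replace sums of fields by lambda terms, to which the rules for
  brackets and connections no longer apply.\<close>

declare fun_ops [simp del]

lemma vf_scale_zero [simp]: "vf_scale f 0 = 0"
  by (simp add: fun_eq_iff fun_ops vf_scale_apply)

section \<open>Existence of the connection belonging to a bilinear product\<close>

context framed_group
begin

lemma lf_add_field: "lf (u + v) = lf u + lf v"
  by (simp add: fun_eq_iff fun_ops lf_add)

lemma lf_scale_field: "lf (c *\<^sub>R u) = vf_scale (\<lambda>_. c) (lf u)"
  by (simp add: fun_eq_iff fun_ops lf_scale vf_scale_apply)

lemma lf_minus_field: "lf (- u) = - lf u"
  using lf_scale_field[of "- 1" u] by (simp add: vf_scale_minus_one)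

lemma lf_diff_field: "lf (u - v) = lf u - lf v"
  using lf_add_field[of u "- v"] by (simp add: lf_minus_field)

lemma lf_field_inj: "lf u = lf v \<longleftrightarrow> u = v"
  using lf_inj by metis

lemma VF_apply_const: "X \<in> VF \<Longrightarrow> X p (\<lambda>_. c) = 0"
  using tangent_const[OF vector_field_tangent] .

lemma pullback_expansion: "pullback p (X p) = (\<Sum>b\<in>B. coef X b p *\<^sub>R b)"
  unfolding coef_def using sum_representation_eq[OF indep_B _ finite_B order_refl] span_B by simp

lemma coef_add:
  assumes "X \<in> VF" "Y \<in> VF"
  shows "coef (X + Y) b = (\<lambda>p. coef X b p + coef Y b p)"
  using assms span_B
  by (simp add: fun_eq_iff fun_ops coef_def pullback_add vector_field_tangent representation_add[OF indep_B])

lemma coef_scale: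
  assumes "X \<in> VF"
  shows "coef (vf_scale f X) b = (\<lambda>p. f p * coef X b p)"
  using assms span_B
  by (simp add: fun_eq_iff fun_ops coef_def vf_scale_def pullback_scale vector_field_tangent representation_scale[OF indep_B])

lemma coef_lf: "coef (lf u) b = (\<lambda>_. representation B u b)"
  by (simp add: fun_eq_iff fun_ops coef_def)

text \<open>In the frame \<open>b\<^sup>+\<close> this is \<open>\<Sum>\<^sub>b X(Y\<^sub>b) b\<^sup>+ + \<Sum>\<^sub>b\<^sub>c X\<^sub>b Y\<^sub>c (b.c)\<^sup>+\<close>.\<close>

definition product_connection :: "('a \<Rightarrow> 'a \<Rightarrow> 'a) \<Rightarrow> 'g vfield \<Rightarrow> 'g vfield \<Rightarrow> 'g vfield" where
  "product_connection m X Y =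
     (if X \<in> VF \<and> Y \<in> VF
      then (\<lambda>p. lf ((\<Sum>b\<in>B. X p (coef Y b) *\<^sub>R b) + m (pullback p (X p)) (pullback p (Y p))) p)
      else 0)"

lemma product_connection_apply:
  "X \<in> VF \<Longrightarrow> Y \<in> VF \<Longrightarrow> product_connection m X Y p f =
     (\<Sum>b\<in>B. X p (coef Y b) * lf b p f) + lf (m (pullback p (X p)) (pullback p (Y p))) p f"
  by (simp add: product_connection_def lf_add lf_sum lf_scale)

lemma product_connection_VF:
  assumes m: "bilinear m" and X: "X \<in> VF" and Y: "Y \<in> VF"
  shows "product_connection m X Y \<in> VF"
  unfolding vector_fields_def
proof (intro CollectI conjI allI ballI)
  show "product_connection m X Y p \<in> tangent_space A p" for p
    using X Y by (simp add: product_connection_def lf_tangent)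
  \<comment> \<open>The pointwise product is expanded in the basis to exhibit it as a combination of
    fixed fields with smooth coefficients.\<close>
  have "lf (m (pullback p (X p)) (pullback p (Y p))) p f =
      (\<Sum>(b, c)\<in>B \<times> B. coef X b p * (coef Y c p * lf (m b c) p f))" for p f
    unfolding pullback_expansion bilinear_sum[OF m]
    by (simp add: lf_sum case_prod_beta bilinear_lmul[OF m] bilinear_rmul[OF m] lf_scale mult_ac)
  then show "(\<lambda>p. product_connection m X Y p f) \<in> C" for f
    using X Y coef_smooth[OF Y]
    by (auto simp: product_connection_apply case_prod_beta
        intro!: smooth_functions_add[OF atlas] smooth_functions_sum[OF atlas] smooth_functions_mult[OF atlas])
qed

lemma linear_connection_product:
  assumes m: "bilinear m"
  shows "linear_connection A (product_connection m)"
  unfolding linear_connection_def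
proof (intro conjI ballI allI impI)
  fix X X' Y Y' f
  note pc = product_connection_apply
  show "product_connection m X Y \<in> VF" if "X \<in> VF" "Y \<in> VF"
    using product_connection_VF[OF m that] .
  show "product_connection m (X + X') Y = product_connection m X Y + product_connection m X' Y"
    if "X \<in> VF" "X' \<in> VF" "Y \<in> VF"
    using that by (simp add: fun_eq_iff fun_ops pc pullback_add vector_field_tangent bilinear_ladd[OF m] lf_add
        algebra_simps sum.distrib)
  show "product_connection m (vf_scale f X) Y = vf_scale f (product_connection m X Y)"
    if "f \<in> C" "X \<in> VF" "Y \<in> VF"
    using that pullback_scale[OF vector_field_tangent]
    by (simp add: fun_eq_iff fun_ops pc vf_scale_def bilinear_lmul[OF m] lf_scale VF_scale[unfolded vf_scale_def]
        algebra_simps sum_distrib_left)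
  show "product_connection m X (Y + Y') = product_connection m X Y + product_connection m X Y'"
    if "X \<in> VF" "Y \<in> VF" "Y' \<in> VF"
    using that tangent_add[OF atlas vector_field_tangent[OF that(1)] coef_smooth[OF that(2)] coef_smooth[OF that(3)]]
    by (simp add: fun_eq_iff fun_ops pc pullback_add vector_field_tangent bilinear_radd[OF m] lf_add coef_add
        algebra_simps sum.distrib)
  show "product_connection m X (vf_scale f Y) =
      vf_scale (\<lambda>p. X p f) Y + vf_scale f (product_connection m X Y)"
    if "f \<in> C" "X \<in> VF" "Y \<in> VF"
  proof -
    have "product_connection m X (vf_scale f Y) p h =
        X p f * (\<Sum>b\<in>B. coef Y b p * lf b p h) + f p * product_connection m X Y p h" for p h
      using that tangent_mult[OF atlas vector_field_tangent[OF that(2)] that(1) coef_smooth[OF that(3)]]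
        pullback_scale[OF vector_field_tangent[OF that(3)]]
      by (simp add: pc coef_scale) (simp add: vf_scale_def bilinear_rmul[OF m] lf_scale algebra_simps
          sum_distrib_left sum.distrib)
    then show ?thesis
      using coef_expansion[OF that(3)] by (simp add: fun_eq_iff fun_ops vf_scale_apply)
  qed
  show "product_connection m X Y = 0" if "X \<notin> VF \<or> Y \<notin> VF"
    using that by (auto simp: product_connection_def)
qed

lemma product_connection_lf: "product_connection m (lf u) (lf v) = lf (m u v)"
  by (simp add: fun_eq_iff fun_ops product_connection_apply coef_lf VF_apply_const)

end


section \<open>Linear connections on a Lie group\<close>

locale connection = framed_group G A \<iota> B
  for G :: "('g::{t2_space,second_countable_topology}) monoid" and A :: "('g, 'e::euclidean_space) atlas"
    and \<iota> :: "'a::real_vector \<Rightarrow> 'g tvec" and B +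
  fixes D :: "'g vfield \<Rightarrow> 'g vfield \<Rightarrow> 'g vfield"
  assumes D: "linear_connection A D"
begin

lemma D_VF [simp]: "X \<in> VF \<Longrightarrow> Y \<in> VF \<Longrightarrow> D X Y \<in> VF"
  and D_add1: "X \<in> VF \<Longrightarrow> X' \<in> VF \<Longrightarrow> Y \<in> VF \<Longrightarrow> D (X + X') Y = D X Y + D X' Y"
  and D_scale1: "f \<in> C \<Longrightarrow> X \<in> VF \<Longrightarrow> Y \<in> VF \<Longrightarrow> D (vf_scale f X) Y = vf_scale f (D X Y)"
  and D_add2: "X \<in> VF \<Longrightarrow> Y \<in> VF \<Longrightarrow> Y' \<in> VF \<Longrightarrow> D X (Y + Y') = D X Y + D X Y'"
  and D_scale2: "f \<in> C \<Longrightarrow> X \<in> VF \<Longrightarrow> Y \<in> VF \<Longrightarrow>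
    D X (vf_scale f Y) = vf_scale (\<lambda>p. X p f) Y + vf_scale f (D X Y)"
  and D_outside: "X \<notin> VF \<or> Y \<notin> VF \<Longrightarrow> D X Y = 0"
  using D unfolding linear_connection_def by blast+

lemma D_minus1: "X \<in> VF \<Longrightarrow> Y \<in> VF \<Longrightarrow> D (- X) Y = - D X Y"
  using D_scale1[OF smooth_functions_const[of "- 1"]] by (simp add: vf_scale_minus_one)

lemma D_minus2: "X \<in> VF \<Longrightarrow> Y \<in> VF \<Longrightarrow> D X (- Y) = - D X Y"
  using D_scale2[OF smooth_functions_const[of "- 1"], of X Y]
  by (simp add: VF_apply_const vf_scale_minus_one) (simp add: fun_eq_iff fun_ops vf_scale_apply)

lemma D_diff1: "X \<in> VF \<Longrightarrow> X' \<in> VF \<Longrightarrow> Y \<in> VF \<Longrightarrow> D (X - X') Y = D X Y - D X' Y"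
  using D_add1[of X "- X'" Y] by (simp add: D_minus1)

lemma D_diff2: "X \<in> VF \<Longrightarrow> Y \<in> VF \<Longrightarrow> Y' \<in> VF \<Longrightarrow> D X (Y - Y') = D X Y - D X Y'"
  using D_add2[of X Y "- Y'"] by (simp add: D_minus2)

lemma D_zero1: "Y \<in> VF \<Longrightarrow> D 0 Y = 0"
  using D_diff1[of 0 0 Y] by simp

lemma D_zero2: "X \<in> VF \<Longrightarrow> D X 0 = 0"
  using D_diff2[of X 0 0] by simp

text \<open>The difference of two connections is tensorial: their derivative terms X(f) Y coincide,
  so agreement on the frame propagates first in \<open>Y\<close>, then in \<open>X\<close>.\<close>

lemma connection_eqI:
  assumes "linear_connection A D'" "\<And>u v. D (lf u) (lf v) = D' (lf u) (lf v)"
  shows "D = D'"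
proof (intro ext)
  interpret D': connection G A \<iota> B D'
    by unfold_locales (rule assms(1))
  have 1: "D (lf u) Y = D' (lf u) Y" if "Y \<in> VF" for u Y
    using that by (induction rule: VF_induct) (simp_all add: assms(2) D_add2 D'.D_add2 D_scale2 D'.D_scale2)
  have 2: "D X Y = D' X Y" if "X \<in> VF" "Y \<in> VF" for X Y
    using that by (induction rule: VF_induct) (simp_all add: 1 D_add1 D'.D_add1 D_scale1 D'.D_scale1)
  show "D X Y p f = D' X Y p f" for X Y p f
    using 2 D_outside D'.D_outside by (cases "X \<in> VF \<and> Y \<in> VF") auto
qed

lemma vf_push_translation_scale:
  "vf_push (\<lambda>x. g \<cdot> x) (vf_scale f X) = vf_scale (\<lambda>x. f (inver g \<cdot> x)) (vf_push (\<lambda>x. g \<cdot> x) X)"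
  by (simp add: fun_eq_iff fun_ops vf_push_translation vf_scale_apply)

lemma vf_push_translation_add:
  "vf_push (\<lambda>x. g \<cdot> x) (X + Y) = vf_push (\<lambda>x. g \<cdot> x) X + vf_push (\<lambda>x. g \<cdot> x) Y"
  by (simp add: fun_eq_iff fun_ops vf_push_translation)

text \<open>Left translation fixes the frame fields, so the hypothesis is invariance on the frame.
  Coefficients are transported to f(g^-1 x) on both sides alike, and the derivative terms match by
  \<open>left_field_translate\<close>.\<close>

lemma invariant_under_translationI:
  assumes inv: "\<And>u v. vf_push (\<lambda>x. g \<cdot> x) (D (lf u) (lf v)) = D (lf u) (lf v)"
  shows "invariant_under A (\<lambda>x. g \<cdot> x) D"
proof -
  let ?P = "vf_push (\<lambda>x. g \<cdot> x)"
  have P: "?P X \<in> VF" if "X \<in> VF" for X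
    using vf_push_translation_vector_field[OF that] .
  have C': "(\<lambda>x. f (inver g \<cdot> x)) \<in> C" if "f \<in> C" for f
    using smooth_translation[OF that] .
  have PX: "(\<lambda>p. ?P X p (\<lambda>x. f (inver g \<cdot> x))) = (\<lambda>p. X (inver g \<cdot> p) f)" for X f
    by (simp add: vf_push_translation)
  have 1: "?P (D (lf u) Y) = D (lf u) (?P Y)" if "Y \<in> VF" for u Y
    using that
  proof (induction rule: VF_induct)
    case (lf v)
    then show ?case by (simp add: inv vf_push_left_field)
  next
    case (add X Y)
    then show ?case by (simp add: D_add2 P vf_push_translation_add)
  next
    case (scale f X)
    have "(\<lambda>p. lf u p (\<lambda>x. f (inver g \<cdot> x))) = (\<lambda>p. lf u (inver g \<cdot> p) f)"
      by (simp add: left_field_translate)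
    then show ?case
      using scale by (simp add: D_scale2 P C' vf_push_translation_add vf_push_translation_scale)
  qed
  have 2: "?P (D X Y) = D (?P X) (?P Y)" if "X \<in> VF" "Y \<in> VF" for X Y
    using that
    by (induction rule: VF_induct)
      (simp_all add: 1 vf_push_left_field D_add1 D_scale1 P C' vf_push_translation_add vf_push_translation_scale)
  then show ?thesis by (simp add: invariant_under_def)
qed

end

text \<open>Used for \<open>m\<close> and for \<open>half_br\<close>; the second use shows that the
  description defining \<open>nabla0\<close> denotes.\<close>

lemma (in framed_group) ex1_connection_of_product:
  assumes m: "bilinear m"
  shows "\<exists>!D. connection_of_product G A \<iota> m D"
proof (rule ex1I)
  interpret pc: connection G A \<iota> B "product_connection m"
    by unfold_locales (rule linear_connection_product[OF m])
  have "invariant_under A (\<lambda>x. g \<cdot> x) (product_connection m)" for g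
    by (rule pc.invariant_under_translationI) (simp add: product_connection_lf vf_push_left_field)
  then show "connection_of_product G A \<iota> m (product_connection m)"
    by (simp add: connection_of_product_def left_invariant_connection_def pc.D product_connection_lf)
  show "D = product_connection m" if "connection_of_product G A \<iota> m D" for D
    using that pc.connection_eqI[of D]
    by (simp add: connection_of_product_def left_invariant_connection_def product_connection_lf)
qed


section \<open>Torsion and curvature\<close>

locale lie_framed_group = framed_group G A \<iota> B
  for G :: "('g::{t2_space,second_countable_topology}) monoid" and A :: "('g, 'e::euclidean_space) atlas"
    and \<iota> :: "'a::real_vector \<Rightarrow> 'g tvec" and B +
  fixes br :: "'a \<Rightarrow> 'a \<Rightarrow> 'a"
  assumes bracket_unit: "\<iota> (br u v) = vf_bracket (left_field G (\<iota> u)) (left_field G (\<iota> v)) \<one>\<^bsub>G\<^esub>"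
begin

text \<open>The locale fixes the bracket only at the unit. Replacing \<open>f\<close> by its left
  translate by \<open>p\<close> moves the identity to \<open>p\<close>.\<close>

lemma bracket_lf: "vf_bracket (lf u) (lf v) = lf (br u v)"
proof (intro ext)
  fix p f
  have "lf (br u v) p f = lf u unit (\<lambda>q. lf v q (\<lambda>x. f (p \<cdot> x))) - lf v unit (\<lambda>q. lf u q (\<lambda>x. f (p \<cdot> x)))"
    unfolding left_field_apply[of "\<iota> (br u v)" p f] by (simp only: bracket_unit vf_bracket_apply)
  also have "\<dots> = lf u p (\<lambda>q. lf v q f) - lf v p (\<lambda>q. lf u q f)"
    by (simp only: left_field_translate left_field_translate[of _ unit "\<lambda>q. lf _ q f"] group_laws)
  finally show "vf_bracket (lf u) (lf v) p f = lf (br u v) p f"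
    by (simp add: vf_bracket_apply)
qed

text \<open>Closure comes from the frame instead of coordinates: brackets of frame fields are frame
  fields, and sums and function multiples are handled by the bracket rules.\<close>

lemma bracket_VF [simp]:
  assumes "X \<in> VF" "Y \<in> VF"
  shows "vf_bracket X Y \<in> VF"
proof -
  have 1: "vf_bracket (lf u) Y \<in> VF" if "Y \<in> VF" for u Y
    using that
    by (induction rule: VF_induct)
      (simp_all add: bracket_lf vf_bracket_add_right[OF atlas] vf_bracket_scale_right[OF atlas])
  show ?thesis
    using assms
    by (induction rule: VF_induct)
      (simp_all add: 1 vf_bracket_add_left[OF atlas] vf_bracket_scale_left[OF atlas])
qed

end

locale lie_connection = lie_framed_group G A \<iota> B br + connection G A \<iota> B D
  for G :: "('g::{t2_space,second_countable_topology}) monoid" and A :: "('g, 'e::euclidean_space) atlas"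
    and \<iota> :: "'a::real_vector \<Rightarrow> 'g tvec" and B br D
begin

lemmas bracket_rules = vf_bracket_add_left[OF atlas] vf_bracket_add_right[OF atlas]
  vf_bracket_scale_left[OF atlas] vf_bracket_scale_right[OF atlas]

lemmas D_rules = D_add1 D_add2 D_scale1 D_scale2 D_diff1 D_diff2

text \<open>Torsion is tensorial: \<open>D\<close> and the bracket produce the same derivatives of
  coefficient functions. Using the induction hypothesis backwards turns brackets into values of
  \<open>D\<close>, so that this cancellation becomes visible.\<close>

lemma torsion_freeI:
  assumes "\<And>u v. D (lf u) (lf v) - D (lf v) (lf u) = lf (br u v)"
  shows "torsion_free A D"
proof -
  have 1: "D (lf u) Y - D Y (lf u) = vf_bracket (lf u) Y" if "Y \<in> VF" for u Y
    using that
  proof (induction rule: VF_induct)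
    case (scale f X)
    then show ?case
      by (simp add: bracket_rules D_rules flip: scale.IH) (simp add: fun_eq_iff fun_ops vf_scale_apply algebra_simps)
  qed (simp_all add: assms bracket_lf bracket_rules D_rules algebra_simps)
  have 2: "D X Y - D Y X = vf_bracket X Y" if "X \<in> VF" "Y \<in> VF" for X Y
    using that
  proof (induction rule: VF_induct)
    case (scale f X)
    then show ?case
      by (simp add: bracket_rules D_rules flip: scale.IH) (simp add: fun_eq_iff fun_ops vf_scale_apply algebra_simps)
  qed (simp_all add: 1 bracket_rules D_rules algebra_simps)
  then show ?thesis by (simp add: torsion_free_def)
qed

section \<open>Tensoriality of the curvature and of its covariant derivative\<close>

abbreviation "K \<equiv> curvature D"

lemma K_VF [simp]: "X \<in> VF \<Longrightarrow> Y \<in> VF \<Longrightarrow> Z \<in> VF \<Longrightarrow> K X Y Z \<in> VF"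
  by (simp add: curvature_def)

lemma K_add1:
  assumes "X \<in> VF" "X' \<in> VF" "Y \<in> VF" "Z \<in> VF"
  shows "K (X + X') Y Z = K X Y Z + K X' Y Z"
  using assms by (simp add: curvature_def bracket_rules D_rules algebra_simps)

lemma K_scale1:
  assumes "f \<in> C" "X \<in> VF" "Y \<in> VF" "Z \<in> VF"
  shows "K (vf_scale f X) Y Z = vf_scale f (K X Y Z)"
  using assms by (simp add: curvature_def bracket_rules D_rules) (simp add: fun_eq_iff fun_ops vf_scale_apply algebra_simps)

lemma K_add2:
  assumes "X \<in> VF" "Y \<in> VF" "Y' \<in> VF" "Z \<in> VF"
  shows "K X (Y + Y') Z = K X Y Z + K X Y' Z"
  using assms by (simp add: curvature_def bracket_rules D_rules algebra_simps)

lemma K_scale2: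
  assumes "f \<in> C" "X \<in> VF" "Y \<in> VF" "Z \<in> VF"
  shows "K X (vf_scale f Y) Z = vf_scale f (K X Y Z)"
  using assms by (simp add: curvature_def bracket_rules D_rules) (simp add: fun_eq_iff fun_ops vf_scale_apply algebra_simps)

lemma K_add3:
  assumes "X \<in> VF" "Y \<in> VF" "Z \<in> VF" "Z' \<in> VF"
  shows "K X Y (Z + Z') = K X Y Z + K X Y Z'"
  using assms by (simp add: curvature_def D_rules algebra_simps)

text \<open>The second derivatives X(Y f) - Y(X f) are cancelled by the derivative along [X, Y] in
  the last term of the curvature.\<close>

lemma K_scale3:
  assumes "f \<in> C" "X \<in> VF" "Y \<in> VF" "Z \<in> VF"
  shows "K X Y (vf_scale f Z) = vf_scale f (K X Y Z)"
  using assms by (simp add: curvature_def D_rules)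
    (simp add: fun_eq_iff fun_ops vf_scale_apply vf_bracket_apply algebra_simps)

lemmas K_rules = K_add1 K_add2 K_add3 K_scale1 K_scale2 K_scale3

lemma same_curvatureI:
  assumes "lie_connection G A \<iota> B br D'"
    and eq: "\<And>u v w. K (lf u) (lf v) (lf w) = curvature D' (lf u) (lf v) (lf w)"
  shows "same_curvature A D D'"
proof -
  interpret D': lie_connection G A \<iota> B br D' by fact
  have 1: "K (lf u) (lf v) Z = D'.K (lf u) (lf v) Z" if "Z \<in> VF" for u v Z
    using that by (induction rule: VF_induct) (simp_all add: eq K_rules D'.K_rules)
  have 2: "K (lf u) Y Z = D'.K (lf u) Y Z" if "Y \<in> VF" "Z \<in> VF" for u Y Z
    using that by (induction rule: VF_induct) (simp_all add: 1 K_rules D'.K_rules)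
  have "K X Y Z = D'.K X Y Z" if "X \<in> VF" "Y \<in> VF" "Z \<in> VF" for X Y Z
    using that by (induction rule: VF_induct) (simp_all add: 2 K_rules D'.K_rules)
  then show ?thesis by (simp add: same_curvature_def)
qed

text \<open>The covariant derivative of the curvature tensor along \<open>W\<close>, named so that
  its linearity over functions can be stated slot by slot.\<close>

definition DK where
  "DK W X Y Z = D W (K X Y Z) - K (D W X) Y Z - K X (D W Y) Z - K X Y (D W Z)"

lemma DK_add:
  assumes "W \<in> VF" "X \<in> VF" "Y \<in> VF" "Z \<in> VF" "V \<in> VF"
  shows "DK (W + V) X Y Z = DK W X Y Z + DK V X Y Z" "DK W (X + V) Y Z = DK W X Y Z + DK W V Y Z"
    "DK W X (Y + V) Z = DK W X Y Z + DK W X V Z" "DK W X Y (Z + V) = DK W X Y Z + DK W X Y V"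
  using assms by (simp_all add: DK_def D_rules K_rules algebra_simps)

lemma DK_scale:
  assumes "f \<in> C" "W \<in> VF" "X \<in> VF" "Y \<in> VF" "Z \<in> VF"
  shows "DK (vf_scale f W) X Y Z = vf_scale f (DK W X Y Z)" "DK W (vf_scale f X) Y Z = vf_scale f (DK W X Y Z)"
    "DK W X (vf_scale f Y) Z = vf_scale f (DK W X Y Z)" "DK W X Y (vf_scale f Z) = vf_scale f (DK W X Y Z)"
  using assms by (simp_all add: DK_def D_rules K_rules)
    (simp_all add: fun_eq_iff fun_ops vf_scale_apply algebra_simps)

lemma parallel_curvatureI:
  assumes zero: "\<And>a u v w. DK (lf a) (lf u) (lf v) (lf w) = 0"
  shows "parallel_curvature A D"
proof -
  have 1: "DK (lf a) (lf u) (lf v) Z = 0" if "Z \<in> VF" for a u v Z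
    using that by (induction rule: VF_induct) (simp_all add: zero DK_add DK_scale)
  have 2: "DK (lf a) (lf u) Y Z = 0" if "Y \<in> VF" "Z \<in> VF" for a u Y Z
    using that by (induction rule: VF_induct) (simp_all add: 1 DK_add DK_scale)
  have 3: "DK (lf a) X Y Z = 0" if "X \<in> VF" "Y \<in> VF" "Z \<in> VF" for a X Y Z
    using that by (induction rule: VF_induct) (simp_all add: 2 DK_add DK_scale)
  have "DK W X Y Z = 0" if "W \<in> VF" "X \<in> VF" "Y \<in> VF" "Z \<in> VF" for W X Y Z
    using that by (induction rule: VF_induct) (simp_all add: 3 DK_add DK_scale)
  then show ?thesis by (simp add: parallel_curvature_def DK_def)
qed

text \<open>The equation on the frame makes \<open>a\<^sup>+\<close> an affine field of \<open>D\<close>.\<close>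

lemma bracket_connection:
  assumes eq: "\<And>u v. vf_bracket (lf a) (D (lf u) (lf v)) = D (lf (br a u)) (lf v) + D (lf u) (lf (br a v))"
    and "X \<in> VF" "Y \<in> VF"
  shows "vf_bracket (lf a) (D X Y) = D (vf_bracket (lf a) X) Y + D X (vf_bracket (lf a) Y)"
proof -
  have 1: "vf_bracket (lf a) (D (lf u) Y) = D (lf (br a u)) Y + D (lf u) (vf_bracket (lf a) Y)"
    if "Y \<in> VF" for u Y
    using that
  proof (induction rule: VF_induct)
    case (lf v)
    then show ?case by (simp add: eq bracket_lf)
  next
    case (add X Y)
    then show ?case by (simp add: bracket_rules D_rules)
  next
    \<comment> \<open>The second derivatives of \<open>f\<close> match because a(u f) = [a,u] f +
      u(a f). For this \<open>bracket_lf\<close> is read backwards, so that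
      \<open>lf (br a u)\<close> unfolds as a commutator.\<close>
    case (scale f Y)
    then show ?case
      by (simp add: bracket_rules D_rules flip: bracket_lf)
        (simp add: fun_eq_iff fun_ops vf_scale_apply vf_bracket_apply algebra_simps)
  qed
  show ?thesis
    using assms(2,3)
  proof (induction rule: VF_induct)
    case (lf u)
    then show ?case by (simp add: 1 bracket_lf)
  next
    case (add X Y)
    then show ?case by (simp add: bracket_rules D_rules)
  next
    case (scale f X)
    then show ?case
      by (simp add: bracket_rules D_rules) (simp add: fun_eq_iff fun_ops vf_scale_apply algebra_simps)
  qed
qed

lemma invariant_under_right_translation:
  assumes conn: "connected (UNIV :: 'g set)"
    and eq: "\<And>a u v. vf_bracket (lf a) (D (lf u) (lf v)) = D (lf (br a u)) (lf v) + D (lf u) (lf (br a v))"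
  shows "invariant_under A (\<lambda>x. x \<cdot> g) D"
proof -
  interpret opp: framed_group "opposite_group G" A \<iota> B
    by (rule framed_group_opposite) unfold_locales
  interpret opp: connection "opposite_group G" A \<iota> B D
    by unfold_locales (rule D)
  have comm: "vf_bracket (lf a) (opp.lf u) = 0" for a u
    by (rule left_right_commute[OF iota_tangent iota_tangent])
  have "vf_push (\<lambda>x. x \<cdot> g) (D (opp.lf u) (opp.lf v)) = D (opp.lf u) (opp.lf v)" for u v
  proof -
    have "vf_bracket (lf a) (D (opp.lf u) (opp.lf v)) = 0" for a
      using bracket_connection[OF eq opp.lf_VF opp.lf_VF] by (simp add: comm D_zero1 D_zero2)
    from commute_imp_right_invariant[OF conn opp.D_VF[OF opp.lf_VF opp.lf_VF] this]
    obtain w where "D (opp.lf u) (opp.lf v) = opp.lf w" .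
    then show ?thesis using opp.vf_push_left_field[of g "\<iota> w"] by simp
  qed
  then show ?thesis using opp.invariant_under_translationI[of g] by simp
qed

end

section \<open>Symmetric Leibniz algebras\<close>

locale symmetric_leibniz =
  fixes m :: "'a::real_vector \<Rightarrow> 'a \<Rightarrow> 'a"
  assumes leibniz: "symmetric_leibniz_algebra m"
begin

definition br where "br u v = m u v - m v u"

lemma bilinear_m: "bilinear m"
  using leibniz by (simp add: symmetric_leibniz_algebra_def)

lemmas m_rules = bilinear_ladd[OF bilinear_m] bilinear_radd[OF bilinear_m]
  bilinear_lmul[OF bilinear_m] bilinear_rmul[OF bilinear_m]
  bilinear_lsub[OF bilinear_m] bilinear_rsub[OF bilinear_m]
  bilinear_lzero[OF bilinear_m] bilinear_rzero[OF bilinear_m]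

lemma left_leibniz: "m u (m v w) = m (m u v) w + m v (m u w)"
  and right_leibniz: "m (m v w) u = m (m v u) w + m v (m w u)"
  using leibniz unfolding symmetric_leibniz_algebra_def is_derivation_def by blast+

text \<open>The left Leibniz rule in the form
  \<open>L\<^sub>u\<^sub>.\<^sub>v = [L\<^sub>u, L\<^sub>v]\<close>, with the commutator of left
  multiplications on the right.\<close>

lemma left_mult_mult: "m (m u v) w = m u (m v w) - m v (m u w)"
  unfolding left_leibniz[of u v w] by simp

text \<open>The left rule writes w.(u.v) as u.(w.v) - (u.w).v, and the right rule writes (u.w).v as
  (u.v).w + u.(w.v). Having both rules is what forces the sign.\<close>

lemma products_anticommute: "m w (m u v) = - m (m u v) w"
proof -
  have "m w (m u v) = m u (m w v) - m (m u w) v"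
    unfolding left_leibniz[of u w v] by simp
  also have "m (m u w) v = m (m u v) w + m u (m w v)"
    by (rule right_leibniz)
  finally show ?thesis by simp
qed

text \<open>Immediate from \<open>left_mult_mult\<close>, since commutators are
  antisymmetric.\<close>

lemma left_mult_antisym: "m (m u v) w = - m (m v u) w"
  unfolding left_mult_mult by simp

text \<open>Bracketing with \<open>a\<close> is left minus right multiplication, a difference of two
  derivations.\<close>

lemma br_derivation: "br a (m u v) = m (br a u) v + m u (br a v)"
  unfolding br_def m_rules left_leibniz[of a u v] right_leibniz[of u v a] by simp

text \<open>A derivation of the product is one of its commutator; applied to \<open>br u\<close>
  this is the Jacobi identity.\<close>

lemma br_jacobi: "br u (br v w) - br v (br u w) = br (br u v) w"
proof -
  have "br u (br v w) = br u (m v w) - br u (m w v)"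
    by (simp add: br_def m_rules)
  also have "\<dots> = m (br u v) w + m v (br u w) - m (br u w) v - m w (br u v)"
    by (simp add: br_derivation)
  also have "\<dots> = br (br u v) w + br v (br u w)" by (simp add: br_def)
  finally show ?thesis by simp
qed

text \<open>One factor 2 arises because \<open>br u v\<close>, a difference of products,
  anticommutes with \<open>w\<close>; the other because left multiplications by u.v and v.u are
  opposite.\<close>

lemma br_br: "br (br u v) w = - 4 *\<^sub>R m (m v u) w"
proof -
  have "m w (br u v) = - m (br u v) w"
    unfolding br_def m_rules products_anticommute[of w] by simp
  then have "br (br u v) w = 2 *\<^sub>R m (br u v) w"
    by (simp add: br_def[of "br u v"] scaleR_2)
  also have "m (br u v) w = - 2 *\<^sub>R m (m v u) w"
    unfolding br_def m_rules left_mult_antisym[of u v w] by (simp add: scaleR_2)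
  finally show ?thesis by simp
qed

text \<open>The commutator of left multiplications is left multiplication by u.v; subtracting that
  by u.v - v.u leaves v.u.\<close>

lemma curvature_product:
  "m u (m v w) - m v (m u w) - m (br u v) w = m (m v u) w"
  unfolding br_def m_rules left_leibniz[of u v w] by simp

text \<open>The product whose connection is \<open>nabla0\<close>.\<close>

definition half_br where "half_br u v = (1/2) *\<^sub>R br u v"

lemma bilinear_half_br: "bilinear half_br"
  by (auto simp: bilinear_def half_br_def br_def m_rules algebra_simps intro!: linearI)

text \<open>Jacobi gives 1/4 - 1/2 = -1/4 times [[u,v],w], and the factor -4 of \<open>br_br\<close>
  turns this into the curvature of \<open>m\<close>.\<close>

lemma curvature_half_br:
  "half_br u (half_br v w) - half_br v (half_br u w) - half_br (br u v) w = m (m v u) w"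
proof -
  have "half_br u (half_br v w) - half_br v (half_br u w) = (1/4) *\<^sub>R (br u (br v w) - br v (br u w))"
    by (simp add: half_br_def br_def m_rules algebra_simps)
  then show ?thesis
    by (simp add: br_jacobi half_br_def[of "br u v"] br_br scaleR_2)
qed

lemma half_br_derivation: "half_br a (m u v) = m (half_br a u) v + m u (half_br a v)"
  by (simp add: half_br_def br_derivation m_rules scaleR_right_distrib)

text \<open>Equality would make \<open>m\<close> antisymmetric, and for an antisymmetric product the
  left Leibniz rule is the Jacobi identity.\<close>

lemma not_lie_imp_ne_half_br:
  assumes "\<not> is_lie_algebra m"
  shows "m \<noteq> half_br"
proof
  assume eq: "m = half_br"
  have antisym: "m u v = - m v u" for u v
  proof -
    have "2 *\<^sub>R m u v = m u v - m v u"
      by (subst (1) eq) (simp add: half_br_def br_def)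
    then show ?thesis by (simp add: scaleR_2 eq_neg_iff_add_eq_0)
  qed
  have "m u u = 0" for u
  proof -
    have "2 *\<^sub>R m u u = 0"
      using antisym[of u u] by (simp only: scaleR_2 eq_neg_iff_add_eq_0)
    then show ?thesis by simp
  qed
  moreover have "m u (m v w) + m v (m w u) + m w (m u v) = 0" for u v w
    unfolding left_leibniz[of u v w] antisym[of "m u v" w] antisym[of w u] bilinear_rneg[OF bilinear_m] by simp
  ultimately have "is_lie_algebra m" using bilinear_m by (simp add: is_lie_algebra_def)
  with assms show False by simp
qed

definition products where "products = span {m u v |u v. True}"

lemma m_products: "m u v \<in> products"
  unfolding products_def by (rule span_base) auto

lemma half_br_products: "half_br u v \<in> products"
  using m_products unfolding half_br_def br_def products_def by (intro span_scale span_diff)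

end


section \<open>The holonomy algebra\<close>

context framed_group
begin

abbreviation T where "T \<equiv> tangent_space A unit"

lemma pullback_unit [simp]: "pullback unit (\<iota> u) = u"
  using pullback_lf[of unit u] by simp

text \<open>Conjugation by \<iota>, carrying maps of the algebra to maps of the tangent space at the
  unit; the value 0 elsewhere follows the convention of \<open>endomorphisms\<close>.\<close>

definition transport where
  "transport \<phi> t = (if t \<in> T then \<iota> (\<phi> (pullback unit t)) else 0)"

lemma transport_iota [simp]: "transport \<phi> (\<iota> u) = \<iota> (\<phi> u)"
  by (simp add: transport_def iota_tangent)

lemma transport_eqI:
  assumes "\<And>u. S (\<iota> u) = \<iota> (\<phi> u)" "\<And>t. t \<notin> T \<Longrightarrow> S t = 0"
  shows "S = transport \<phi>"
proof
  fix t show "S t = transport \<phi> t"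
    using assms by (cases "t \<in> T") (auto elim: tangent_unitE simp: transport_def iota_tangent)
qed

lemma iota_zero: "\<iota> 0 = 0"
  using iota_scale[of 0 0] by (simp add: zero_fun_def)

lemma iota_diff: "\<iota> (u - v) = \<iota> u - \<iota> v"
  using iota_add[of "u - v" v] by (simp add: eq_diff_eq)

lemma transport_endomorphism:
  assumes "linear \<phi>"
  shows "transport \<phi> \<in> endomorphisms T"
  unfolding endomorphisms_def
proof (intro CollectI conjI ballI allI impI)
  fix s t c assume s: "s \<in> T"
  obtain u where u: "s = \<iota> u" using tangent_unitE[OF s] .
  show "transport \<phi> s \<in> T" by (simp add: u iota_tangent)
  show "transport \<phi> (\<lambda>f. c * s f) = (\<lambda>f. c * transport \<phi> s f)"
    using transport_iota[of \<phi> "c *\<^sub>R u"] by (simp add: u iota_scale linear_cmul[OF assms])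
  show "transport \<phi> (s + t) = transport \<phi> s + transport \<phi> t" if t: "t \<in> T"
  proof -
    obtain v where v: "t = \<iota> v" using tangent_unitE[OF t] .
    show ?thesis
      using transport_iota[of \<phi> "u + v"] by (simp add: u v iota_add linear_add[OF assms])
  qed
qed (simp add: transport_def)

lemma commutator_transport:
  assumes "linear \<phi>" "linear \<psi>"
  shows "commutator (transport \<phi>) (transport \<psi>) = transport (\<lambda>w. \<phi> (\<psi> w) - \<psi> (\<phi> w))"
proof (rule transport_eqI)
  \<comment> \<open>Outside \<open>T\<close> the inner map returns 0, which itself lies in
    \<open>T\<close>; linearity is needed for the outer map to return 0 as well.\<close>
  have "transport \<phi> 0 = 0" "transport \<psi> 0 = 0"
    using transport_iota[of \<phi> 0] transport_iota[of \<psi> 0] assms by (simp_all add: iota_zero linear_0)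
  moreover have "transport \<xi> t = 0" if "t \<notin> T" for \<xi> t
    using that by (simp add: transport_def)
  ultimately show "commutator (transport \<phi>) (transport \<psi>) t = 0" if "t \<notin> T" for t
    using that by (simp add: commutator_def)
qed (simp add: commutator_def iota_diff)

lemma transport_add: "transport \<phi> + transport \<psi> = transport (\<lambda>w. \<phi> w + \<psi> w)"
proof (rule transport_eqI)
  show "(transport \<phi> + transport \<psi>) t = 0" if "t \<notin> T" for t
    using that by (simp add: transport_def fun_ops)
qed (simp add: fun_ops iota_add)

lemma transport_scale: "(\<lambda>t f. c * transport \<phi> t f) = transport (\<lambda>w. c *\<^sub>R \<phi> w)"
proof (rule transport_eqI)
  show "(\<lambda>f. c * transport \<phi> t f) = 0" if "t \<notin> T" for t
    using that by (simp add: transport_def fun_eq_iff fun_ops)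
qed (simp add: iota_scale)

end

lemma (in connection) left_mult_End_eq_transport:
  assumes "\<And>u v. D (lf u) (lf v) = lf (n u v)"
  shows "left_mult_End G A D (\<iota> u) = transport (n u)"
  by (rule transport_eqI) (simp_all add: left_mult_End_def iota_tangent assms)

lemma (in connection) curvature_End_eq_transport:
  assumes "\<And>u v w. curvature D (lf u) (lf v) (lf w) = lf (k u v w)"
  shows "curvature_End G A D (\<iota> u) (\<iota> v) = transport (k u v)"
  by (rule transport_eqI) (simp_all add: curvature_End_def iota_tangent assms)

locale leibniz_lie_connection =
  symmetric_leibniz m + lie_connection G A \<iota> B "\<lambda>u v. m u v - m v u" D
  for m :: "'a::real_vector \<Rightarrow> 'a \<Rightarrow> 'a"
    and G :: "('g::{t2_space,second_countable_topology}) monoid" and A :: "('g, 'e::euclidean_space) atlas"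
    and \<iota> :: "'a \<Rightarrow> 'g tvec" and B D
begin

text \<open>Stated for a second product \<open>n\<close> so as to cover both \<open>m\<close> and
  \<open>half_br\<close>. The curvatures are left multiplications by products and already span the
  claimed set, which is closed under all operations because \<open>n u\<close> is a derivation of
  \<open>m\<close> that maps into \<open>products\<close>. As [[u,v],w] = -4 (v.u).w, the set is the
  adjoint action of the derived algebra.\<close>

lemma holonomy_algebra_eq:
  assumes D_eq: "\<And>u v. D (lf u) (lf v) = lf (n u v)" and n: "bilinear n"
    and K_eq: "\<And>u v w. K (lf u) (lf v) (lf w) = lf (m (m v u) w)"
    and n_der: "\<And>a u v. n a (m u v) = m (n a u) v + m u (n a v)"
    and n_products: "\<And>u v. n u v \<in> products"
  shows "holonomy_algebra G A D = (\<lambda>z. transport (m z)) ` products"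
proof -
  let ?H = "(\<lambda>z. transport (m z)) ` products"
  define F where "F = {\<h>. lie_subalgebra_End T \<h> \<and>
    (\<forall>u\<in>T. \<forall>v\<in>T. curvature_End G A D u v \<in> \<h>) \<and>
    (\<forall>u\<in>T. \<forall>S\<in>\<h>. commutator (left_mult_End G A D u) S \<in> \<h>)}"
  have hol: "holonomy_algebra G A D = \<Inter> F"
    by (simp add: holonomy_algebra_def F_def)
  have lin: "linear (m z)" "linear (n z)" for z
    using bilinear_m n by (simp_all add: bilinear_def)
  have left_mult: "left_mult_End G A D (\<iota> u) = transport (n u)" for u
    by (rule left_mult_End_eq_transport[OF D_eq])
  have curv: "curvature_End G A D (\<iota> u) (\<iota> v) = transport (m (m v u))" for u v
    by (rule curvature_End_eq_transport[OF K_eq])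
  have "?H \<in> F"
    unfolding F_def lie_subalgebra_End_def
  proof (intro CollectI conjI ballI allI)
    show "?H \<subseteq> endomorphisms T" using transport_endomorphism[OF lin(1)] by auto
    have "transport (m 0) = 0"
      by (rule transport_eqI[symmetric]) (simp_all add: fun_ops m_rules iota_zero)
    moreover have "0 \<in> products" unfolding products_def by (rule span_zero)
    ultimately show "0 \<in> ?H" by force
  next
    fix S T' assume "S \<in> ?H" "T' \<in> ?H"
    then obtain x y where xy: "S = transport (m x)" "T' = transport (m y)" "x \<in> products" "y \<in> products"
      by auto
    have "S + T' = transport (m (x + y))" by (simp add: xy transport_add m_rules[abs_def])
    moreover have "x + y \<in> products" using xy unfolding products_def by (intro span_add)
    ultimately show "S + T' \<in> ?H" by blast
    \<comment> \<open>Closure under commutators is the left Leibniz rule again.\<close>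
    have "commutator S T' = transport (m (m x y))"
      unfolding left_mult_mult by (simp add: xy commutator_transport lin)
    then show "commutator S T' \<in> ?H" using m_products by blast
  next
    fix c S assume "S \<in> ?H"
    then obtain x where x: "S = transport (m x)" "x \<in> products" by auto
    have "(\<lambda>v f. c * S v f) = transport (m (c *\<^sub>R x))"
      by (simp add: x transport_scale m_rules[abs_def])
    moreover have "c *\<^sub>R x \<in> products" using x unfolding products_def by (intro span_scale)
    ultimately show "(\<lambda>v f. c * S v f) \<in> ?H" by blast
  next
    fix s t assume "s \<in> T" "t \<in> T"
    then obtain u v where "s = \<iota> u" "t = \<iota> v" by (metis tangent_unitE)
    then show "curvature_End G A D s t \<in> ?H" using curv m_products by blast
  next
    fix s S assume "s \<in> T" "S \<in> ?H"
    then obtain u x where ux: "s = \<iota> u" "S = transport (m x)" by (metis tangent_unitE imageE)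
    \<comment> \<open>A derivation d satisfies \<open>[d, L\<^sub>x] = L\<^sub>d\<^sub>x\<close>;
      here d is \<open>n u\<close>.\<close>
    have "commutator (left_mult_End G A D s) S = transport (m (n u x))"
      using n_der[of u x] by (simp add: ux left_mult commutator_transport lin)
    then show "commutator (left_mult_End G A D s) S \<in> ?H" using n_products by blast
  qed
  moreover have "?H \<subseteq> \<h>" if \<h>: "\<h> \<in> F" for \<h>
  proof -
    \<comment> \<open>Minimality: for z = v.u this is the curvature of u and v, in that order, and
      linear combinations stay in the subalgebra.\<close>
    have "transport (m z) \<in> \<h>" if "z \<in> products" for z
      using that unfolding products_def
    proof (induction rule: span_induct_alt)
      case base
      have "transport (m 0) = 0"
        by (rule transport_eqI[symmetric]) (simp_all add: fun_ops m_rules iota_zero)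
      then show ?case using \<h> by (simp add: F_def lie_subalgebra_End_def)
    next
      case (step c x y)
      then obtain u v where x: "x = m v u" by auto
      have "transport (m x) \<in> \<h>"
        using \<h> curv[of u v] iota_tangent by (auto simp: F_def x) metis
      then have "(\<lambda>v f. c * transport (m x) v f) + transport (m y) \<in> \<h>"
        using \<h> step.IH by (simp add: F_def lie_subalgebra_End_def)
      then show ?case by (simp add: transport_scale transport_add m_rules[abs_def])
    qed
    then show ?thesis by blast
  qed
  ultimately show ?thesis unfolding hol by blast
qed

end

text \<open>The first conjunct states that the prescription on left invariant fields determines a
  connection, so that the second speaks of one object. The finite spanning set expresses finite
  dimension.\<close>

theorem corollary3p2:
  fixes m :: "'a::real_vector \<Rightarrow> 'a \<Rightarrow> 'a"
    and G :: "('g::{t2_space,second_countable_topology}) monoid"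
    and A :: "('g, 'e::euclidean_space) atlas"
    and \<iota> :: "'a \<Rightarrow> 'g tvec"
  assumes "\<exists>B. finite B \<and> span B = (UNIV :: 'a set)"
    and "symmetric_leibniz_algebra m"
    and "\<not> is_lie_algebra m"
    and "lie_group G A"
    and "connected (UNIV :: 'g set)"
    and "lie_algebra_identification G A (\<lambda>u v. m u v - m v u) \<iota>"
  shows "(\<exists>!D. connection_of_product G A \<iota> m D) \<and>
         (\<forall>D. connection_of_product G A \<iota> m D \<longrightarrow>
            D \<noteq> nabla0 G A \<and>
            strongly_special_connection G A D \<and>
            parallel_curvature A D)"
proof -
  obtain B :: "'a set" where B: "finite B" "independent B" "span B = UNIV"
  proof -
    obtain S :: "'a set" where S: "finite S" "span S = UNIV" using assms(1) by blast
    obtain B where "B \<subseteq> S" "independent B" "S \<subseteq> span B" using maximal_independent_subset[of S] by metis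
    moreover from this have "span B = UNIV"
      using span_minimal[OF _ subspace_span, of S B] S(2) by auto
    ultimately show thesis using that[of B] finite_subset[OF _ S(1)] by blast
  qed
  interpret symmetric_leibniz m by unfold_locales (rule assms(2))
  interpret lie_framed_group G A \<iota> B "\<lambda>u v. m u v - m v u"
    using assms(4,6) B by unfold_locales (simp_all add: lie_algebra_identification_def)
  obtain D0 where D0: "connection_of_product G A \<iota> half_br D0"
    using ex1_connection_of_product[OF bilinear_half_br] by blast
  \<comment> \<open>The description of \<open>nabla0\<close> quantifies over tangent vectors,
    \<open>connection_of_product\<close> over algebra elements; surjectivity of \<iota> onto
    \<open>T\<close> identifies them.\<close>
  have nabla0: "nabla0 G A = D0"
  proof -
    have "lf (half_br u v) = vf_scale (\<lambda>_. 1/2) (vf_bracket (lf u) (lf v))" for u v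
      by (simp add: half_br_def lf_scale_field bracket_lf br_def)
    then have "left_invariant_connection G A D \<and>
        (\<forall>u\<in>T. \<forall>v\<in>T. D (left_field G u) (left_field G v) =
             vf_scale (\<lambda>_. 1/2) (vf_bracket (left_field G u) (left_field G v)))
        \<longleftrightarrow> connection_of_product G A \<iota> half_br D" for D
      unfolding connection_of_product_def using iota_tangent by (metis tangent_unitE)
    then show ?thesis
      unfolding nabla0_def using ex1_connection_of_product[OF bilinear_half_br] D0 by auto
  qed
  have "D \<noteq> nabla0 G A \<and> strongly_special_connection G A D \<and> parallel_curvature A D"
    if D: "connection_of_product G A \<iota> m D" for D
  proof (intro conjI)
    have D_lf: "D (lf u) (lf v) = lf (m u v)" and D0_lf: "D0 (lf u) (lf v) = lf (half_br u v)" for u v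
      using D D0 by (simp_all add: connection_of_product_def)
    interpret D: leibniz_lie_connection m G A \<iota> B D
      using D by unfold_locales (simp add: connection_of_product_def left_invariant_connection_def)
    interpret D0: leibniz_lie_connection m G A \<iota> B D0
      using D0 by unfold_locales (simp add: connection_of_product_def left_invariant_connection_def)
    have K: "D.K (lf u) (lf v) (lf w) = lf (m (m v u) w)" for u v w
      using curvature_product[of u v w]
      by (simp add: curvature_def bracket_lf D_lf br_def flip: lf_diff_field)
    have K0: "D0.K (lf u) (lf v) (lf w) = lf (m (m v u) w)" for u v w
      using curvature_half_br[of u v w]
      by (simp add: curvature_def bracket_lf D0_lf br_def flip: lf_diff_field)
    show "D \<noteq> nabla0 G A"
    proof
      assume "D = nabla0 G A"
      then have "lf (m u v) = lf (half_br u v)" for u v using D_lf D0_lf nabla0 by metis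
      then have "m = half_br" unfolding lf_field_inj by (intro ext)
      then show False using not_lie_imp_ne_half_br[OF assms(3)] by simp
    qed
    show "parallel_curvature A D"
    proof (rule D.parallel_curvatureI)
      fix a u v w
      \<comment> \<open>Left multiplication by \<open>a\<close> is a derivation of the iterated
        product (v.u).w. The terms appear with \<open>u\<close> and \<open>v\<close> exchanged
        because the curvature of u and v multiplies by v.u.\<close>
      have "m a (m (m v u) w) - m (m v (m a u)) w - m (m (m a v) u) w - m (m v u) (m a w) = 0"
        unfolding left_leibniz[of a "m v u" w] left_leibniz[of a v u] m_rules by simp
      then show "D.DK (lf a) (lf u) (lf v) (lf w) = 0"
        by (simp add: D.DK_def K D_lf flip: lf_diff_field)
    qed
    have "torsion_free A D"
      by (rule D.torsion_freeI) (simp add: D_lf flip: lf_diff_field)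
    moreover have "same_curvature A D (nabla0 G A)"
      unfolding nabla0 by (rule D.same_curvatureI) (unfold_locales, simp add: K K0)
    moreover have "bi_invariant_connection G A D"
    proof -
      \<comment> \<open>The derivation property of the bracket, read on left invariant fields, makes
        them affine fields of \<open>D\<close>.\<close>
      have "vf_bracket (lf a) (D (lf u) (lf v)) = D (lf (m a u - m u a)) (lf v) + D (lf u) (lf (m a v - m v a))"
        for a u v
        using br_derivation[of a u v] by (simp add: D_lf bracket_lf br_def flip: lf_add_field)
      from D.invariant_under_right_translation[OF assms(5) this] show ?thesis
        using D by (simp add: bi_invariant_connection_def connection_of_product_def
            left_invariant_connection_def)
    qed
    \<comment> \<open>Both algebras equal the same set: left multiplications are derivations in one
      case, half brackets in the other.\<close>
    moreover have "holonomy_algebra G A D = holonomy_algebra G A (nabla0 G A)"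
      unfolding nabla0
      using D.holonomy_algebra_eq[OF D_lf bilinear_m K left_leibniz m_products]
        D0.holonomy_algebra_eq[OF D0_lf bilinear_half_br K0 half_br_derivation half_br_products] by simp
    ultimately show "strongly_special_connection G A D"
      by (simp add: strongly_special_connection_def special_connection_def)
  qed
  then show ?thesis using ex1_connection_of_product[OF bilinear_m] by blast
qed

end
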